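(* Let $\mathfrak M$ be the variety of all metabelian algebras over a field $F$ of characteristic $0$, i.e. the variety defined by the single identity $(xy)(zt)=0$. For an arbitrary pair $(r,s)\neq(0,0)$ of nonnegative integers, the variety of algebras generated by the Grassmann envelope of the free $\mathfrak M_{r,s}$-superalgebra has the unique basic superrank $(r,s)$; that is, its basic spectrum equals $\{(r,s)\}$.
   Context: All algebras are over a field $F$ of characteristic $0$ and are not assumed associative or unital. A superalgebra is a $\mathbb Z_2$-graded algebra $\mathcal A=\mathcal A_0+\mathcal A_1$, $\mathcal A_i\mathcal A_j\subseteq\mathcal A_{i+j \bmod 2}$. $\mathrm G=\mathrm G_0+\mathrm G_1$ is the Grassmann algebra on countably many anticommuting generators $e_1,e_2,\dots$ ($\mathrm G_0$, $\mathrm G_1$ spanned by words of even, resp. odd, length). The Grassmann envelope of $\mathcal A$ is $\mathrm G(\mathcal A)=\mathrm G_0\otimes\mathcal A_0+\mathrm G_1\otimes\mathcal A_1\subseteq \mathrm G\otimes\mathcal A$. For a multilinear polynomial $f$, its superization $\tilde f$ is obtained by the Koszul sign rule (a sign $(-1)^{ij}$ whenever a variable of parity $i$ passes through one of parity $j$); $\mathcal A$ satisfies the superidentity $\tilde f=0$ if and only if $\mathrm G(\mathcal A)$ satisfies $f=0$. For a variety $\mathcal V$, a $\mathcal V$-superalgebra is a superalgebra $\mathcal A$ with $\mathrm G(\mathcal A)\in\mathcal V$; $\tilde{\mathcal V}$ is the class of all $\mathcal V$-superalgebras. The supervariety generated by a superalgebra $\mathcal B$ is the class of all superalgebras satisfying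 every superidentity $\tilde f=0$ ($f$ multilinear) satisfied by $\mathcal B$. For nonnegative integers $(r,s)\ne(0,0)$, $\mathcal V_{r,s}$ is the supervariety generated by the free $\mathcal V$-superalgebra on $r$ even and $s$ odd generators; $\mathcal V_{0,0}=\{\{0\}\}$. A pair $(r,s)$ is a basic superrank of $\mathcal V$ if $\mathcal V_{r,s}=\tilde{\mathcal V}$ and $(r,s)$ is minimal with this property, i.e. $\mathcal V_{r',s'}\ne\tilde{\mathcal V}$ for every $(r',s')\neq(r,s)$ with $r'\leqslant r$, $s'\leqslant s$. The basic spectrum of $\mathcal V$ is the set of all (finite) basic superranks of $\mathcal V$. The free $\mathfrak M_{r,s}$-superalgebra is the free superalgebra of the supervariety $\mathfrak M_{r,s}$ on a countable set of even and a countable set of odd generators. *)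

theory Defs
  imports
    Complex_Main
    "HOL-Algebra.Module"
    "HOL-Algebra.QuotRing"
    "HOL-Library.Poly_Mapping"
    "HOL-Library.Z2"
begin

section \<open>Nonassociative algebras and superalgebras\<close>

definition scalars :: "'f::field ring"
  where "scalars = \<lparr>carrier = UNIV, mult = (*), one = 1, zero = 0, add = (+)\<rparr>"

text \<open>
  The records \<^type>\<open>module\<close> and \<open>superalg\<close> inherit a component \<^const>\<open>one\<close> from
  \<^type>\<open>ring\<close>. No axiom below mentions it: algebras are not assumed unital, nor associative.
\<close>

locale nonassoc_algebra = module "scalars :: 'f ring" A
  for A :: "('f::field, 'a, 'm) module_scheme" (structure) +
  assumes mult_closed: "\<lbrakk>x \<in> carrier A; y \<in> carrier A\<rbrakk> \<Longrightarrow> x \<otimes> y \<in> carrier A"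
    and mult_l_distr:
      "\<lbrakk>x \<in> carrier A; y \<in> carrier A; z \<in> carrier A\<rbrakk> \<Longrightarrow> (x \<oplus> y) \<otimes> z = x \<otimes> z \<oplus> y \<otimes> z"
    and mult_r_distr:
      "\<lbrakk>x \<in> carrier A; y \<in> carrier A; z \<in> carrier A\<rbrakk> \<Longrightarrow> x \<otimes> (y \<oplus> z) = x \<otimes> y \<oplus> x \<otimes> z"
    and mult_smult_l:
      "\<lbrakk>x \<in> carrier A; y \<in> carrier A\<rbrakk> \<Longrightarrow> (c \<odot> x) \<otimes> y = c \<odot> (x \<otimes> y)"
    and mult_smult_r:
      "\<lbrakk>x \<in> carrier A; y \<in> carrier A\<rbrakk> \<Longrightarrow> x \<otimes> (c \<odot> y) = c \<odot> (x \<otimes> y)"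

record ('f, 'a) superalg = "('f, 'a) module" +
  grade :: "bit \<Rightarrow> 'a set"

locale superalgebra = nonassoc_algebra A
  for A :: "('f::field, 'a, 'm) superalg_scheme" (structure) +
  assumes grade_submodule: "submodule (grade A i) (scalars :: 'f ring) A"
    and grade_disjoint: "grade A 0 \<inter> grade A 1 = {\<zero>}"
    and grade_sum: "x \<in> carrier A \<Longrightarrow> \<exists>x0\<in>grade A 0. \<exists>x1\<in>grade A 1. x = x0 \<oplus> x1"
    and grade_mult: "\<lbrakk>x \<in> grade A i; y \<in> grade A j\<rbrakk> \<Longrightarrow> x \<otimes> y \<in> grade A (i + j)"

definition graded_ideal :: "'a set \<Rightarrow> ('f::field, 'a) superalg \<Rightarrow> bool"
  where "graded_ideal J A \<longleftrightarrow>
    submodule J (scalars :: 'f ring) A \<and>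
    (\<forall>x\<in>J. \<forall>y\<in>carrier A. x \<otimes>\<^bsub>A\<^esub> y \<in> J \<and> y \<otimes>\<^bsub>A\<^esub> x \<in> J) \<and>
    (\<forall>x\<in>J. \<exists>x0\<in>J \<inter> grade A 0. \<exists>x1\<in>J \<inter> grade A 1. x = x0 \<oplus>\<^bsub>A\<^esub> x1)"

definition quotient_superalg :: "('f, 'a) superalg \<Rightarrow> 'a set \<Rightarrow> ('f, 'a set) superalg"
  where "quotient_superalg A J =
    \<lparr>carrier = a_rcosets\<^bsub>A\<^esub> J, mult = rcoset_mult A J, one = J +>\<^bsub>A\<^esub> \<one>\<^bsub>A\<^esub>,
     zero = J, add = set_add A,
     smult = (\<lambda>c K. \<Union>x\<in>K. J +>\<^bsub>A\<^esub> (c \<odot>\<^bsub>A\<^esub> x)),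
     grade = (\<lambda>i. (\<lambda>x. J +>\<^bsub>A\<^esub> x) ` grade A i)\<rparr>"


section \<open>Nonassociative polynomials, identities, varieties\<close>

datatype 'x word = Var 'x | Times "'x word" "'x word"

primrec letters :: "'x word \<Rightarrow> 'x list" where
  "letters (Var x) = [x]"
| "letters (Times u v) = letters u @ letters v"

type_synonym ('x, 'f) npoly = "'x word \<Rightarrow>\<^sub>0 'f"

primrec eval_word :: "('f, 'a, 'm) module_scheme \<Rightarrow> ('x \<Rightarrow> 'a) \<Rightarrow> 'x word \<Rightarrow> 'a" where
  "eval_word A v (Var x) = v x"
| "eval_word A v (Times u w) = eval_word A v u \<otimes>\<^bsub>A\<^esub> eval_word A v w"

definition eval_npoly ::
    "('f::field, 'a, 'm) module_scheme \<Rightarrow> ('x \<Rightarrow> 'a) \<Rightarrow> ('x, 'f) npoly \<Rightarrow> 'a"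
  where "eval_npoly A v f =
    (\<Oplus>\<^bsub>A\<^esub>w\<in>Poly_Mapping.keys f. Poly_Mapping.lookup f w \<odot>\<^bsub>A\<^esub> eval_word A v w)"

definition satisfies :: "('f::field, 'a, 'm) module_scheme \<Rightarrow> (nat, 'f) npoly \<Rightarrow> bool"
  where "satisfies A f \<longleftrightarrow> (\<forall>v. range v \<subseteq> carrier A \<longrightarrow> eval_npoly A v f = \<zero>\<^bsub>A\<^esub>)"

text \<open>
  A variety is represented by a set of defining identities, so that membership makes sense for
  algebras over every carrier type.
\<close>

definition in_variety :: "(nat, 'f::field) npoly set \<Rightarrow> ('f, 'a) module \<Rightarrow> bool"
  where "in_variety I A \<longleftrightarrow> nonassoc_algebra A \<and> (\<forall>f\<in>I. satisfies A f)"

definition variety_generated_by :: "('f::field, 'a) module \<Rightarrow> (nat, 'f) npoly set"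
  where "variety_generated_by A = {f. satisfies A f}"

definition metabelian :: "(nat, 'f::field) npoly set"
  where "metabelian =
    {Poly_Mapping.single (Times (Times (Var 0) (Var 1)) (Times (Var 2) (Var 3))) 1}"


section \<open>Grassmann envelope\<close>

text \<open>
  The Grassmann algebra has the basis \<open>e\<^sub>S = e\<^sub>i\<^sub>1 \<dots> e\<^sub>i\<^sub>k\<close> for finite
  \<open>S = {i\<^sub>1 < \<dots> < i\<^sub>k}\<close>, with \<open>e\<^sub>P e\<^sub>Q = grassmann_sign P Q e\<^sub>P\<^sub>\<union>\<^sub>Q\<close> for disjoint \<open>P\<close>, \<open>Q\<close> and
  \<open>e\<^sub>P e\<^sub>Q = 0\<close> otherwise. An element of its tensor product with \<open>A\<close> is uniquely a finite sum
  of terms \<open>e\<^sub>S \<otimes> a\<^sub>S\<close>; it is encoded as the finitely supported function \<open>S \<mapsto> a\<^sub>S\<close>.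
\<close>

definition grassmann_sign :: "nat set \<Rightarrow> nat set \<Rightarrow> 'f::field"
  where "grassmann_sign P Q = (- 1) ^ card {(p, q). p \<in> P \<and> q \<in> Q \<and> q < p}"

definition grassmann_envelope :: "('f::field, 'a) superalg \<Rightarrow> ('f, nat set \<Rightarrow> 'a) module"
  where "grassmann_envelope A =
    \<lparr>carrier = {g. finite {S. g S \<noteq> \<zero>\<^bsub>A\<^esub>} \<and>
       (\<forall>S. if finite S then g S \<in> grade A (of_nat (card S)) else g S = \<zero>\<^bsub>A\<^esub>)},
     mult = (\<lambda>g h S. if finite S
       then \<Oplus>\<^bsub>A\<^esub>P\<in>Pow S. grassmann_sign P (S - P) \<odot>\<^bsub>A\<^esub> (g P \<otimes>\<^bsub>A\<^esub> h (S - P))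
       else \<zero>\<^bsub>A\<^esub>),
     one = (\<lambda>S. \<zero>\<^bsub>A\<^esub>),
     zero = (\<lambda>S. \<zero>\<^bsub>A\<^esub>),
     add = (\<lambda>g h S. g S \<oplus>\<^bsub>A\<^esub> h S),
     smult = (\<lambda>c g S. c \<odot>\<^bsub>A\<^esub> g S)\<rparr>"


section \<open>Superidentities\<close>

definition multilinear :: "('x, 'f::field) npoly \<Rightarrow> bool"
  where "multilinear f \<longleftrightarrow>
    (\<exists>X. finite X \<and> (\<forall>w\<in>Poly_Mapping.keys f. distinct (letters w) \<and> set (letters w) = X))"

text \<open>
  Sign of rearranging the variables of \<open>w\<close>, with parities \<open>par\<close>, from increasing order to the
  order in which they occur in \<open>w\<close>: each inverted pair contributes \<open>(-1)\<^sup>i\<^sup>j\<close>.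
  Another reference order would change all signs of a multilinear polynomial by a common factor.
\<close>

definition koszul_sign :: "(nat \<Rightarrow> bit) \<Rightarrow> nat word \<Rightarrow> 'f::field"
  where "koszul_sign par w = (- 1) ^ card {(k, l). k < l \<and> l < length (letters w) \<and>
    letters w ! l < letters w ! k \<and> par (letters w ! k) * par (letters w ! l) = 1}"

definition superization :: "(nat \<Rightarrow> bit) \<Rightarrow> (nat, 'f::field) npoly \<Rightarrow> (nat, 'f) npoly"
  where "superization par f =
    (\<Sum>w\<in>Poly_Mapping.keys f.
       Poly_Mapping.single w (koszul_sign par w * Poly_Mapping.lookup f w))"

definition satisfies_super :: "('f::field, 'a) superalg \<Rightarrow> (nat, 'f) npoly \<Rightarrow> bool"
  where "satisfies_super A f \<longleftrightarrow>
    (\<forall>par v. (\<forall>x. v x \<in> grade A (par x)) \<longrightarrow> eval_npoly A v (superization par f) = \<zero>\<^bsub>A\<^esub>)"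


section \<open>Supervarieties and their free superalgebras\<close>

text \<open>
  A class of superalgebras is the set of its members with carrier in a type \<open>'u\<close> that plays the
  role of a universe.
\<close>

definition superalgs_of :: "(nat, 'f::field) npoly set \<Rightarrow> ('f, 'u) superalg set"
  where "superalgs_of I = {A. superalgebra A \<and> in_variety I (grassmann_envelope A)}"

definition supervariety_generated_by :: "('f::field, 'a) superalg \<Rightarrow> ('f, 'u) superalg set"
  where "supervariety_generated_by B =
    {A. superalgebra A \<and> (\<forall>f. multilinear f \<and> satisfies_super B f \<longrightarrow> satisfies_super A f)}"

definition npoly_mult ::
    "('x, 'f::field) npoly \<Rightarrow> ('x, 'f) npoly \<Rightarrow> ('x, 'f) npoly"
  where "npoly_mult f g =
    (\<Sum>u\<in>Poly_Mapping.keys f. \<Sum>v\<in>Poly_Mapping.keys g.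
       Poly_Mapping.single (Times u v) (Poly_Mapping.lookup f u * Poly_Mapping.lookup g v))"

definition free_superalg ::
    "'x set \<Rightarrow> ('x \<Rightarrow> bit) \<Rightarrow> ('f::field, ('x, 'f) npoly) superalg"
  where "free_superalg X par =
    \<lparr>carrier = {f. \<forall>w\<in>Poly_Mapping.keys f. set (letters w) \<subseteq> X},
     mult = npoly_mult, one = 0, zero = 0, add = (+),
     smult = (\<lambda>c. Poly_Mapping.map ((*) c)),
     grade = (\<lambda>i. {f. \<forall>w\<in>Poly_Mapping.keys f. set (letters w) \<subseteq> X \<and>
       sum_list (map par (letters w)) = i})\<rparr>"

text \<open>
  The free superalgebra of a class \<open>\<C>\<close> (closed under subdirect products, as supervarieties are)
  on \<open>X\<close> is the largest quotient of the absolutely free superalgebra on \<open>X\<close> that lies in \<open>\<C>\<close>.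
\<close>

definition relatively_free ::
    "('f::field, ('x, 'f) npoly set) superalg set \<Rightarrow> 'x set \<Rightarrow> ('x \<Rightarrow> bit) \<Rightarrow>
     ('f, ('x, 'f) npoly set) superalg"
  where "relatively_free \<C> X par =
    quotient_superalg (free_superalg X par)
      (\<Inter>{J. graded_ideal J (free_superalg X par) \<and>
             quotient_superalg (free_superalg X par) J \<in> \<C>})"

text \<open>Even generators are \<open>Inl i\<close>, odd generators are \<open>Inr j\<close>.\<close>

type_synonym 'f gpoly = "(nat + nat, 'f) npoly"

definition gen_parity :: "nat + nat \<Rightarrow> bit"
  where "gen_parity = case_sum (\<lambda>_. 0) (\<lambda>_. 1)"

definition gens :: "nat \<Rightarrow> nat \<Rightarrow> (nat + nat) set"
  where "gens r s = Inl ` {..<r} \<union> Inr ` {..<s}"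

definition free_V_superalg ::
    "(nat, 'f::field) npoly set \<Rightarrow> nat \<Rightarrow> nat \<Rightarrow> ('f, 'f gpoly set) superalg"
  where "free_V_superalg I r s = relatively_free (superalgs_of I) (gens r s) gen_parity"

definition supervariety_rs ::
    "(nat, 'f::field) npoly set \<Rightarrow> nat \<Rightarrow> nat \<Rightarrow> ('f, 'u) superalg set"
  where "supervariety_rs I r s =
    (if (r, s) = (0, 0) then {A. superalgebra A \<and> carrier A = {\<zero>\<^bsub>A\<^esub>}}
     else supervariety_generated_by (free_V_superalg I r s))"

definition countable_free_superalg ::
    "('f::field, 'f gpoly set) superalg set \<Rightarrow> ('f, 'f gpoly set) superalg"
  where "countable_free_superalg \<C> = relatively_free \<C> UNIV gen_parity"


section \<open>Basic superranks\<close>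

definition is_basic_superrank ::
    "'u itself \<Rightarrow> (nat, 'f::field) npoly set \<Rightarrow> nat \<times> nat \<Rightarrow> bool"
  where "is_basic_superrank U I = (\<lambda>(r, s).
    supervariety_rs I r s = (superalgs_of I :: ('f, 'u) superalg set) \<and>
    (\<forall>r' s'. r' \<le> r \<and> s' \<le> s \<and> (r', s') \<noteq> (r, s) \<longrightarrow>
       supervariety_rs I r' s' \<noteq> (superalgs_of I :: ('f, 'u) superalg set)))"

definition basic_spectrum ::
    "'u itself \<Rightarrow> (nat, 'f::field) npoly set \<Rightarrow> (nat \<times> nat) set"
  where "basic_spectrum U I = {p. is_basic_superrank U I p}"

text \<open>
  A supervariety is determined by its countably generated members. Each of these is a quotient of
  the free superalgebra on \<^typ>\<open>nat + nat\<close>, so it has an isomorphic copy with carrier in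
  \<open>'u\<close> as soon as \<open>'f gpoly\<close> embeds into \<open>'u\<close> (choose coset representatives). In such a
  universe, equality of classes therefore agrees with equality of the supervarieties.
\<close>

definition large_universe :: "'f::field itself \<Rightarrow> 'u itself \<Rightarrow> bool"
  where "large_universe F U \<longleftrightarrow> (\<exists>emb :: 'f gpoly \<Rightarrow> 'u. inj emb)"

end

theory Submission
  imports Defs "HOL-Combinatorics.Permutations" "HOL-Library.Nat_Bijection"
begin

text \<open>
  Let \<open>B\<close> be the free metabelian superalgebra on \<open>r\<close> even and \<open>s\<close> odd generators, and let \<open>I\<close> be the
  identities of the Grassmann envelope of the countably generated free superalgebra of the
  supervariety generated by \<open>B\<close>.

  The superalgebras of the variety \<open>I\<close> are exactly those of the supervariety generated by \<open>B\<close>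
  (\<open>superalgs_of_envelope_identities\<close>). This rests on the equivalence of a multilinear identity
  of an envelope with the corresponding superidentity (\<open>envelope_satisfies_iff\<close>) and, for identities
  that are not multilinear, on generic elements of the envelope of a free superalgebra
  (\<open>envelope_identities_complete\<close>). Since \<open>B\<close> belongs to the class, it is also the free superalgebra of
  \<open>I\<close> on \<open>r\<close> even and \<open>s\<close> odd generators (\<open>free_I_eq\<close>), and it generates the class. So \<open>(r, s)\<close> has
  the generating property.

  It remains to see that a pair \<open>(r', s')\<close> with this property satisfies \<open>r \<le> r'\<close> and \<open>s \<le> s'\<close>; both
  the minimality and the uniqueness of \<open>(r, s)\<close> follow. If there are too few generators of parity
  \<open>q\<close>, say fewer than the \<open>N\<close> that \<open>B\<close> has, consider a Young symmetrizer for an array of \<open>N\<close> long rows,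
  read as a multilinear polynomial in left normed words (\<open>rect_poly\<close>). In a metabelian superalgebra
  at most one variable can take a value outside the span of the generators. If only few
  generators are available, each column of the array, apart from one, must contain a generator of the
  other parity, while each row can contain only boundedly many of these; so for long rows
  the polynomial is a superidentity (\<open>rect_poly_few_generators\<close>). In \<open>B\<close>, on the other hand, filling each
  row with a generator of its own gives a nonzero value (\<open>rect_poly_enough_generators\<close>), because words
  without a factor \<open>(u\<^sub>1 u\<^sub>2) (u\<^sub>3 u\<^sub>4)\<close> are linearly independent in \<open>B\<close> and the characteristic is zero.
  An isomorphic copy of \<open>B\<close> inside the universe then separates the two classes.
\<close>

section \<open>Evaluation of nonassociative polynomials\<close>

lemma scalars_simps [simp]:
  "carrier scalars = UNIV" "monoid.mult scalars = (*)" "monoid.one scalars = 1" "ring.zero scalars = 0"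
  "ring.add scalars = (+)"
  by (simp_all add: scalars_def)

lemma cring_scalars: "cring (scalars :: 'f::field ring)"
proof (rule cringI)
  show "abelian_group (scalars :: 'f ring)"
    by (rule abelian_groupI) (auto simp: algebra_simps intro: exI[of _ "- _"] left_minus)
  show "comm_monoid (scalars :: 'f ring)"
    by (rule comm_monoidI) (auto simp: algebra_simps)
qed (auto simp: algebra_simps)

lemma nonassoc_algebraI:
  fixes A :: "('f::field, 'a, 'm) module_scheme" (structure)
  assumes "\<And>x y. \<lbrakk>x \<in> carrier A; y \<in> carrier A\<rbrakk> \<Longrightarrow> x \<oplus> y \<in> carrier A"
    and "\<zero> \<in> carrier A"
    and "\<And>c x. x \<in> carrier A \<Longrightarrow> c \<odot> x \<in> carrier A"
    and "\<And>x y. \<lbrakk>x \<in> carrier A; y \<in> carrier A\<rbrakk> \<Longrightarrow> x \<otimes> y \<in> carrier A"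
    and "\<And>x y z. \<lbrakk>x \<in> carrier A; y \<in> carrier A; z \<in> carrier A\<rbrakk> \<Longrightarrow> (x \<oplus> y) \<oplus> z = x \<oplus> (y \<oplus> z)"
    and "\<And>x y. \<lbrakk>x \<in> carrier A; y \<in> carrier A\<rbrakk> \<Longrightarrow> x \<oplus> y = y \<oplus> x"
    and "\<And>x. x \<in> carrier A \<Longrightarrow> \<zero> \<oplus> x = x"
    and "\<And>x. x \<in> carrier A \<Longrightarrow> (- 1) \<odot> x \<oplus> x = \<zero>"
    and "\<And>a b x. x \<in> carrier A \<Longrightarrow> (a + b) \<odot> x = a \<odot> x \<oplus> b \<odot> x"
    and "\<And>a x y. \<lbrakk>x \<in> carrier A; y \<in> carrier A\<rbrakk> \<Longrightarrow> a \<odot> (x \<oplus> y) = a \<odot> x \<oplus> a \<odot> y"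
    and "\<And>a b x. x \<in> carrier A \<Longrightarrow> (a * b) \<odot> x = a \<odot> (b \<odot> x)"
    and "\<And>x. x \<in> carrier A \<Longrightarrow> 1 \<odot> x = x"
    and "\<And>x y z. \<lbrakk>x \<in> carrier A; y \<in> carrier A; z \<in> carrier A\<rbrakk> \<Longrightarrow> (x \<oplus> y) \<otimes> z = x \<otimes> z \<oplus> y \<otimes> z"
    and "\<And>x y z. \<lbrakk>x \<in> carrier A; y \<in> carrier A; z \<in> carrier A\<rbrakk> \<Longrightarrow> x \<otimes> (y \<oplus> z) = x \<otimes> y \<oplus> x \<otimes> z"
    and "\<And>c x y. \<lbrakk>x \<in> carrier A; y \<in> carrier A\<rbrakk> \<Longrightarrow> (c \<odot> x) \<otimes> y = c \<odot> (x \<otimes> y)"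
    and "\<And>c x y. \<lbrakk>x \<in> carrier A; y \<in> carrier A\<rbrakk> \<Longrightarrow> x \<otimes> (c \<odot> y) = c \<odot> (x \<otimes> y)"
  shows "nonassoc_algebra A"
proof -
  have "abelian_group A"
    by (rule abelian_groupI) (erule (2) assms(5) | erule (1) assms(1,6) | rule assms(2)
      | erule assms(7) | rule bexI, erule assms(8), erule assms(3))+
  then have "module (scalars :: 'f ring) A"
    by (intro moduleI cring_scalars) (simp_all add: assms(3,9-12))
  then show ?thesis
    by (intro nonassoc_algebra.intro nonassoc_algebra_axioms.intro assms(4,13-16))
qed

context nonassoc_algebra
begin

lemma smult_carrier [simp, intro]: "x \<in> carrier A \<Longrightarrow> c \<odot> x \<in> carrier A"
  using smult_closed[of c x] by simp

lemma smult_add_left: "x \<in> carrier A \<Longrightarrow> (a + b) \<odot> x = a \<odot> x \<oplus> b \<odot> x"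
  using smult_l_distr[of a b x] by simp

lemma smult_add_right:
  "x \<in> carrier A \<Longrightarrow> y \<in> carrier A \<Longrightarrow> a \<odot> (x \<oplus> y) = a \<odot> x \<oplus> a \<odot> y"
  using smult_r_distr[of a x y] by simp

lemma smult_smult: "x \<in> carrier A \<Longrightarrow> a \<odot> (b \<odot> x) = (a * b) \<odot> x"
  using smult_assoc1[of a b x] by simp

lemma smult_1 [simp]: "x \<in> carrier A \<Longrightarrow> 1 \<odot> x = x"
  using smult_one[of x] by simp

lemma smult_0_left [simp]: "x \<in> carrier A \<Longrightarrow> 0 \<odot> x = \<zero>"
  using smult_l_null[of x] by simp

lemma smult_0_right [simp]: "c \<odot> \<zero> = \<zero>"
  using smult_r_null[of c] by simp

lemma smult_minus_1_add [simp]: "x \<in> carrier A \<Longrightarrow> (- 1) \<odot> x \<oplus> x = \<zero>"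
  using smult_add_left[of x "-1" 1] by simp

lemma add_smult_minus_1 [simp]: "x \<in> carrier A \<Longrightarrow> x \<oplus> (- 1) \<odot> x = \<zero>"
  using smult_add_left[of x 1 "-1"] by simp

lemma mult_0_left [simp]: "x \<in> carrier A \<Longrightarrow> \<zero> \<otimes> x = \<zero>"
  using mult_smult_l[of \<zero> x 0] mult_closed[of \<zero> x] by simp

lemma mult_0_right [simp]: "x \<in> carrier A \<Longrightarrow> x \<otimes> \<zero> = \<zero>"
  using mult_smult_r[of x \<zero> 0] mult_closed[of x \<zero>] by simp

lemma a_inv_eq_smult: "x \<in> carrier A \<Longrightarrow> \<ominus> x = (- 1) \<odot> x"
  by (intro minus_equality) simp_all

lemma submodule_iff:
  "submodule H (scalars :: 'f ring) A \<longleftrightarrow>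
    H \<subseteq> carrier A \<and> \<zero> \<in> H \<and> (\<forall>x\<in>H. \<forall>y\<in>H. x \<oplus> y \<in> H) \<and> (\<forall>c. \<forall>x\<in>H. c \<odot> x \<in> H)"
    (is "_ \<longleftrightarrow> ?R")
proof
  assume sub: "submodule H (scalars :: 'f ring) A"
  have 1: "H \<subseteq> carrier A" "\<And>c x. x \<in> H \<Longrightarrow> c \<odot> x \<in> H" "\<And>x y. x \<in> H \<Longrightarrow> y \<in> H \<Longrightarrow> x \<oplus> y \<in> H"
    using submoduleE(1,4,5)[OF sub] by simp_all
  obtain x where "x \<in> H" using submoduleE(2)[OF sub] by blast
  then have "\<zero> \<in> H" using 1(2)[of x 0] 1(1) smult_0_left[of x] by auto
  with 1 show ?R by blast
next
  assume R: ?R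
  show "submodule H (scalars :: 'f ring) A"
  proof (rule submoduleI)
    show "\<ominus> a \<in> H" if "a \<in> H" for a
      using R that by (subst a_inv_eq_smult) auto
  qed (use R in auto)
qed

lemma smult_eq_zeroD: "c \<odot> x = \<zero> \<Longrightarrow> c \<noteq> 0 \<Longrightarrow> x \<in> carrier A \<Longrightarrow> x = \<zero>"
  using smult_smult[of x "inverse c" c] by simp

end

lemma additive_finsum:
  assumes "abelian_monoid A" "abelian_monoid B"
    and h: "\<And>x. x \<in> carrier A \<Longrightarrow> h x \<in> carrier B"
    and hadd: "\<And>x y. x \<in> carrier A \<Longrightarrow> y \<in> carrier A \<Longrightarrow> h (x \<oplus>\<^bsub>A\<^esub> y) = h x \<oplus>\<^bsub>B\<^esub> h y"
    and h0: "h \<zero>\<^bsub>A\<^esub> = \<zero>\<^bsub>B\<^esub>"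
    and g: "\<And>i. i \<in> I \<Longrightarrow> g i \<in> carrier A"
  shows "h (\<Oplus>\<^bsub>A\<^esub>i\<in>I. g i) = (\<Oplus>\<^bsub>B\<^esub>i\<in>I. h (g i))"
proof -
  interpret A: abelian_monoid A by fact
  interpret B: abelian_monoid B by fact
  show ?thesis using g
  proof (induction I rule: infinite_finite_induct)
    case (insert i I)
    then have "h (\<Oplus>\<^bsub>A\<^esub>i\<in>insert i I. g i) = h (g i \<oplus>\<^bsub>A\<^esub> (\<Oplus>\<^bsub>A\<^esub>i\<in>I. g i))"
      by (subst A.finsum_insert) auto
    also have "\<dots> = h (g i) \<oplus>\<^bsub>B\<^esub> h (\<Oplus>\<^bsub>A\<^esub>i\<in>I. g i)"
      using insert by (intro hadd A.finsum_closed) auto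
    also have "\<dots> = (\<Oplus>\<^bsub>B\<^esub>i\<in>insert i I. h (g i))"
      using insert h by (subst B.finsum_insert) auto
    finally show ?case .
  qed (auto simp: h0 A.finsum_infinite B.finsum_infinite)
qed

lemma npoly_sum_singles:
  "(\<Sum>w\<in>Poly_Mapping.keys f. Poly_Mapping.single w (Poly_Mapping.lookup f w)) = f"
  by (rule poly_mapping_eqI)
    (auto simp: lookup_sum lookup_single when_def sum.If_cases if_distrib
        intro!: sum.neutral simp: in_keys_iff cong: if_cong)

text \<open>
  Only multiples of words of \<open>f\<close> are added, so in the induction step whatever is known about the
  words of \<open>f\<close> (multilinearity, parity, generators) is available for \<open>w\<close>.
\<close>

lemma npoly_induct [case_names zero add]:
  assumes "P 0" and "\<And>p w c. P p \<Longrightarrow> w \<in> Poly_Mapping.keys f \<Longrightarrow> P (Poly_Mapping.single w c + p)"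
  shows "P (f :: ('x, 'f::field) npoly)"
proof -
  have "P (\<Sum>w\<in>W. Poly_Mapping.single w (Poly_Mapping.lookup f w))"
    if "finite W" "W \<subseteq> Poly_Mapping.keys f" for W
    using that by (induction W) (auto intro!: assms)
  from this[of "Poly_Mapping.keys f"] show ?thesis by (simp add: npoly_sum_singles)
qed

context nonassoc_algebra
begin

lemma eval_word_closed: "(\<And>x. x \<in> set (letters w) \<Longrightarrow> v x \<in> carrier A) \<Longrightarrow> eval_word A v w \<in> carrier A"
  by (induction w) (auto intro: mult_closed)

lemma eval_npoly_superset:
  assumes "finite W" "Poly_Mapping.keys f \<subseteq> W" and v: "\<And>x. v x \<in> carrier A"
  shows "eval_npoly A v f = (\<Oplus>w\<in>W. Poly_Mapping.lookup f w \<odot> eval_word A v w)"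
  unfolding eval_npoly_def
  by (rule add.finprod_mono_neutral_cong_left)
    (use assms in \<open>auto simp: in_keys_iff eval_word_closed\<close>)

lemma eval_npoly_closed: "(\<And>x. v x \<in> carrier A) \<Longrightarrow> eval_npoly A v f \<in> carrier A"
  unfolding eval_npoly_def by (intro finsum_closed) (auto intro: eval_word_closed)

lemma eval_npoly_0 [simp]: "eval_npoly A v 0 = \<zero>"
  by (simp add: eval_npoly_def)

lemma eval_npoly_single [simp]:
  "(\<And>x. v x \<in> carrier A) \<Longrightarrow> eval_npoly A v (Poly_Mapping.single w c) = c \<odot> eval_word A v w"
  using finsum_insert[of "{}" w] by (subst eval_npoly_superset[where W = "{w}"]) (auto simp: eval_word_closed)

lemma eval_npoly_add:
  assumes v: "\<And>x. v x \<in> carrier A"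
  shows "eval_npoly A v (f + g) = eval_npoly A v f \<oplus> eval_npoly A v g"
proof -
  let ?W = "Poly_Mapping.keys f \<union> Poly_Mapping.keys g"
  have "eval_npoly A v (f + g) = (\<Oplus>w\<in>?W. Poly_Mapping.lookup (f + g) w \<odot> eval_word A v w)"
    using keys_add[of f g] by (intro eval_npoly_superset v) auto
  also have "\<dots> = (\<Oplus>w\<in>?W. Poly_Mapping.lookup f w \<odot> eval_word A v w \<oplus> Poly_Mapping.lookup g w \<odot> eval_word A v w)"
    by (intro add.finprod_cong') (auto simp: lookup_add smult_add_left eval_word_closed v)
  also have "\<dots> = (\<Oplus>w\<in>?W. Poly_Mapping.lookup f w \<odot> eval_word A v w) \<oplus> (\<Oplus>w\<in>?W. Poly_Mapping.lookup g w \<odot> eval_word A v w)"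
    by (rule finsum_addf) (auto intro: eval_word_closed v)
  also have "\<dots> = eval_npoly A v f \<oplus> eval_npoly A v g"
    by (subst (1 2) eval_npoly_superset[where W = ?W]) (auto intro: v)
  finally show ?thesis .
qed

end

lemma lookup_map_times [simp]:
  "Poly_Mapping.lookup (Poly_Mapping.map ((*) c) p) w = (c :: 'f::field) * Poly_Mapping.lookup p w"
  by (auto simp: Poly_Mapping.map.rep_eq when_def)

definition alg_hom :: "('a \<Rightarrow> 'b) \<Rightarrow> ('f::field, 'a, 'm) module_scheme \<Rightarrow> ('f, 'b, 'n) module_scheme \<Rightarrow> bool"
  where "alg_hom h A B \<longleftrightarrow>
    (\<forall>x\<in>carrier A. h x \<in> carrier B) \<and>
    (\<forall>x\<in>carrier A. \<forall>y\<in>carrier A. h (x \<oplus>\<^bsub>A\<^esub> y) = h x \<oplus>\<^bsub>B\<^esub> h y) \<and>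
    (\<forall>x\<in>carrier A. \<forall>y\<in>carrier A. h (x \<otimes>\<^bsub>A\<^esub> y) = h x \<otimes>\<^bsub>B\<^esub> h y) \<and>
    (\<forall>c. \<forall>x\<in>carrier A. h (c \<odot>\<^bsub>A\<^esub> x) = c \<odot>\<^bsub>B\<^esub> h x)"

lemma alg_hom_zero:
  assumes "alg_hom h A B" "nonassoc_algebra A" "nonassoc_algebra B"
  shows "h \<zero>\<^bsub>A\<^esub> = \<zero>\<^bsub>B\<^esub>"
proof -
  interpret A: nonassoc_algebra A by fact
  interpret B: nonassoc_algebra B by fact
  have "h (0 \<odot>\<^bsub>A\<^esub> \<zero>\<^bsub>A\<^esub>) = 0 \<odot>\<^bsub>B\<^esub> h \<zero>\<^bsub>A\<^esub>" "h \<zero>\<^bsub>A\<^esub> \<in> carrier B"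
    using assms(1) A.zero_closed unfolding alg_hom_def by blast+
  then show ?thesis by simp
qed

lemma eval_word_hom:
  assumes "alg_hom h A B" "nonassoc_algebra A" "\<And>x. v x \<in> carrier A"
  shows "eval_word B (\<lambda>x. h (v x)) w = h (eval_word A v w)"
proof -
  interpret A: nonassoc_algebra A by fact
  show ?thesis
    using assms(1,3) by (induction w) (auto simp: alg_hom_def A.eval_word_closed)
qed

lemma eval_npoly_hom:
  assumes h: "alg_hom h A B" and A: "nonassoc_algebra A" and B: "nonassoc_algebra B"
    and v: "\<And>x. v x \<in> carrier A"
  shows "eval_npoly B (\<lambda>x. h (v x)) f = h (eval_npoly A v f)"
proof -
  interpret A: nonassoc_algebra A by fact
  interpret B: nonassoc_algebra B by fact
  have "h (eval_npoly A v f) =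
      (\<Oplus>\<^bsub>B\<^esub>w\<in>Poly_Mapping.keys f. h (Poly_Mapping.lookup f w \<odot>\<^bsub>A\<^esub> eval_word A v w))"
    unfolding eval_npoly_def
    by (rule additive_finsum)
      (use h v in \<open>auto simp: alg_hom_def A.eval_word_closed alg_hom_zero[OF h A B]
          A.abelian_monoid_axioms B.abelian_monoid_axioms\<close>)
  also have "\<dots> = eval_npoly B (\<lambda>x. h (v x)) f"
    unfolding eval_npoly_def
    by (rule B.add.finprod_cong')
      (use h v in \<open>auto simp: alg_hom_def A.eval_word_closed eval_word_hom[OF h A v] B.eval_word_closed\<close>)
  finally show ?thesis by simp
qed

text \<open>
  Used for the projection onto a quotient and for an injective change of the carrier. All axioms are
  inherited along \<open>h\<close> except that the homogeneous parts meet in zero, which depends on the kernel.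
\<close>

lemma superalgebra_image:
  fixes A :: "('f::field, 'a) superalg" and B :: "('f, 'b) superalg"
  assumes A: "superalgebra A" and h: "alg_hom h A B"
    and car: "carrier B = h ` carrier A" and zero: "\<zero>\<^bsub>B\<^esub> = h \<zero>\<^bsub>A\<^esub>"
    and gr: "\<And>i. grade B i = h ` grade A i"
    and disj: "grade B 0 \<inter> grade B 1 \<subseteq> {\<zero>\<^bsub>B\<^esub>}"
  shows "superalgebra B"
proof -
  interpret A: superalgebra A by fact
  have hadd: "h x \<oplus>\<^bsub>B\<^esub> h y = h (x \<oplus>\<^bsub>A\<^esub> y)" and hmult: "h x \<otimes>\<^bsub>B\<^esub> h y = h (x \<otimes>\<^bsub>A\<^esub> y)" if "x \<in> carrier A" "y \<in> carrier A" for x y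
    using h that unfolding alg_hom_def by simp_all
  have hsm: "c \<odot>\<^bsub>B\<^esub> h x = h (c \<odot>\<^bsub>A\<^esub> x)" if "x \<in> carrier A" for x c
    using h that unfolding alg_hom_def by simp
  have sub: "submodule (grade A i) (scalars :: 'f ring) A" for i
    by (rule A.grade_submodule)
  have grc: "grade A i \<subseteq> carrier A" for i
    using sub unfolding A.submodule_iff by blast
  have B: "nonassoc_algebra B"
    by (rule nonassoc_algebraI)
      (auto simp: car zero hadd hmult hsm A.mult_closed A.a_ac A.smult_add_left
        A.smult_add_right A.smult_smult A.mult_l_distr A.mult_r_distr A.mult_smult_l A.mult_smult_r
        intro!: imageI)
  interpret B: nonassoc_algebra B by fact
  show ?thesis
  proof (rule superalgebra.intro[OF B], rule superalgebra_axioms.intro)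
    have z: "\<zero>\<^bsub>A\<^esub> \<in> grade A i" for i
      using sub unfolding A.submodule_iff by blast
    fix i
    show "submodule (grade B i) (scalars :: 'f ring) B"
      using sub[of i] unfolding A.submodule_iff B.submodule_iff gr car zero
      by (auto simp: hadd hsm subset_iff intro!: imageI)
    show "grade B 0 \<inter> grade B 1 = {\<zero>\<^bsub>B\<^esub>}"
      using disj z by (auto simp: gr zero)
  next
    fix x assume "x \<in> carrier B"
    then obtain y where y: "y \<in> carrier A" "x = h y" using car by auto
    then obtain y0 y1 where "y0 \<in> grade A 0" "y1 \<in> grade A 1" "y = y0 \<oplus>\<^bsub>A\<^esub> y1"
      using A.grade_sum by blast
    then show "\<exists>x0\<in>grade B 0. \<exists>x1\<in>grade B 1. x = x0 \<oplus>\<^bsub>B\<^esub> x1"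
      using y grc by (auto simp: gr hadd subset_iff)
  next
    fix x y i j assume "x \<in> grade B i" "y \<in> grade B j"
    then obtain a b where ab: "a \<in> grade A i" "x = h a" "b \<in> grade A j" "y = h b"
      by (auto simp only: gr image_iff)
    then have "x \<otimes>\<^bsub>B\<^esub> y = h (a \<otimes>\<^bsub>A\<^esub> b)"
      using hmult[of a b] grc by blast
    then show "x \<otimes>\<^bsub>B\<^esub> y \<in> grade B (i + j)"
      using A.grade_mult[OF ab(1,3)] unfolding gr by blast
  qed
qed

section \<open>Free superalgebras and their quotients\<close>

context superalgebra
begin

lemma grade_carrier: "x \<in> grade A i \<Longrightarrow> x \<in> carrier A"
  using grade_submodule[of i] unfolding submodule_iff by blast

lemma grade_zero [simp]: "\<zero> \<in> grade A i"
  using grade_submodule[of i] unfolding submodule_iff by blast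

lemma grade_add: "x \<in> grade A i \<Longrightarrow> y \<in> grade A i \<Longrightarrow> x \<oplus> y \<in> grade A i"
  using grade_submodule[of i] unfolding submodule_iff by blast

lemma grade_smult: "x \<in> grade A i \<Longrightarrow> c \<odot> x \<in> grade A i"
  using grade_submodule[of i] unfolding submodule_iff by blast

lemma grade_both: "x \<in> grade A 0 \<Longrightarrow> x \<in> grade A 1 \<Longrightarrow> x = \<zero>"
  using grade_disjoint by blast

lemma eval_word_grade:
  "(\<And>x. x \<in> set (letters w) \<Longrightarrow> v x \<in> grade A (par x)) \<Longrightarrow>
    eval_word A v w \<in> grade A (sum_list (map par (letters w)))"
proof (induction w)
  case (Times u w)
  then show ?case using grade_mult[OF Times.IH] by (simp del: add_bit_eq_xor)
qed auto

end

text \<open>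
  A word splits in at most one way as a product, so a coefficient of a product is a single product
  of coefficients. All algebraic laws of \<^const>\<open>npoly_mult\<close> follow by comparing coefficients.
\<close>

lemma lookup_npoly_mult [simp]:
  "Poly_Mapping.lookup (npoly_mult p q) (Times u v) = Poly_Mapping.lookup p u * Poly_Mapping.lookup q v"
  "Poly_Mapping.lookup (npoly_mult p q) (Var x) = 0"
proof -
  have "Poly_Mapping.lookup (npoly_mult p q) (Times u v) =
    (\<Sum>a\<in>Poly_Mapping.keys p. if a = u then \<Sum>b\<in>Poly_Mapping.keys q. if b = v then Poly_Mapping.lookup p a * Poly_Mapping.lookup q b else 0 else 0)"
    unfolding npoly_mult_def lookup_sum lookup_single when_def
    by (rule sum.cong[OF refl]) (simp cong: if_cong)
  also have "\<dots> = Poly_Mapping.lookup p u * Poly_Mapping.lookup q v"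
    by (auto simp: in_keys_iff)
  finally show "Poly_Mapping.lookup (npoly_mult p q) (Times u v) = Poly_Mapping.lookup p u * Poly_Mapping.lookup q v" .
  show "Poly_Mapping.lookup (npoly_mult p q) (Var x) = 0"
    by (simp add: npoly_mult_def lookup_sum lookup_single)
qed

lemma npoly_eqI:
  assumes "\<And>x. Poly_Mapping.lookup p (Var x) = Poly_Mapping.lookup q (Var x)"
    and "\<And>u v. Poly_Mapping.lookup p (Times u v) = Poly_Mapping.lookup q (Times u v)"
  shows "p = q"
proof (rule poly_mapping_eqI)
  fix w show "Poly_Mapping.lookup p w = Poly_Mapping.lookup q w"
    using assms by (cases w) auto
qed

lemma npoly_mult_bilinear:
  "npoly_mult (p + p') q = npoly_mult p q + npoly_mult p' q"
  "npoly_mult q (p + p') = npoly_mult q p + npoly_mult q p'"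
  "npoly_mult (p - p') q = npoly_mult p q - npoly_mult p' q"
  "npoly_mult q (p - p') = npoly_mult q p - npoly_mult q p'"
  "npoly_mult (Poly_Mapping.map ((*) c) p) q = Poly_Mapping.map ((*) c) (npoly_mult p q)"
  "npoly_mult q (Poly_Mapping.map ((*) c) p) = Poly_Mapping.map ((*) c) (npoly_mult q p)"
  "npoly_mult 0 q = 0" "npoly_mult q 0 = 0"
  by (rule npoly_eqI; simp add: lookup_add lookup_minus algebra_simps)+

lemma npoly_mult_single [simp]:
  "npoly_mult (Poly_Mapping.single u a) (Poly_Mapping.single v b) = Poly_Mapping.single (Times u v) (a * b)"
  by (rule npoly_eqI) (auto simp: lookup_single when_def)

lemma keys_npoly_multE:
  assumes "w \<in> Poly_Mapping.keys (npoly_mult p q)"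
  obtains u v where "w = Times u v" "u \<in> Poly_Mapping.keys p" "v \<in> Poly_Mapping.keys q"
  using assms by (cases w) (auto simp: in_keys_iff)

lemma keys_smult: "Poly_Mapping.keys (Poly_Mapping.map ((*) (c :: 'f::field)) p) \<subseteq> Poly_Mapping.keys p"
  by (auto simp: in_keys_iff)

lemma keys_add_in: "w \<in> Poly_Mapping.keys (p + q) \<Longrightarrow> w \<in> Poly_Mapping.keys p \<or> w \<in> Poly_Mapping.keys q"
  using keys_add[of p q] by blast

definition npoly_filter :: "('x word \<Rightarrow> bool) \<Rightarrow> ('x, 'f::field) npoly \<Rightarrow> ('x, 'f) npoly"
  where "npoly_filter P = Poly_Mapping.mapp (\<lambda>w c. c when P w)"

lemma lookup_npoly_filter [simp]:
  "Poly_Mapping.lookup (npoly_filter P p) w = (Poly_Mapping.lookup p w when P w)"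
  by (auto simp: npoly_filter_def lookup_mapp when_def in_keys_iff)

definition word_parity :: "('x \<Rightarrow> bit) \<Rightarrow> 'x word \<Rightarrow> bit"
  where "word_parity par w = sum_list (map par (letters w))"

lemma free_simps [simp]:
  "carrier (free_superalg X par) = {f. \<forall>w\<in>Poly_Mapping.keys f. set (letters w) \<subseteq> X}"
  "monoid.mult (free_superalg X par) = npoly_mult"
  "ring.zero (free_superalg X par) = 0"
  "ring.add (free_superalg X par) = (+)"
  "module.smult (free_superalg X par) = (\<lambda>c. Poly_Mapping.map ((*) c))"
  "grade (free_superalg X par) i = {f. \<forall>w\<in>Poly_Mapping.keys f. set (letters w) \<subseteq> X \<and> word_parity par w = i}"
  by (simp_all add: free_superalg_def word_parity_def)

lemma smult_simps:
  "Poly_Mapping.map ((*) (a + b)) p = Poly_Mapping.map ((*) a) p + Poly_Mapping.map ((*) b) (p :: ('x, 'f::field) npoly)"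
  "Poly_Mapping.map ((*) a) (p + q) = Poly_Mapping.map ((*) a) p + Poly_Mapping.map ((*) a) q"
  "Poly_Mapping.map ((*) (a * b)) p = Poly_Mapping.map ((*) a) (Poly_Mapping.map ((*) b) p)"
  "Poly_Mapping.map ((*) 1) p = p"
  "Poly_Mapping.map ((*) (- 1)) p = - p"
  "Poly_Mapping.map ((*) a) (p - q) = Poly_Mapping.map ((*) a) p - Poly_Mapping.map ((*) a) q"
  "Poly_Mapping.map ((*) a) 0 = (0 :: ('x, 'f) npoly)"
  by (rule poly_mapping_eqI; simp add: lookup_add lookup_minus algebra_simps)+

lemma superalgebra_free: "superalgebra (free_superalg X par :: ('f::field, ('x, 'f) npoly) superalg)"
proof -
  let ?F = "free_superalg X par :: ('f::field, ('x, 'f) npoly) superalg"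
  have "nonassoc_algebra ?F"
    by (rule nonassoc_algebraI)
      (auto simp: npoly_mult_bilinear smult_simps add.assoc add.commute
        dest!: keys_add_in subsetD[OF keys_smult] elim!: keys_npoly_multE; blast)+
  then interpret nonassoc_algebra ?F .
  show ?thesis
  proof (rule superalgebra.intro, fact, rule superalgebra_axioms.intro)
    show "submodule (grade ?F i) (scalars :: 'f ring) ?F" for i
      unfolding submodule_iff by (auto dest!: keys_add_in subsetD[OF keys_smult])
    show "grade ?F 0 \<inter> grade ?F 1 = {\<zero>\<^bsub>?F\<^esub>}"
      by (auto simp flip: keys_eq_empty)
    show "\<exists>x0\<in>grade ?F 0. \<exists>x1\<in>grade ?F 1. p = x0 \<oplus>\<^bsub>?F\<^esub> x1" if "p \<in> carrier ?F" for p
    proof (intro bexI)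
      show "p = npoly_filter (\<lambda>w. word_parity par w = 0) p \<oplus>\<^bsub>?F\<^esub> npoly_filter (\<lambda>w. word_parity par w = 1) p"
        by (rule poly_mapping_eqI) (auto simp: lookup_add when_def)
    qed (use that in \<open>auto simp: in_keys_iff when_def split: if_splits\<close>)
    show "x \<otimes>\<^bsub>?F\<^esub> y \<in> grade ?F (i + j)" if "x \<in> grade ?F i" "y \<in> grade ?F j" for x y i j
    proof -
      have "set (letters w) \<subseteq> X \<and> word_parity par w = i + j" if "w \<in> Poly_Mapping.keys (npoly_mult x y)" for w
        using that
      proof (rule keys_npoly_multE)
        fix u v assume "w = Times u v" "u \<in> Poly_Mapping.keys x" "v \<in> Poly_Mapping.keys y"
        moreover from this have "word_parity par w = word_parity par u + word_parity par v"
          by (simp add: word_parity_def)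
        ultimately show ?thesis
          using \<open>x \<in> grade ?F i\<close> \<open>y \<in> grade ?F j\<close> by (simp del: add_bit_eq_xor)
      qed
      then show ?thesis by simp
    qed
  qed
qed

lemma koszul_sign_nonzero [simp]: "koszul_sign par w \<noteq> (0 :: 'f::field)"
  by (simp add: koszul_sign_def)

lemma lookup_superization [simp]:
  "Poly_Mapping.lookup (superization par f) w = koszul_sign par w * Poly_Mapping.lookup f w"
  by (simp add: superization_def lookup_sum lookup_single when_def in_keys_iff)

lemma keys_superization [simp]: "Poly_Mapping.keys (superization par f) = Poly_Mapping.keys f"
  by (auto simp: in_keys_iff)

lemma satisfies_super_grade:
  "satisfies_super A f \<Longrightarrow> (\<And>x. v x \<in> grade A (par x)) \<Longrightarrow> eval_npoly A v (superization par f) = \<zero>\<^bsub>A\<^esub>"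
  by (simp add: satisfies_super_def)

locale free_ideal =
  fixes X :: "'x set" and par :: "'x \<Rightarrow> bit" and J :: "('x, 'f::field) npoly set"
  assumes graded: "graded_ideal J (free_superalg X par)"
begin

abbreviation F :: "('f, ('x, 'f) npoly) superalg" where "F \<equiv> free_superalg X par"
abbreviation proj :: "('x, 'f) npoly \<Rightarrow> ('x, 'f) npoly set" where "proj \<equiv> a_r_coset F J"
abbreviation Q :: "('f, ('x, 'f) npoly set) superalg" where "Q \<equiv> quotient_superalg F J"

sublocale F: superalgebra F by (rule superalgebra_free)

lemma J_sub: "J \<subseteq> carrier F" "0 \<in> J" "x \<in> J \<Longrightarrow> y \<in> J \<Longrightarrow> x + y \<in> J" "x \<in> J \<Longrightarrow> Poly_Mapping.map ((*) c) x \<in> J"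
proof -
  have *: "J \<subseteq> carrier F \<and> \<zero>\<^bsub>F\<^esub> \<in> J \<and> (\<forall>x\<in>J. \<forall>y\<in>J. x \<oplus>\<^bsub>F\<^esub> y \<in> J) \<and> (\<forall>c. \<forall>x\<in>J. c \<odot>\<^bsub>F\<^esub> x \<in> J)"
    using graded unfolding graded_ideal_def F.submodule_iff by (elim conjE, intro conjI)
  then show "J \<subseteq> carrier F" by (elim conjE)
  show "0 \<in> J" "x \<in> J \<Longrightarrow> y \<in> J \<Longrightarrow> x + y \<in> J" "x \<in> J \<Longrightarrow> Poly_Mapping.map ((*) c) x \<in> J"
    using * by (simp_all del: free_simps(1))
qed

lemma J_diff: "x \<in> J \<Longrightarrow> y \<in> J \<Longrightarrow> x - y \<in> J"
  using J_sub(3)[of x "- y"] J_sub(4)[of y "- 1"] by (simp add: smult_simps)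

lemma J_mult: "x \<in> J \<Longrightarrow> y \<in> carrier F \<Longrightarrow> npoly_mult x y \<in> J" "x \<in> J \<Longrightarrow> y \<in> carrier F \<Longrightarrow> npoly_mult y x \<in> J"
proof -
  have "\<forall>x\<in>J. \<forall>y\<in>carrier F. x \<otimes>\<^bsub>F\<^esub> y \<in> J \<and> y \<otimes>\<^bsub>F\<^esub> x \<in> J"
    using graded unfolding graded_ideal_def by (elim conjE)
  then show "x \<in> J \<Longrightarrow> y \<in> carrier F \<Longrightarrow> npoly_mult x y \<in> J" "x \<in> J \<Longrightarrow> y \<in> carrier F \<Longrightarrow> npoly_mult y x \<in> J"
    by (simp_all del: free_simps(1))
qed

lemma J_graded: "x \<in> J \<Longrightarrow> \<exists>x0\<in>J \<inter> grade F 0. \<exists>x1\<in>J \<inter> grade F 1. x = x0 + x1"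
proof -
  have "\<forall>x\<in>J. \<exists>x0\<in>J \<inter> grade F 0. \<exists>x1\<in>J \<inter> grade F 1. x = x0 \<oplus>\<^bsub>F\<^esub> x1"
    using graded unfolding graded_ideal_def by (elim conjE)
  then show "x \<in> J \<Longrightarrow> \<exists>x0\<in>J \<inter> grade F 0. \<exists>x1\<in>J \<inter> grade F 1. x = x0 + x1"
    by (simp only: free_simps(4))
qed

lemma proj_def: "proj x = (\<lambda>j. j + x) ` J"
  by (auto simp: a_r_coset_def r_coset_def)

lemma proj_eq_iff: "proj x = proj y \<longleftrightarrow> x - y \<in> J"
proof
  assume "proj x = proj y"
  moreover have "x \<in> proj x" using J_sub(2) by (force simp: proj_def)
  ultimately show "x - y \<in> J" by (auto simp: proj_def)
next
  have *: "proj x \<subseteq> proj y" if "x - y \<in> J" for x y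
  proof
    fix z assume "z \<in> proj x"
    then obtain j where "j \<in> J" "z = j + x" by (auto simp: proj_def)
    then have "z = (j + (x - y)) + y" "j + (x - y) \<in> J" using that J_sub(3) by auto
    then show "z \<in> proj y" unfolding proj_def by blast
  qed
  assume "x - y \<in> J"
  moreover from this have "y - x \<in> J" using J_diff[OF J_sub(2)] by fastforce
  ultimately show "proj x = proj y" using * by blast
qed

lemma in_proj: "a \<in> proj x \<longleftrightarrow> a - x \<in> J"
  unfolding proj_def by (auto intro!: image_eqI[of _ _ "a - x"])

lemma proj_self: "x \<in> proj x"
  using J_sub(2) by (simp add: in_proj)

lemma proj_carrier: "a \<in> proj x \<Longrightarrow> x \<in> carrier F \<Longrightarrow> a \<in> carrier F"
proof -
  assume "a \<in> proj x" "x \<in> carrier F"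
  then have "(a - x) + x \<in> carrier F"
    using J_sub(1) F.a_closed[of "a - x" x] by (auto simp: in_proj)
  then show ?thesis by simp
qed

lemma Q_simps:
  "carrier Q = proj ` carrier F" "ring.zero Q = proj 0" "grade Q i = proj ` grade F i"
proof -
  show "carrier Q = proj ` carrier F"
    unfolding quotient_superalg_def A_RCOSETS_def' by auto
  show "ring.zero Q = proj 0"
    by (auto simp: quotient_superalg_def in_proj)
  show "grade Q i = proj ` grade F i"
    by (simp add: quotient_superalg_def)
qed

lemma alg_hom_proj: "alg_hom proj F Q"
proof -
  have ne: "proj x \<noteq> {}" for x using proj_self by blast
  have "proj (x + y) = proj x \<oplus>\<^bsub>Q\<^esub> proj y" for x y
  proof -
    have "proj x \<oplus>\<^bsub>Q\<^esub> proj y = (\<Union>h\<in>proj x. \<Union>k\<in>proj y. {h + k})"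
      by (simp add: quotient_superalg_def set_add_def')
    also have "\<dots> = proj (x + y)"
    proof (intro equalityI subsetI)
      fix z assume "z \<in> (\<Union>h\<in>proj x. \<Union>k\<in>proj y. {h + k})"
      then obtain h k where "h - x \<in> J" "k - y \<in> J" "z = h + k" by (auto simp: in_proj)
      then show "z \<in> proj (x + y)" using J_sub(3)[of "h - x" "k - y"] by (simp add: in_proj algebra_simps)
    next
      fix z assume "z \<in> proj (x + y)"
      then have "z - y \<in> proj x" "y \<in> proj y" "z = (z - y) + y"
        by (auto simp: in_proj algebra_simps J_sub(2))
      then show "z \<in> (\<Union>h\<in>proj x. \<Union>k\<in>proj y. {h + k})" by blast
    qed
    finally show ?thesis by simp
  qed
  moreover have "proj (npoly_mult x y) = proj x \<otimes>\<^bsub>Q\<^esub> proj y" if xy: "x \<in> carrier F" "y \<in> carrier F" for x y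
  proof -
    have "proj (npoly_mult a b) = proj (npoly_mult x y)" if "a \<in> proj x" "b \<in> proj y" for a b
    proof -
      have "npoly_mult a b - npoly_mult x y = npoly_mult (a - x) b + npoly_mult x (b - y)"
        by (simp add: npoly_mult_bilinear)
      also have "\<dots> \<in> J"
        using that xy proj_carrier[OF that(2)] by (intro J_sub(3) J_mult) (auto simp: in_proj)
      finally show ?thesis by (simp add: proj_eq_iff)
    qed
    then have "(\<Union>a\<in>proj x. \<Union>b\<in>proj y. proj (npoly_mult a b)) = proj (npoly_mult x y)"
      by (simp add: ne)
    then show ?thesis by (simp add: quotient_superalg_def rcoset_mult_def)
  qed
  moreover have "proj (Poly_Mapping.map ((*) c) x) = c \<odot>\<^bsub>Q\<^esub> proj x" for c x
  proof -
    have "proj (Poly_Mapping.map ((*) c) a) = proj (Poly_Mapping.map ((*) c) x)" if "a \<in> proj x" for a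
      using J_sub(4)[of "a - x" c] that by (simp add: in_proj proj_eq_iff smult_simps)
    then have "(\<Union>a\<in>proj x. proj (Poly_Mapping.map ((*) c) a)) = proj (Poly_Mapping.map ((*) c) x)"
      by (simp add: ne)
    then show ?thesis by (simp add: quotient_superalg_def)
  qed
  ultimately show ?thesis
    unfolding alg_hom_def by (auto simp: Q_simps(1))
qed

lemma superalgebra_Q: "superalgebra Q"
proof (rule superalgebra_image[OF superalgebra_free alg_hom_proj])
  show "grade Q 0 \<inter> grade Q 1 \<subseteq> {\<zero>\<^bsub>Q\<^esub>}"
  proof
    fix K assume "K \<in> grade Q 0 \<inter> grade Q 1"
    then obtain x y where xy: "x \<in> grade F 0" "y \<in> grade F 1" "K = proj x" "K = proj y"
      unfolding Q_simps by blast
    then have "x - y \<in> J" by (simp add: proj_eq_iff[symmetric])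
    then obtain a b where ab: "a \<in> J" "a \<in> grade F 0" "b \<in> J" "b \<in> grade F 1" "x - y = a + b"
      using J_graded by blast
    have neg: "- z \<in> grade F i" if "z \<in> grade F i" for z i
      using F.grade_smult[OF that, of "- 1"] by (simp add: smult_simps)
    have "x - a \<in> grade F 0"
      using F.grade_add[OF xy(1) neg[OF ab(2)]] by simp
    moreover have "x - a \<in> grade F 1"
      using F.grade_add[OF xy(2) ab(4)] ab(5) by (simp add: algebra_simps)
    ultimately have "x = a" using F.grade_both[of "x - a"] by simp
    then have "x \<in> J" using ab by simp
    then show "K \<in> {\<zero>\<^bsub>Q\<^esub>}" by (simp only: insert_iff xy(3) Q_simps(2) proj_eq_iff diff_zero simp_thms)
  qed
qed (simp_all add: Q_simps)

sublocale Q: superalgebra Q by (rule superalgebra_Q)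

lemma eval_Q:
  assumes "\<And>x. u x \<in> carrier F"
  shows "eval_npoly Q (\<lambda>x. proj (u x)) f = proj (eval_npoly F u f)"
  using assms by (intro eval_npoly_hom[OF alg_hom_proj]) (auto intro: F.nonassoc_algebra_axioms Q.nonassoc_algebra_axioms)

text \<open>
  Homogeneous elements of the quotient lift to homogeneous polynomials. A superidentity of the
  quotient thereby becomes a membership condition on \<open>J\<close>, and such conditions pass to intersections.
\<close>

lemma Q_satisfies_super_iff:
  "satisfies_super Q f \<longleftrightarrow>
    (\<forall>p u. (\<forall>x. u x \<in> grade F (p x)) \<longrightarrow> eval_npoly F u (superization p f) \<in> J)"
proof
  assume sat: "satisfies_super Q f"
  show "\<forall>p u. (\<forall>x. u x \<in> grade F (p x)) \<longrightarrow> eval_npoly F u (superization p f) \<in> J"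
  proof (intro allI impI)
    fix p :: "nat \<Rightarrow> bit" and u assume u: "\<forall>x. u x \<in> grade F (p x)"
    then have "eval_npoly Q (\<lambda>x. proj (u x)) (superization p f) = \<zero>\<^bsub>Q\<^esub>"
      by (intro satisfies_super_grade[OF sat]) (auto simp only: Q_simps)
    moreover have uc: "u x \<in> carrier F" for x using u F.grade_carrier by blast
    ultimately show "eval_npoly F u (superization p f) \<in> J"
      by (simp only: eval_Q[OF uc] Q_simps(2) proj_eq_iff diff_zero)
  qed
next
  assume *: "\<forall>p u. (\<forall>x. u x \<in> grade F (p x)) \<longrightarrow> eval_npoly F u (superization p f) \<in> J"
  show "satisfies_super Q f"
    unfolding satisfies_super_def
  proof (intro allI impI)
    fix p :: "nat \<Rightarrow> bit" and v assume "\<forall>x. v x \<in> grade Q (p x)"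
    then have "\<forall>x. \<exists>a. a \<in> grade F (p x) \<and> v x = proj a" unfolding Q_simps by blast
    then obtain u where u: "\<And>x. u x \<in> grade F (p x)" "\<And>x. v x = proj (u x)" by metis
    have uc: "u x \<in> carrier F" for x using u(1) F.grade_carrier by blast
    have "eval_npoly Q (\<lambda>x. proj (u x)) (superization p f) = \<zero>\<^bsub>Q\<^esub>"
      using * u(1) by (subst eval_Q[OF uc]) (auto simp only: Q_simps(2) proj_eq_iff diff_zero)
    moreover have "v = (\<lambda>x. proj (u x))" using u(2) by blast
    ultimately show "eval_npoly Q v (superization p f) = \<zero>\<^bsub>Q\<^esub>" by simp
  qed
qed

end

text \<open>
  The homogeneous components of an element are unique, so the components provided by the members of
  the family all coincide.
\<close>

lemma graded_ideal_Inter: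
  fixes \<J> :: "('x, 'f::field) npoly set set"
  assumes ne: "\<J> \<noteq> {}" and gr: "\<And>J. J \<in> \<J> \<Longrightarrow> graded_ideal J (free_superalg X par)"
  shows "graded_ideal (\<Inter>\<J>) (free_superalg X par)"
proof -
  let ?F = "free_superalg X par :: ('f, ('x, 'f) npoly) superalg"
  interpret F: superalgebra ?F by (rule superalgebra_free)
  note sub = gr[unfolded graded_ideal_def F.submodule_iff]
  show ?thesis
    unfolding graded_ideal_def F.submodule_iff
  proof (intro conjI ballI)
    show "\<Inter>\<J> \<subseteq> carrier ?F" using ne sub by blast
    fix x assume x: "x \<in> \<Inter>\<J>"
    then obtain J1 where J1: "J1 \<in> \<J>" "x \<in> J1" using ne by blast
    then obtain x0 x1 where x01: "x0 \<in> grade ?F 0" "x1 \<in> grade ?F 1" "x = x0 \<oplus>\<^bsub>?F\<^esub> x1"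
      using sub by blast
    have "x0 \<in> J \<and> x1 \<in> J" if J: "J \<in> \<J>" for J
    proof -
      obtain y0 y1 where y: "y0 \<in> J" "y0 \<in> grade ?F 0" "y1 \<in> J" "y1 \<in> grade ?F 1" "x = y0 \<oplus>\<^bsub>?F\<^esub> y1"
        using sub[OF J] x J by blast
      have neg: "- z \<in> grade ?F i" if "z \<in> grade ?F i" for z i
        using F.grade_smult[OF that, of "- 1"] by (simp add: smult_simps)
      have "x0 - y0 = y1 - x1" using x01(3) y(5) by (simp add: algebra_simps)
      moreover have "x0 - y0 \<in> grade ?F 0" using F.grade_add[OF x01(1) neg[OF y(2)]] by simp
      moreover have "y1 - x1 \<in> grade ?F 1" using F.grade_add[OF y(4) neg[OF x01(2)]] by simp
      ultimately have "x0 - y0 = 0" "y1 - x1 = 0" using F.grade_both[of "x0 - y0"] by simp_all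
      then show ?thesis using y by simp
    qed
    then show "\<exists>x0\<in>\<Inter>\<J> \<inter> grade ?F 0. \<exists>x1\<in>\<Inter>\<J> \<inter> grade ?F 1. x = x0 \<oplus>\<^bsub>?F\<^esub> x1"
      using x01 by blast
  qed (use sub in blast)+
qed

lemma eval_npoly_smult:
  fixes A :: "('f::field, 'a, 'm) module_scheme" (structure)
  assumes "nonassoc_algebra A" and v: "\<And>x. v x \<in> carrier A"
  shows "eval_npoly A v (Poly_Mapping.map ((*) c) f) = c \<odot> eval_npoly A v f"
proof -
  interpret nonassoc_algebra A by fact
  show ?thesis
    by (induction f rule: npoly_induct)
      (simp_all add: v eval_npoly_add smult_add_right eval_npoly_closed eval_word_closed smult_smult smult_simps)
qed

lemma eval_npoly_mult:
  fixes A :: "('f::field, 'a, 'm) module_scheme" (structure)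
  assumes "nonassoc_algebra A" and v: "\<And>x. v x \<in> carrier A"
  shows "eval_npoly A v (npoly_mult f g) = eval_npoly A v f \<otimes> eval_npoly A v g"
proof -
  interpret nonassoc_algebra A by fact
  note [simp] = v eval_npoly_closed eval_word_closed
  have "eval_npoly A v (npoly_mult (Poly_Mapping.single w c) g) = (c \<odot> eval_word A v w) \<otimes> eval_npoly A v g" for w c
    by (induction g rule: npoly_induct)
      (simp_all add: eval_npoly_add mult_r_distr npoly_mult_bilinear mult_closed mult_smult_l mult_smult_r smult_smult mult.commute)
  then show ?thesis
    by (induction f rule: npoly_induct)
      (simp_all add: eval_npoly_add mult_l_distr npoly_mult_bilinear)
qed

lemma alg_hom_eval:
  assumes "nonassoc_algebra A" "\<And>x. v x \<in> carrier A"
  shows "alg_hom (eval_npoly A v) (free_superalg X par) A"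
  using assms unfolding alg_hom_def
  by (auto simp: eval_npoly_mult eval_npoly_smult nonassoc_algebra.eval_npoly_add nonassoc_algebra.eval_npoly_closed)

definition eval_kernel :: "('f::field, 'a) superalg \<Rightarrow> ('x \<Rightarrow> 'a) \<Rightarrow> 'x set \<Rightarrow> ('x, 'f) npoly set"
  where "eval_kernel A v X = {p. (\<forall>w\<in>Poly_Mapping.keys p. set (letters w) \<subseteq> X) \<and> eval_npoly A v p = \<zero>\<^bsub>A\<^esub>}"

context superalgebra
begin

lemma eval_npoly_grade:
  assumes "\<And>x. v x \<in> grade A (par x)" "\<And>w. w \<in> Poly_Mapping.keys p \<Longrightarrow> word_parity par w = i"
  shows "eval_npoly A v p \<in> grade A i"
proof -
  have c: "v x \<in> carrier A" for x using assms(1) grade_carrier by blast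
  show ?thesis
  proof (induction p rule: npoly_induct)
    case (add q w b)
    have "eval_word A v w \<in> grade A i"
      using eval_word_grade[of w v par] assms(1) assms(2)[OF add(2)] by (auto simp only: word_parity_def)
    with add show ?case
      by (simp add: c eval_npoly_add grade_add grade_smult)
  qed simp
qed

end

text \<open>
  A homogeneous polynomial takes a homogeneous value, so the even and the odd part of a polynomial
  in the kernel have opposite values, of different parity: both vanish.
\<close>

lemma graded_ideal_eval_kernel:
  fixes A :: "('f::field, 'a) superalg" (structure) and v :: "'x \<Rightarrow> 'a"
  assumes A: "superalgebra A" and v: "\<And>x. v x \<in> grade A (par x)"
  shows "graded_ideal (eval_kernel A v X) (free_superalg X par)"
proof -
  interpret superalgebra A by fact
  let ?F = "free_superalg X par :: ('f, ('x, 'f) npoly) superalg"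
  let ?J = "eval_kernel A v X"
  interpret F: superalgebra ?F by (rule superalgebra_free)
  have c: "v x \<in> carrier A" for x using v grade_carrier by blast
  note [simp] = eval_npoly_mult[OF nonassoc_algebra_axioms c] eval_npoly_smult[OF nonassoc_algebra_axioms c] eval_npoly_add eval_npoly_closed c
  have J: "?J = {p \<in> carrier ?F. eval_npoly A v p = \<zero>}"
    by (simp add: eval_kernel_def)
  show ?thesis
    unfolding graded_ideal_def F.submodule_iff
  proof (intro conjI ballI allI)
    fix x y assume "x \<in> ?J" "y \<in> carrier ?F"
    then show "x \<otimes>\<^bsub>?F\<^esub> y \<in> ?J" "y \<otimes>\<^bsub>?F\<^esub> x \<in> ?J"
      using F.mult_closed[of x y] F.mult_closed[of y x] unfolding J by simp_all
  next
    fix x y assume "x \<in> ?J" "y \<in> ?J"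
    then show "x \<oplus>\<^bsub>?F\<^esub> y \<in> ?J"
      using F.a_closed[of x y] unfolding J by simp
  next
    fix x a assume "x \<in> ?J"
    then show "a \<odot>\<^bsub>?F\<^esub> x \<in> ?J"
      using F.smult_carrier[of x a] unfolding J by simp
  next
    fix x assume x: "x \<in> ?J"
    then obtain x0 x1 where x01: "x0 \<in> grade ?F 0" "x1 \<in> grade ?F 1" "x = x0 \<oplus>\<^bsub>?F\<^esub> x1"
      using F.grade_sum[of x] unfolding J by blast
    have e: "eval_npoly A v x0 \<in> grade A 0" "eval_npoly A v x1 \<in> grade A 1"
      using x01 by (auto intro!: eval_npoly_grade[of v par] v)
    have "eval_npoly A v x0 \<oplus> eval_npoly A v x1 = \<zero>"
      using x x01 unfolding J by simp
    then have "eval_npoly A v x0 = \<ominus> eval_npoly A v x1"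
      by (intro minus_equality[symmetric]) simp_all
    then have "eval_npoly A v x0 \<in> grade A 1"
      using e(2) by (simp add: a_inv_eq_smult grade_smult)
    with e(1) have "eval_npoly A v x0 = \<zero>" by (rule grade_both)
    with \<open>eval_npoly A v x0 \<oplus> _ = _\<close> have "eval_npoly A v x1 = \<zero>" by simp
    then show "\<exists>x0\<in>?J \<inter> grade ?F 0. \<exists>x1\<in>?J \<inter> grade ?F 1. x = x0 \<oplus>\<^bsub>?F\<^esub> x1"
      using x01 \<open>eval_npoly A v x0 = \<zero>\<close> F.grade_carrier[OF x01(1)] F.grade_carrier[OF x01(2)]
      unfolding J by blast
  qed (auto simp: J)
qed

text \<open>
  The quotient is a copy, carried by sets of polynomials, of the subalgebra of \<open>A\<close> generated by the
  values of \<open>v\<close>. Through it a superalgebra over an arbitrary type takes part in the intersection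
  that defines a relatively free superalgebra.
\<close>

lemma quotient_eval_kernel_satisfies_super:
  fixes A :: "('f::field, 'a) superalg" (structure) and v :: "'x \<Rightarrow> 'a"
  assumes A: "superalgebra A" and v: "\<And>x. v x \<in> grade A (par x)" and sat: "satisfies_super A f"
  shows "satisfies_super (quotient_superalg (free_superalg X par) (eval_kernel A v X)) f"
proof -
  interpret superalgebra A by fact
  let ?F = "free_superalg X par :: ('f, ('x, 'f) npoly) superalg"
  interpret free_ideal X par "eval_kernel A v X"
    by unfold_locales (rule graded_ideal_eval_kernel[OF A v])
  have c: "v x \<in> carrier A" for x using v grade_carrier by blast
  show ?thesis
    unfolding Q_satisfies_super_iff
  proof (intro allI impI)
    fix p :: "nat \<Rightarrow> bit" and u assume u: "\<forall>x. u x \<in> grade ?F (p x)"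
    then have uc: "u x \<in> carrier ?F" for x using F.grade_carrier by blast
    have "eval_npoly A v (eval_npoly ?F u (superization p f)) = eval_npoly A (\<lambda>x. eval_npoly A v (u x)) (superization p f)"
      by (rule eval_npoly_hom[symmetric, OF alg_hom_eval]) (auto simp only: c uc F.nonassoc_algebra_axioms nonassoc_algebra_axioms)
    also have "\<dots> = \<zero>"
      using u by (intro satisfies_super_grade[OF sat] eval_npoly_grade[of v par] v) auto
    finally show "eval_npoly ?F u (superization p f) \<in> eval_kernel A v X"
      using F.eval_npoly_closed[of u "superization p f"] uc by (simp add: eval_kernel_def)
  qed
qed

section \<open>Multilinear polynomials\<close>

lemma eval_word_cong: "(\<And>x. x \<in> set (letters w) \<Longrightarrow> v x = v' x) \<Longrightarrow> eval_word A v w = eval_word A v' w"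
  by (induction w) auto

inductive_set lin_span :: "('f::field, 'a, 'm) module_scheme \<Rightarrow> 'a set \<Rightarrow> 'a set"
  for A E where
  zero: "\<zero>\<^bsub>A\<^esub> \<in> lin_span A E"
| add: "e \<in> E \<Longrightarrow> y \<in> lin_span A E \<Longrightarrow> c \<odot>\<^bsub>A\<^esub> e \<oplus>\<^bsub>A\<^esub> y \<in> lin_span A E"

context nonassoc_algebra
begin

lemma eval_npoly_cong:
  assumes "\<And>w x. w \<in> Poly_Mapping.keys f \<Longrightarrow> x \<in> set (letters w) \<Longrightarrow> v x = v' x" and "\<And>x. v' x \<in> carrier A"
  shows "eval_npoly A v f = eval_npoly A v' f"
proof -
  have "eval_word A v w = eval_word A v' w" if "w \<in> Poly_Mapping.keys f" for w
    using that assms(1) by (intro eval_word_cong) auto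
  then show ?thesis
    unfolding eval_npoly_def using assms(2) by (intro add.finprod_cong') (auto intro: eval_word_closed)
qed

lemma eval_word_linear:
  assumes "distinct (letters w)" "x \<in> set (letters w)" and v: "\<And>x. v x \<in> carrier A"
    and ab: "a \<in> carrier A" "b \<in> carrier A"
  shows "eval_word A (v(x := c \<odot> a \<oplus> b)) w = c \<odot> eval_word A (v(x := a)) w \<oplus> eval_word A (v(x := b)) w"
  using assms(1,2)
proof (induction w)
  case (Times u w)
  have cl: "eval_word A (v(x := y)) w \<in> carrier A" if "y \<in> carrier A" for w y
    using that v by (intro eval_word_closed) auto
  note [simp] = cl ab mult_closed
  from Times.prems consider "x \<in> set (letters u)" "x \<notin> set (letters w)" | "x \<in> set (letters w)" "x \<notin> set (letters u)"
    by auto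
  then show ?case
  proof cases
    case 1
    then have "eval_word A (v(x := y)) w = eval_word A v w" for y
      by (intro eval_word_cong) auto
    moreover have "eval_word A v w \<in> carrier A" by (intro eval_word_closed v)
    ultimately show ?thesis
      using 1 Times by (simp add: mult_l_distr mult_smult_l del: fun_upd_apply)
  next
    case 2
    then have "eval_word A (v(x := y)) u = eval_word A v u" for y
      by (intro eval_word_cong) auto
    moreover have "eval_word A v u \<in> carrier A" by (intro eval_word_closed v)
    ultimately show ?thesis
      using 2 Times by (simp add: mult_r_distr mult_smult_r del: fun_upd_apply)
  qed
qed simp

lemma smult_exchange:
  assumes "x \<in> carrier A" "y \<in> carrier A" "z \<in> carrier A" "t \<in> carrier A"
  shows "d \<odot> (c \<odot> x \<oplus> y) \<oplus> (c \<odot> z \<oplus> t) = c \<odot> (d \<odot> x \<oplus> z) \<oplus> (d \<odot> y \<oplus> t)"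
  using assms by (simp add: smult_add_right smult_smult a_ac mult.commute)

lemma eval_npoly_linear:
  assumes f: "\<And>w. w \<in> Poly_Mapping.keys f \<Longrightarrow> distinct (letters w) \<and> x \<in> set (letters w)"
    and v: "\<And>x. v x \<in> carrier A" and ab: "a \<in> carrier A" "b \<in> carrier A"
  shows "eval_npoly A (v(x := c \<odot> a \<oplus> b)) f = c \<odot> eval_npoly A (v(x := a)) f \<oplus> eval_npoly A (v(x := b)) f"
proof (induction f rule: npoly_induct)
  case (add p w d)
  have v': "(v(x := y)) z \<in> carrier A" if "y \<in> carrier A" for y z using that v by simp
  have cl: "eval_word A (v(x := y)) w \<in> carrier A" "eval_npoly A (v(x := y)) p \<in> carrier A" if "y \<in> carrier A" for y
    using that v by (auto intro!: eval_word_closed eval_npoly_closed)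
  have w: "eval_word A (v(x := c \<odot> a \<oplus> b)) w = c \<odot> eval_word A (v(x := a)) w \<oplus> eval_word A (v(x := b)) w"
    using f[OF add(2)] by (intro eval_word_linear v ab) auto
  show ?case
    using ab by (simp add: eval_npoly_add v' cl add(1) w smult_exchange del: fun_upd_apply)
qed simp

lemma lin_span_carrier: "y \<in> lin_span A E \<Longrightarrow> E \<subseteq> carrier A \<Longrightarrow> y \<in> carrier A"
  by (induction rule: lin_span.induct) auto

text \<open>
  Every variable occurs exactly once in every word, so the value is linear in each variable and the
  variables can be expanded one after another. The subspace \<open>Z\<close> will be zero for Grassmann
  envelopes, and in a free superalgebra the span of the words that vanish in metabelian algebras.
\<close>

lemma eval_npoly_lin_span:
  assumes X: "finite X" "\<And>w. w \<in> Poly_Mapping.keys f \<Longrightarrow> distinct (letters w) \<and> set (letters w) = X"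
    and Z: "\<zero> \<in> Z" "\<And>x y. x \<in> Z \<Longrightarrow> y \<in> Z \<Longrightarrow> x \<oplus> y \<in> Z" "\<And>c x. x \<in> Z \<Longrightarrow> c \<odot> x \<in> Z"
    and E: "\<And>x. E x \<subseteq> carrier A"
    and base: "\<And>v. (\<And>x. v x \<in> carrier A) \<Longrightarrow> (\<And>x. x \<in> X \<Longrightarrow> v x \<in> E x) \<Longrightarrow> eval_npoly A v f \<in> Z"
    and v: "\<And>x. v x \<in> carrier A" "\<And>x. x \<in> X \<Longrightarrow> v x \<in> lin_span A (E x)"
  shows "eval_npoly A v f \<in> Z"
proof -
  have "eval_npoly A v f \<in> Z"
    if "finite Y" "Y \<subseteq> X" "\<And>x. v x \<in> carrier A" "\<And>x. x \<in> Y \<Longrightarrow> v x \<in> lin_span A (E x)"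
      "\<And>x. x \<in> X - Y \<Longrightarrow> v x \<in> E x" for Y v
    using that
  proof (induction Y arbitrary: v rule: finite_induct)
    case (insert y Y)
    have "eval_npoly A (v(y := b)) f \<in> Z" if "b \<in> lin_span A (E y)" for b
      using that
    proof (induction rule: lin_span.induct)
      case zero
      have cl: "eval_npoly A (v(y := \<zero>)) f \<in> carrier A"
        using insert.prems by (intro eval_npoly_closed) auto
      \<comment> \<open>linearity for the trivial combination \<open>(- 1) 0 + 0\<close> shows that the value at zero is zero\<close>
      have "eval_npoly A (v(y := (- 1) \<odot> \<zero> \<oplus> \<zero>)) f = (- 1) \<odot> eval_npoly A (v(y := \<zero>)) f \<oplus> eval_npoly A (v(y := \<zero>)) f"
        using X insert by (intro eval_npoly_linear) auto
      then have "eval_npoly A (v(y := \<zero>)) f = \<zero>" using cl by simp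
      then show ?case using Z(1) by (simp only:)
    next
      case (add e z c)
      have ez: "e \<in> carrier A" "z \<in> carrier A" using add E[of y] lin_span_carrier by auto
      have "eval_npoly A (v(y := c \<odot> e \<oplus> z)) f = c \<odot> eval_npoly A (v(y := e)) f \<oplus> eval_npoly A (v(y := z)) f"
        using X insert by (intro eval_npoly_linear ez) auto
      moreover have "eval_npoly A (v(y := e)) f \<in> Z"
        using insert.prems insert.hyps ez add.hyps by (intro insert.IH) auto
      ultimately show ?case using Z add.IH by (simp del: fun_upd_apply)
    qed
    from this[of "v y"] show ?case using insert by simp
  qed (auto intro: base)
  from this[of X v] show ?thesis using X v by simp
qed

end

section \<open>Products over the pairs of a list\<close>

text \<open>
  The product of \<open>F x y\<close> over all pairs in which \<open>x\<close> stands before \<open>y\<close>. Koszul signs and the signs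
  of products in the Grassmann algebra both have this form, and it behaves well under concatenation,
  hence under the multiplication of words.
\<close>

primrec pair_prod :: "('a \<Rightarrow> 'a \<Rightarrow> 'b::comm_ring_1) \<Rightarrow> 'a list \<Rightarrow> 'b" where
  "pair_prod F [] = 1"
| "pair_prod F (x # xs) = (\<Prod>y\<leftarrow>xs. F x y) * pair_prod F xs"

definition cross_prod :: "('a \<Rightarrow> 'a \<Rightarrow> 'b::comm_ring_1) \<Rightarrow> 'a list \<Rightarrow> 'a list \<Rightarrow> 'b"
  where "cross_prod F xs ys = (\<Prod>x\<leftarrow>xs. \<Prod>y\<leftarrow>ys. F x y)"

lemma cross_prod_simps [simp]:
  "cross_prod F [] ys = 1" "cross_prod F (x # xs) ys = (\<Prod>y\<leftarrow>ys. F x y) * cross_prod F xs ys"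
  by (simp_all add: cross_prod_def)

lemma cross_prod_Nil_right [simp]: "cross_prod F xs [] = 1"
  by (induction xs) simp_all

lemma cross_prod_Cons_right: "cross_prod F xs (y # ys) = (\<Prod>x\<leftarrow>xs. F x y) * cross_prod F xs ys"
  by (induction xs) (auto simp: algebra_simps)

lemma cross_prod_append_right: "cross_prod F xs (ys @ ys') = cross_prod F xs ys * cross_prod F xs ys'"
  by (induction xs) (auto simp: algebra_simps)

lemma pair_prod_append: "pair_prod F (xs @ ys) = pair_prod F xs * pair_prod F ys * cross_prod F xs ys"
  by (induction xs) (auto simp: algebra_simps)

lemma prod_list_nonzero: "(\<And>y. y \<in> set ys \<Longrightarrow> g y \<noteq> 0) \<Longrightarrow> (\<Prod>y\<leftarrow>ys. g y) \<noteq> (0 :: 'b::field)"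
  by (induction ys) auto

lemma pair_prod_nonzero: "(\<And>x y. F x y \<noteq> 0) \<Longrightarrow> pair_prod F xs \<noteq> (0 :: 'b::field)"
  by (induction xs) (auto intro!: prod_list_nonzero simp del: prod_list_zero_iff)

lemma pair_prod_cong:
  assumes "distinct xs" "\<And>x y. x \<in> set xs \<Longrightarrow> y \<in> set xs \<Longrightarrow> x \<noteq> y \<Longrightarrow> F x y = F' x y"
  shows "pair_prod F xs = pair_prod F' xs"
  using assms
proof (induction xs)
  case (Cons x xs)
  have "map (F x) xs = map (F' x) xs" using Cons.prems by (intro map_cong refl) auto
  moreover have "pair_prod F xs = pair_prod F' xs" using Cons by simp
  ultimately show ?case by (simp only: pair_prod.simps)
qed simp

lemma prod_list_map_mult:
  "(\<Prod>x\<leftarrow>xs. g x * h x) = (\<Prod>x\<leftarrow>xs. g x) * (\<Prod>x\<leftarrow>xs. h x :: 'b::comm_ring_1)"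
  by (induction xs) (auto simp: algebra_simps)

lemma pair_prod_mult:
  fixes F F' :: "'a \<Rightarrow> 'a \<Rightarrow> 'b::comm_ring_1"
  shows "pair_prod (\<lambda>x y. F x y * F' x y) xs = pair_prod F xs * pair_prod F' xs"
  by (induction xs) (simp_all add: prod_list_map_mult algebra_simps)

lemma pair_prod_symmetric:
  assumes sym: "\<And>x y. F x y = F y x" and "mset xs = mset ys"
  shows "pair_prod F xs = pair_prod F ys"
  using assms(2)
proof (induction xs arbitrary: ys)
  case (Cons x xs)
  then have "x \<in> set ys" by (metis list.set_intros(1) mset_eq_setD)
  then obtain ys1 ys2 where ys: "ys = ys1 @ x # ys2" by (meson split_list)
  with Cons have "mset xs = mset (ys1 @ ys2)" by simp
  moreover from this have "(\<Prod>y\<leftarrow>xs. F x y) = (\<Prod>y\<leftarrow>ys1 @ ys2. F x y)"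
    by (metis mset_map prod_mset_prod_list)
  moreover have "(\<Prod>y\<leftarrow>ys1. F x y) = (\<Prod>y\<leftarrow>ys1. F y x)"
    by (rule arg_cong[of _ _ prod_list]) (simp add: sym)
  ultimately show ?case
    using Cons.IH[of "ys1 @ ys2"] by (simp add: ys pair_prod_append cross_prod_Cons_right algebra_simps)
qed simp

lemma prod_list_signs:
  "(\<Prod>y\<leftarrow>ys. if R y then - 1 else 1) = (- 1 :: 'b::comm_ring_1) ^ card {l. l < length ys \<and> R (ys ! l)}"
proof -
  have "(\<Prod>y\<leftarrow>ys. if R y then - 1 else 1) = (- 1 :: 'b) ^ length (filter R ys)"
    by (induction ys) auto
  then show ?thesis by (simp add: length_filter_conv_card)
qed

lemma sign_of_inversions:
  "(- 1 :: 'b::comm_ring_1) ^ card {(k, l). k < l \<and> l < length xs \<and> R (xs ! k) (xs ! l)} =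
    pair_prod (\<lambda>x y. if R x y then - 1 else 1) xs"
proof (induction xs)
  case (Cons x xs)
  let ?I = "\<lambda>xs. {(k, l). k < l \<and> l < length xs \<and> R (xs ! k) (xs ! l)}"
  let ?S = "{l. l < length xs \<and> R x (xs ! l)}"
  have fin: "finite (?I xs)"
    by (rule finite_subset[of _ "{..<length xs} \<times> {..<length xs}"]) auto
  have *: "(k, l) \<in> ?I (x # xs) \<longleftrightarrow>
      (\<exists>l'. k = 0 \<and> l = Suc l' \<and> l' \<in> ?S) \<or> (\<exists>k' l'. k = Suc k' \<and> l = Suc l' \<and> (k', l') \<in> ?I xs)" for k l
    by (cases k; cases l) simp_all
  have I: "?I (x # xs) = (\<lambda>l. (0 :: nat, Suc l)) ` ?S \<union> map_prod Suc Suc ` ?I xs"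
  proof (rule Set.set_eqI)
    fix p :: "nat \<times> nat"
    obtain k l where p: "p = (k, l)" by (cases p)
    show "p \<in> ?I (x # xs) \<longleftrightarrow> p \<in> (\<lambda>l. (0 :: nat, Suc l)) ` ?S \<union> map_prod Suc Suc ` ?I xs"
      unfolding p * by (simp add: image_iff Bex_def split_paired_Ex) blast
  qed
  have "card (?I (x # xs)) = card ((\<lambda>l. (0 :: nat, Suc l)) ` ?S) + card (map_prod Suc Suc ` ?I xs)"
    unfolding I
  proof (rule card_Un_disjoint)
    have L: "fst p = 0" if "p \<in> (\<lambda>l. (0 :: nat, Suc l)) ` ?S" for p
      using that by (elim imageE) simp
    have R: "fst p \<noteq> 0" if "p \<in> map_prod Suc Suc ` ?I xs" for p
      using that by (elim imageE) simp
    show "(\<lambda>l. (0 :: nat, Suc l)) ` ?S \<inter> map_prod Suc Suc ` ?I xs = {}"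
    proof (intro disjoint_iff[THEN iffD2] allI impI notI)
      fix p assume "p \<in> (\<lambda>l. (0 :: nat, Suc l)) ` ?S" "p \<in> map_prod Suc Suc ` ?I xs"
      then show False by (elim R[THEN notE] L)
    qed
  qed (simp_all add: fin)
  moreover have "card ((\<lambda>l. (0 :: nat, Suc l)) ` ?S) = card ?S"
    by (intro card_image inj_onI) simp
  moreover have "card (map_prod Suc Suc ` ?I xs) = card (?I xs)"
    by (intro card_image inj_on_subset[OF prod.inj_map] inj_Suc subset_UNIV)
  ultimately have "card (?I (x # xs)) = card ?S + card (?I xs)" by (simp only:)
  then show ?case
    by (simp only: power_add prod_list_signs pair_prod.simps Cons.IH)
qed simp

definition koszul_factor :: "(nat \<Rightarrow> bit) \<Rightarrow> nat \<Rightarrow> nat \<Rightarrow> 'f::field"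
  where "koszul_factor par x y = (if y < x \<and> par x * par y = 1 then - 1 else 1)"

lemma koszul_sign_pair_prod: "koszul_sign par w = pair_prod (koszul_factor par) (letters w)"
  using sign_of_inversions[of "letters w" "\<lambda>x y. y < x \<and> par x * par y = 1"]
  unfolding koszul_sign_def koszul_factor_def by simp

section \<open>Grassmann envelopes\<close>

lemma grassmann_sign_Un_left:
  assumes "finite P" "finite P'" "finite Q" "P \<inter> P' = {}"
  shows "grassmann_sign (P \<union> P') Q = grassmann_sign P Q * grassmann_sign P' Q"
proof -
  have "{(p, q). p \<in> P \<union> P' \<and> q \<in> Q \<and> q < p} = {(p, q). p \<in> P \<and> q \<in> Q \<and> q < p} \<union> {(p, q). p \<in> P' \<and> q \<in> Q \<and> q < p}"
    by auto
  moreover have "finite {(p, q). p \<in> P \<and> q \<in> Q \<and> q < p}" "finite {(p, q). p \<in> P' \<and> q \<in> Q \<and> q < p}"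
    using assms by (auto intro: finite_subset[of _ "P \<times> Q"] finite_subset[of _ "P' \<times> Q"])
  moreover have "{(p, q). p \<in> P \<and> q \<in> Q \<and> q < p} \<inter> {(p, q). p \<in> P' \<and> q \<in> Q \<and> q < p} = {}"
    using assms by auto
  ultimately show ?thesis
    unfolding grassmann_sign_def by (simp add: card_Un_disjoint power_add)
qed

text \<open>
  Each pair in \<open>P \<times> Q\<close> is an inversion for exactly one of the two orders.
\<close>

lemma grassmann_sign_swap:
  assumes "finite P" "finite Q" "P \<inter> Q = {}"
  shows "grassmann_sign P Q * grassmann_sign Q P = ((- 1) ^ (card P * card Q) :: 'f::field)"
proof -
  let ?I = "{(p, q). p \<in> P \<and> q \<in> Q \<and> q < p}" and ?J = "{(p, q). p \<in> P \<and> q \<in> Q \<and> p < q}"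
    and ?K = "{(q, p). q \<in> Q \<and> p \<in> P \<and> p < q}"
  have f: "finite ?I" "finite ?J"
    using assms by (auto intro: finite_subset[of _ "P \<times> Q"])
  have "p \<noteq> q" if "p \<in> P" "q \<in> Q" for p q using assms(3) that by blast
  then have "P \<times> Q = ?I \<union> ?J"
    by (auto simp: nat_neq_iff)
  moreover have "?I \<inter> ?J = {}" by auto
  ultimately have "card (P \<times> Q) = card ?I + card ?J"
    using f by (simp add: card_Un_disjoint)
  also have "?J = prod.swap ` ?K" by (auto simp: image_def)
  also have "card \<dots> = card ?K" by (intro card_image) simp
  finally show ?thesis
    using assms unfolding grassmann_sign_def by (simp add: power_add[symmetric] card_cartesian_product)
qed

lemma grassmann_sign_Un_right:
  assumes "finite P" "finite P'" "finite Q" "P \<inter> P' = {}"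
  shows "grassmann_sign Q (P \<union> P') = grassmann_sign Q P * grassmann_sign Q P'"
proof -
  have "{(p, q). p \<in> Q \<and> q \<in> P \<union> P' \<and> q < p} = {(p, q). p \<in> Q \<and> q \<in> P \<and> q < p} \<union> {(p, q). p \<in> Q \<and> q \<in> P' \<and> q < p}"
    by auto
  moreover have "finite {(p, q). p \<in> Q \<and> q \<in> P \<and> q < p}" "finite {(p, q). p \<in> Q \<and> q \<in> P' \<and> q < p}"
    using assms by (auto intro: finite_subset[of _ "Q \<times> P"] finite_subset[of _ "Q \<times> P'"])
  moreover have "{(p, q). p \<in> Q \<and> q \<in> P \<and> q < p} \<inter> {(p, q). p \<in> Q \<and> q \<in> P' \<and> q < p} = {}"
    using assms by auto
  ultimately show ?thesis
    unfolding grassmann_sign_def by (simp add: card_Un_disjoint power_add)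
qed

lemma grassmann_sign_nonzero [simp]: "grassmann_sign P Q \<noteq> (0 :: 'f::field)"
  by (simp add: grassmann_sign_def)

lemma grassmann_sign_square: "grassmann_sign P Q * grassmann_sign P Q = (1 :: 'f::field)"
  by (simp add: grassmann_sign_def power_mult_distrib[symmetric])

lemma grassmann_sign_empty [simp]: "grassmann_sign {} Q = 1" "grassmann_sign Q {} = 1"
  by (simp_all add: grassmann_sign_def)

definition disjoint_supports :: "('x \<Rightarrow> 'b set) \<Rightarrow> 'x set \<Rightarrow> bool"
  where "disjoint_supports \<sigma> X \<longleftrightarrow> (\<forall>x\<in>X. \<forall>y\<in>X. x \<noteq> y \<longrightarrow> \<sigma> x \<inter> \<sigma> y = {})"

lemma grassmann_sign_UN:
  assumes "distinct (xs @ ys)" "disjoint_supports \<sigma> (set (xs @ ys))" and fin: "\<And>x. finite (\<sigma> x)"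
  shows "grassmann_sign (\<Union>(\<sigma> ` set xs)) (\<Union>(\<sigma> ` set ys)) =
    cross_prod (\<lambda>x y. grassmann_sign (\<sigma> x) (\<sigma> y) :: 'f::field) xs ys"
  using assms(1,2)
proof (induction xs)
  case (Cons x xs)
  have 1: "grassmann_sign (\<sigma> x) (\<Union>(\<sigma> ` set zs)) = (\<Prod>y\<leftarrow>zs. grassmann_sign (\<sigma> x) (\<sigma> y) :: 'f)"
    if "distinct zs" "set zs \<subseteq> set ys" for zs
    using that
  proof (induction zs)
    case (Cons z zs)
    have "grassmann_sign (\<sigma> x) (\<sigma> z \<union> \<Union>(\<sigma> ` set zs)) =
        (grassmann_sign (\<sigma> x) (\<sigma> z) * grassmann_sign (\<sigma> x) (\<Union>(\<sigma> ` set zs)) :: 'f)"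
    proof (rule grassmann_sign_Un_right)
      have "\<sigma> z \<inter> \<sigma> y = {}" if "y \<in> set zs" for y
      proof -
        have "y \<noteq> z" "y \<in> set ys" "z \<in> set ys" using that Cons.prems by auto
        then show ?thesis
          using \<open>disjoint_supports \<sigma> (set ((x # xs) @ ys))\<close> unfolding disjoint_supports_def by auto
      qed
      then show "\<sigma> z \<inter> \<Union>(\<sigma> ` set zs) = {}" by blast
    qed (auto simp: fin)
    then show ?case using Cons by simp
  qed simp
  have "grassmann_sign (\<sigma> x \<union> \<Union>(\<sigma> ` set xs)) (\<Union>(\<sigma> ` set ys)) =
    (grassmann_sign (\<sigma> x) (\<Union>(\<sigma> ` set ys)) * grassmann_sign (\<Union>(\<sigma> ` set xs)) (\<Union>(\<sigma> ` set ys)) :: 'f)"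
  proof (rule grassmann_sign_Un_left)
    have "\<sigma> x \<inter> \<sigma> y = {}" if "y \<in> set xs" for y
      using that Cons.prems unfolding disjoint_supports_def by auto
    then show "\<sigma> x \<inter> \<Union>(\<sigma> ` set xs) = {}" by blast
  qed (auto simp: fin)
  moreover have "disjoint_supports \<sigma> (set (xs @ ys))"
    using Cons.prems(2) by (simp add: disjoint_supports_def)
  ultimately show ?case
    using Cons 1[of ys] by simp
qed simp

text \<open>
  The element \<open>e\<^sub>S \<otimes> a\<close> of the Grassmann envelope.
\<close>

definition pure_tensor :: "('f::field, 'a) superalg \<Rightarrow> nat set \<Rightarrow> 'a \<Rightarrow> nat set \<Rightarrow> 'a"
  where "pure_tensor A S a = (\<lambda>T. if T = S then a else \<zero>\<^bsub>A\<^esub>)"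

text \<open>
  The record type is the one on which \<^const>\<open>grassmann_envelope\<close> is defined.
\<close>

locale plain_superalgebra = superalgebra A for A :: "('f::field, 'a) superalg" (structure)
begin

abbreviation G :: "('f, nat set \<Rightarrow> 'a) module" where "G \<equiv> grassmann_envelope A"

lemma G_simps:
  "carrier G = {g. finite {S. g S \<noteq> \<zero>} \<and> (\<forall>S. if finite S then g S \<in> grade A (of_nat (card S)) else g S = \<zero>)}"
  "g \<otimes>\<^bsub>G\<^esub> h = (\<lambda>S. if finite S then \<Oplus>P\<in>Pow S. grassmann_sign P (S - P) \<odot> (g P \<otimes> h (S - P)) else \<zero>)"
  "\<zero>\<^bsub>G\<^esub> = (\<lambda>S. \<zero>)"
  "g \<oplus>\<^bsub>G\<^esub> h = (\<lambda>S. g S \<oplus> h S)"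
  "c \<odot>\<^bsub>G\<^esub> g = (\<lambda>S. c \<odot> g S)"
  by (simp_all add: grassmann_envelope_def)

lemma G_component_grade: "g \<in> carrier G \<Longrightarrow> finite S \<Longrightarrow> g S \<in> grade A (of_nat (card S))"
  unfolding G_simps by (auto split: if_splits dest: spec[of _ S])

lemma G_component: "g \<in> carrier G \<Longrightarrow> g S \<in> carrier A"
  unfolding G_simps by (cases "finite S") (auto dest!: spec[of _ S] intro: grade_carrier)

lemma G_carrierI:
  "finite {S. g S \<noteq> \<zero>} \<Longrightarrow> (\<And>S. finite S \<Longrightarrow> g S \<in> grade A (of_nat (card S))) \<Longrightarrow>
    (\<And>S. infinite S \<Longrightarrow> g S = \<zero>) \<Longrightarrow> g \<in> carrier G"
  unfolding G_simps by auto

lemma G_finite_support: "g \<in> carrier G \<Longrightarrow> finite {S. g S \<noteq> \<zero>}"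
  unfolding G_simps by simp

lemma G_infinite: "g \<in> carrier G \<Longrightarrow> infinite S \<Longrightarrow> g S = \<zero>"
  unfolding G_simps by (auto dest!: spec[of _ S])

lemma finsum_grade: "(\<And>i. i \<in> I \<Longrightarrow> g i \<in> grade A k) \<Longrightarrow> (\<Oplus>i\<in>I. g i) \<in> grade A k"
proof (induction I rule: infinite_finite_induct)
  case (insert i I)
  then have "(\<Oplus>i\<in>insert i I. g i) = g i \<oplus> (\<Oplus>i\<in>I. g i)"
    using grade_carrier by (intro finsum_insert) auto
  then show ?case using insert by (simp add: grade_add)
qed (simp_all add: finsum_infinite)

lemma finsum_smult: "(\<And>i. i \<in> I \<Longrightarrow> g i \<in> carrier A) \<Longrightarrow> (\<Oplus>i\<in>I. c \<odot> g i) = c \<odot> (\<Oplus>i\<in>I. g i)"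
  by (rule additive_finsum[symmetric]) (auto simp: smult_add_right abelian_monoid_axioms)

lemma finsum_eq_zero: "(\<And>i. i \<in> I \<Longrightarrow> g i = \<zero>) \<Longrightarrow> (\<Oplus>i\<in>I. g i) = \<zero>"
  using add.finprod_one_eqI[of I g] by simp

lemma G_mult_closed:
  assumes g: "g \<in> carrier G" and h: "h \<in> carrier G"
  shows "g \<otimes>\<^bsub>G\<^esub> h \<in> carrier G"
proof (rule G_carrierI)
  let ?U = "(\<lambda>(P, Q). P \<union> Q) ` ({S. g S \<noteq> \<zero>} \<times> {S. h S \<noteq> \<zero>})"
  have "(g \<otimes>\<^bsub>G\<^esub> h) S = \<zero>" if "S \<notin> ?U" for S
  proof -
    have "grassmann_sign P (S - P) \<odot> (g P \<otimes> h (S - P)) = \<zero>" if "P \<in> Pow S" for P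
    proof -
      have "S = P \<union> (S - P)" using that by blast
      then have "g P = \<zero> \<or> h (S - P) = \<zero>" using \<open>S \<notin> ?U\<close> by (force simp: image_iff)
      then show ?thesis using G_component[OF g, of P] G_component[OF h, of "S - P"] by auto
    qed
    from finsum_eq_zero[of "Pow S", OF this] show ?thesis by (simp add: G_simps(2))
  qed
  then have "{S. (g \<otimes>\<^bsub>G\<^esub> h) S \<noteq> \<zero>} \<subseteq> ?U" by blast
  then show "finite {S. (g \<otimes>\<^bsub>G\<^esub> h) S \<noteq> \<zero>}"
    using G_finite_support[OF g] G_finite_support[OF h] by (meson finite_SigmaI finite_imageI finite_subset)
next
  fix S :: "nat set" assume S: "finite S"
  have "grassmann_sign P (S - P) \<odot> (g P \<otimes> h (S - P)) \<in> grade A (of_nat (card S))" if "P \<in> Pow S" for P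
  proof -
    have f: "finite P" "finite (S - P)" using that S finite_subset by auto
    have "card S = card P + card (S - P)"
      using that S f by (metis Diff_disjoint PowD Un_Diff_cancel card_Un_disjoint sup.absorb2)
    then have "(of_nat (card S) :: bit) = of_nat (card P) + of_nat (card (S - P))"
      by (simp only: of_nat_add)
    then show ?thesis
      using grade_mult[OF G_component_grade[OF g f(1)] G_component_grade[OF h f(2)]] grade_smult by simp
  qed
  from finsum_grade[of "Pow S", OF this] show "(g \<otimes>\<^bsub>G\<^esub> h) S \<in> grade A (of_nat (card S))"
    using S by (simp add: G_simps(2))
qed (simp add: G_simps)

lemma G_add_closed: "g \<in> carrier G \<Longrightarrow> h \<in> carrier G \<Longrightarrow> g \<oplus>\<^bsub>G\<^esub> h \<in> carrier G"
proof (rule G_carrierI)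
  assume g: "g \<in> carrier G" and h: "h \<in> carrier G"
  show "finite {S. (g \<oplus>\<^bsub>G\<^esub> h) S \<noteq> \<zero>}"
    by (rule finite_subset[of _ "{S. g S \<noteq> \<zero>} \<union> {S. h S \<noteq> \<zero>}"])
      (auto simp: G_simps(4) G_finite_support[OF g] G_finite_support[OF h])
qed (auto simp: G_simps(4) G_component_grade G_infinite grade_add)

lemma G_smult_closed: "g \<in> carrier G \<Longrightarrow> c \<odot>\<^bsub>G\<^esub> g \<in> carrier G"
proof (rule G_carrierI)
  assume g: "g \<in> carrier G"
  show "finite {S. (c \<odot>\<^bsub>G\<^esub> g) S \<noteq> \<zero>}"
    by (rule finite_subset[of _ "{S. g S \<noteq> \<zero>}"]) (auto simp: G_simps(5) G_finite_support[OF g])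
qed (auto simp: G_simps(5) G_component_grade G_infinite grade_smult)

lemma nonassoc_algebra_G: "nonassoc_algebra G"
proof (rule nonassoc_algebraI)
  note [simp] = G_component mult_closed
  show "\<zero>\<^bsub>G\<^esub> \<in> carrier G" by (rule G_carrierI) (auto simp: G_simps(3))
  fix x y z and c :: 'f
  assume x: "x \<in> carrier G" and y: "y \<in> carrier G"
  { assume z: "z \<in> carrier G"
    show "(x \<oplus>\<^bsub>G\<^esub> y) \<otimes>\<^bsub>G\<^esub> z = x \<otimes>\<^bsub>G\<^esub> z \<oplus>\<^bsub>G\<^esub> y \<otimes>\<^bsub>G\<^esub> z"
      unfolding G_simps(2,4) using x y z
      by (auto simp: fun_eq_iff mult_l_distr smult_add_right finsum_addf)
    show "x \<otimes>\<^bsub>G\<^esub> (y \<oplus>\<^bsub>G\<^esub> z) = x \<otimes>\<^bsub>G\<^esub> y \<oplus>\<^bsub>G\<^esub> x \<otimes>\<^bsub>G\<^esub> z"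
      unfolding G_simps(2,4) using x y z
      by (auto simp: fun_eq_iff mult_r_distr smult_add_right finsum_addf) }
  show "(c \<odot>\<^bsub>G\<^esub> x) \<otimes>\<^bsub>G\<^esub> y = c \<odot>\<^bsub>G\<^esub> (x \<otimes>\<^bsub>G\<^esub> y)"
    unfolding G_simps(2,5) using x y
    by (auto simp: fun_eq_iff mult_smult_l smult_smult finsum_smult[symmetric] mult.commute)
  show "x \<otimes>\<^bsub>G\<^esub> (c \<odot>\<^bsub>G\<^esub> y) = c \<odot>\<^bsub>G\<^esub> (x \<otimes>\<^bsub>G\<^esub> y)"
    unfolding G_simps(2,5) using x y
    by (auto simp: fun_eq_iff mult_smult_r smult_smult finsum_smult[symmetric] mult.commute)
qed ((rule G_mult_closed G_add_closed G_smult_closed; assumption) |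
  (auto simp: fun_eq_iff G_simps(3-5) G_component a_ac smult_add_left smult_add_right smult_smult; fail))+

sublocale G: nonassoc_algebra G by (rule nonassoc_algebra_G)

abbreviation pt :: "nat set \<Rightarrow> 'a \<Rightarrow> nat set \<Rightarrow> 'a" where "pt \<equiv> pure_tensor A"

lemma pt_closed: "finite S \<Longrightarrow> a \<in> grade A (of_nat (card S)) \<Longrightarrow> pt S a \<in> carrier G"
  by (rule G_carrierI) (auto simp: pure_tensor_def)

lemma pt_add: "pt S a \<oplus>\<^bsub>G\<^esub> pt S b = pt S (a \<oplus> b)" if "a \<in> carrier A" "b \<in> carrier A"
  using that by (auto simp: G_simps(4) pure_tensor_def fun_eq_iff)

lemma pt_smult: "c \<odot>\<^bsub>G\<^esub> pt S a = pt S (c \<odot> a)"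
  by (auto simp: G_simps(5) pure_tensor_def fun_eq_iff)

lemma pt_zero: "pt S \<zero> = \<zero>\<^bsub>G\<^esub>"
  by (auto simp: G_simps(3) pure_tensor_def)

lemma pt_mult:
  assumes fin: "finite P" "finite Q" and ab: "a \<in> carrier A" "b \<in> carrier A"
  shows "pt P a \<otimes>\<^bsub>G\<^esub> pt Q b = (if P \<inter> Q = {} then pt (P \<union> Q) (grassmann_sign P Q \<odot> (a \<otimes> b)) else \<zero>\<^bsub>G\<^esub>)"
proof
  fix S
  have t: "pt P a R \<otimes> pt Q b (S - R) = (if R = P \<and> S - R = Q then a \<otimes> b else \<zero>)" for R
    using ab by (auto simp: pure_tensor_def)
  show "(pt P a \<otimes>\<^bsub>G\<^esub> pt Q b) S = (if P \<inter> Q = {} then pt (P \<union> Q) (grassmann_sign P Q \<odot> (a \<otimes> b)) else \<zero>\<^bsub>G\<^esub>) S"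
  proof (cases "P \<inter> Q = {} \<and> S = P \<union> Q")
    case True
    then have S: "S - P = Q" "finite S" "P \<in> Pow S" using fin by auto
    have "(pt P a \<otimes>\<^bsub>G\<^esub> pt Q b) S = (\<Oplus>R\<in>Pow S. if P = R then grassmann_sign P Q \<odot> (a \<otimes> b) else \<zero>)"
      unfolding G_simps t using S ab by (auto intro!: finsum_cong' mult_closed)
    also have "\<dots> = grassmann_sign P Q \<odot> (a \<otimes> b)"
      using S ab by (intro finsum_singleton) (auto intro!: mult_closed)
    finally show ?thesis using True by (simp add: pure_tensor_def)
  next
    case False
    have "grassmann_sign R (S - R) \<odot> (pt P a R \<otimes> pt Q b (S - R)) = \<zero>" if "R \<in> Pow S" for R
      using False that unfolding t by auto
    from finsum_eq_zero[of "Pow S", OF this] have "(pt P a \<otimes>\<^bsub>G\<^esub> pt Q b) S = \<zero>"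
      by (simp add: G_simps(2))
    then show ?thesis using False by (auto simp: pure_tensor_def G_simps(3))
  qed
qed

lemma G_lin_span_pure_tensors:
  assumes "g \<in> carrier G"
  shows "g \<in> lin_span G {pt S a | S a. finite S \<and> a \<in> grade A (of_nat (card S))}" (is "_ \<in> lin_span G ?E")
proof -
  have "h \<in> carrier G \<longrightarrow> {S. h S \<noteq> \<zero>} = T \<longrightarrow> h \<in> lin_span G ?E" if "finite T" for T h
    using that
  proof (induction T arbitrary: h rule: finite_induct)
    case empty
    show ?case
    proof (intro impI)
      assume "{S. h S \<noteq> \<zero>} = {}"
      then have "h = \<zero>\<^bsub>G\<^esub>" by (auto simp: G_simps(3) fun_eq_iff)
      then show "h \<in> lin_span G ?E" by (simp only: lin_span.zero)
    qed
  next
    case (insert S T)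
    show ?case
    proof (intro impI)
      assume h: "h \<in> carrier G" and supp: "{S. h S \<noteq> \<zero>} = insert S T"
      have S: "finite S" using G_infinite[OF h, of S] supp by blast
      let ?h = "\<lambda>R. if R = S then \<zero> else h R"
      have supp': "{S. ?h S \<noteq> \<zero>} = T" using supp insert by auto
      moreover have "?h \<in> carrier G"
        by (rule G_carrierI, unfold supp')
          (use h insert in \<open>auto simp: G_component_grade G_infinite\<close>)
      ultimately have "?h \<in> lin_span G ?E" using insert by blast
      moreover have "h = 1 \<odot>\<^bsub>G\<^esub> pt S (h S) \<oplus>\<^bsub>G\<^esub> ?h"
        using G_component[OF h] by (auto simp: pure_tensor_def G_simps(4,5) fun_eq_iff)
      ultimately show "h \<in> lin_span G ?E"
        using lin_span.add[of "pt S (h S)" ?E ?h G 1] S G_component_grade[OF h S] by auto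
    qed
  qed
  then show ?thesis using assms G_finite_support by blast
qed

text \<open>
  A product of pure tensors is a pure tensor. It vanishes if two supports meet, because
  \<open>e\<^sub>i e\<^sub>i = 0\<close>; otherwise each pair of factors contributes its own sign.
\<close>

lemma eval_word_pure_tensors:
  assumes fin: "\<And>x. finite (\<sigma> x)" and a: "\<And>x. a x \<in> grade A (of_nat (card (\<sigma> x)))"
    and "distinct (letters w)"
  shows "eval_word G (\<lambda>x. pt (\<sigma> x) (a x)) w =
    (if disjoint_supports \<sigma> (set (letters w))
     then pt (\<Union>(\<sigma> ` set (letters w)))
       (pair_prod (\<lambda>x y. grassmann_sign (\<sigma> x) (\<sigma> y)) (letters w) \<odot> eval_word A a w)
     else \<zero>\<^bsub>G\<^esub>)"
  using assms(3)
proof (induction w)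
  case (Var x)
  then show ?case using grade_carrier[OF a] by (simp add: disjoint_supports_def)
next
  case (Times u w)
  let ?F = "\<lambda>x y. grassmann_sign (\<sigma> x) (\<sigma> y) :: 'f"
  have ac: "a x \<in> carrier A" for x using a grade_carrier by blast
  have cl: "eval_word A a w \<in> carrier A" for w by (intro eval_word_closed ac)
  have clG: "eval_word G (\<lambda>x. pt (\<sigma> x) (a x)) w \<in> carrier G" for w
    by (intro G.eval_word_closed pt_closed fin a)
  let ?D = "disjoint_supports \<sigma>"
  show ?case
  proof (cases "?D (set (letters u)) \<and> ?D (set (letters w))")
    case False
    then have "eval_word G (\<lambda>x. pt (\<sigma> x) (a x)) u = \<zero>\<^bsub>G\<^esub> \<or> eval_word G (\<lambda>x. pt (\<sigma> x) (a x)) w = \<zero>\<^bsub>G\<^esub>"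
      using Times by auto
    then have "eval_word G (\<lambda>x. pt (\<sigma> x) (a x)) (Times u w) = \<zero>\<^bsub>G\<^esub>"
      by (elim disjE) (simp_all add: clG)
    moreover have "\<not> ?D (set (letters (Times u w)))"
      using False by (auto simp: disjoint_supports_def)
    ultimately show ?thesis by simp
  next
    case True
    let ?U = "\<Union>(\<sigma> ` set (letters u))" and ?W = "\<Union>(\<sigma> ` set (letters w))"
    have "eval_word G (\<lambda>x. pt (\<sigma> x) (a x)) (Times u w) =
      pt ?U (pair_prod ?F (letters u) \<odot> eval_word A a u) \<otimes>\<^bsub>G\<^esub> pt ?W (pair_prod ?F (letters w) \<odot> eval_word A a w)"
      using Times True by simp
    also have "\<dots> = (if ?U \<inter> ?W = {} then pt (?U \<union> ?W) (grassmann_sign ?U ?W \<odot>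
        ((pair_prod ?F (letters u) \<odot> eval_word A a u) \<otimes> (pair_prod ?F (letters w) \<odot> eval_word A a w))) else \<zero>\<^bsub>G\<^esub>)"
      by (intro pt_mult) (auto simp: fin cl)
    finally have eq: "eval_word G (\<lambda>x. pt (\<sigma> x) (a x)) (Times u w) = \<dots>" .
    show ?thesis
    proof (cases "?U \<inter> ?W = {}")
      case disj: True
      have D: "?D (set (letters (Times u w)))"
        using True disj unfolding disjoint_supports_def by (simp, blast)
      then have "grassmann_sign ?U ?W = cross_prod ?F (letters u) (letters w)"
        using Times.prems by (intro grassmann_sign_UN fin) simp_all
      then show ?thesis
        using disj D cl unfolding eq
        by (simp add: mult_smult_l mult_smult_r smult_smult pair_prod_append mult_closed image_Un algebra_simps)
    next
      case False
      then obtain x y t where xy: "x \<in> set (letters u)" "y \<in> set (letters w)" "t \<in> \<sigma> x" "t \<in> \<sigma> y" by blast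
      moreover have "x \<noteq> y" using xy Times.prems by auto
      ultimately have "\<not> ?D (set (letters (Times u w)))"
        unfolding disjoint_supports_def by auto
      then show ?thesis using False eq by simp
    qed
  qed
qed

end

section \<open>Superidentities and identities of the Grassmann envelope\<close>

lemma superization_single_add:
  "superization par (Poly_Mapping.single w c + p) =
    Poly_Mapping.single w (koszul_sign par w * c) + superization par p"
  by (rule poly_mapping_eqI) (auto simp: lookup_add lookup_single when_def algebra_simps)

lemma superization_zero [simp]: "superization par 0 = 0"
  by (rule poly_mapping_eqI) simp

lemma of_nat_bit: "(of_nat n :: bit) = of_bool (odd n)"
  by (induction n) auto

lemma bit_of_nat_mult_eq_1_iff: "(of_nat m :: bit) * of_nat n = 1 \<longleftrightarrow> odd (m * n)"
  by (simp add: of_nat_bit)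

context plain_superalgebra
begin

text \<open>
  Moving \<open>e\<^bsub>\<sigma> y\<^esub>\<close> past \<open>e\<^bsub>\<sigma> x\<^esub>\<close> costs the sign of two letters of parities \<open>|\<sigma> x|\<close> and \<open>|\<sigma> y|\<close>. Hence the
  sign of the product in the order of \<open>w\<close> is the Koszul sign of \<open>w\<close> up to the sign \<open>c\<close> of the product
  in increasing order, which is the same for all words on \<open>X\<close>.
\<close>

lemma reorder_supports:
  assumes fin: "\<And>x. finite (\<sigma> x)" and disj: "disjoint_supports \<sigma> X"
  obtains c where "c \<noteq> (0 :: 'f)"
    and "\<And>w. distinct (letters w) \<Longrightarrow> set (letters w) = X \<Longrightarrow>
      pair_prod (\<lambda>x y. grassmann_sign (\<sigma> x) (\<sigma> y)) (letters w) =
      c * koszul_sign (\<lambda>x. of_nat (card (\<sigma> x))) w"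
proof (cases "finite X")
  case False
  have "finite (set (letters w))" for w :: "nat word" by simp
  with False show ?thesis by (intro that[of 1]) auto
next
  case True
  let ?par = "\<lambda>x. of_nat (card (\<sigma> x)) :: bit"
  define F :: "nat \<Rightarrow> nat \<Rightarrow> 'f"
    where "F x y = (if x < y then grassmann_sign (\<sigma> x) (\<sigma> y) else grassmann_sign (\<sigma> y) (\<sigma> x))" for x y
  show ?thesis
  proof (rule that)
    show "pair_prod F (sorted_list_of_set X) \<noteq> 0"
      by (rule pair_prod_nonzero) (simp add: F_def)
    fix w assume w: "distinct (letters w)" "set (letters w) = X"
    have "grassmann_sign (\<sigma> x) (\<sigma> y) = F x y * koszul_factor ?par x y"
      if "x \<in> set (letters w)" "y \<in> set (letters w)" "x \<noteq> y" for x y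
    proof (cases "x < y")
      case True
      then show ?thesis by (simp add: F_def koszul_factor_def)
    next
      case False
      then have yx: "y < x" using that(3) by simp
      let ?n = "card (\<sigma> x) * card (\<sigma> y)"
      have "\<sigma> x \<inter> \<sigma> y = {}" using disj that w unfolding disjoint_supports_def by blast
      from grassmann_sign_swap[OF fin fin this]
      have swap: "grassmann_sign (\<sigma> x) (\<sigma> y) * grassmann_sign (\<sigma> y) (\<sigma> x) = ((- 1) ^ ?n :: 'f)" .
      have "grassmann_sign (\<sigma> x) (\<sigma> y) =
          (grassmann_sign (\<sigma> x) (\<sigma> y) * grassmann_sign (\<sigma> y) (\<sigma> x)) * (grassmann_sign (\<sigma> y) (\<sigma> x) :: 'f)"
        by (simp only: mult.assoc grassmann_sign_square mult_1_right)
      also have "\<dots> = grassmann_sign (\<sigma> y) (\<sigma> x) * (- 1) ^ ?n"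
        by (simp only: swap mult.commute)
      also have "(- 1 :: 'f) ^ ?n = koszul_factor ?par x y"
        by (simp only: koszul_factor_def bit_of_nat_mult_eq_1_iff yx simp_thms minus_one_power_iff split: if_split) simp
      also have "grassmann_sign (\<sigma> y) (\<sigma> x) = F x y"
        using yx by (simp add: F_def)
      finally show ?thesis .
    qed
    then have "pair_prod (\<lambda>x y. grassmann_sign (\<sigma> x) (\<sigma> y)) (letters w) =
        pair_prod (\<lambda>x y. F x y * koszul_factor ?par x y) (letters w)"
      by (intro pair_prod_cong w)
    also have "\<dots> = pair_prod F (letters w) * koszul_sign ?par w"
      by (simp only: pair_prod_mult koszul_sign_pair_prod)
    also have "pair_prod F (letters w) = pair_prod F (sorted_list_of_set X)"
    proof (rule pair_prod_symmetric)
      show "F x y = F y x" for x y by (auto simp: F_def)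
      show "mset (letters w) = mset (sorted_list_of_set X)"
        using w True by (intro set_eq_iff_mset_eq_distinct[THEN iffD1]) auto
    qed
    finally show "pair_prod (\<lambda>x y. grassmann_sign (\<sigma> x) (\<sigma> y)) (letters w) =
      pair_prod F (sorted_list_of_set X) * koszul_sign ?par w" .
  qed
qed

text \<open>
  The constant of the preceding lemma is common to all words of \<open>f\<close> and can be taken out.
\<close>

lemma eval_npoly_pure_tensors:
  assumes fin: "\<And>x. finite (\<sigma> x)" and a: "\<And>x. a x \<in> grade A (of_nat (card (\<sigma> x)))"
    and f: "\<And>w. w \<in> Poly_Mapping.keys f \<Longrightarrow> distinct (letters w) \<and> set (letters w) = X"
    and disj: "disjoint_supports \<sigma> X"
  obtains c where "c \<noteq> 0"
    and "eval_npoly G (\<lambda>x. pt (\<sigma> x) (a x)) f =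
      pt (\<Union>(\<sigma> ` X)) (c \<odot> eval_npoly A a (superization (\<lambda>x. of_nat (card (\<sigma> x))) f))"
proof -
  let ?par = "\<lambda>x. of_nat (card (\<sigma> x)) :: bit"
  obtain c :: 'f where c: "c \<noteq> 0" and eq: "\<And>w. distinct (letters w) \<Longrightarrow> set (letters w) = X \<Longrightarrow>
      pair_prod (\<lambda>x y. grassmann_sign (\<sigma> x) (\<sigma> y)) (letters w) = c * koszul_sign ?par w"
    using reorder_supports[OF fin disj] by blast
  have ac: "a x \<in> carrier A" for x using a grade_carrier by blast
  have ptc: "pt (\<sigma> x) (a x) \<in> carrier G" for x by (intro pt_closed fin a)
  have cl: "eval_word A a w \<in> carrier A" "eval_npoly A a p \<in> carrier A" for w p
    by (intro eval_word_closed eval_npoly_closed ac)+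
  have "eval_npoly G (\<lambda>x. pt (\<sigma> x) (a x)) f = pt (\<Union>(\<sigma> ` X)) (c \<odot> eval_npoly A a (superization ?par f))"
  proof (induction f rule: npoly_induct)
    case zero
    then show ?case by (simp add: pt_zero)
  next
    case (add p w d)
    have "eval_word G (\<lambda>x. pt (\<sigma> x) (a x)) w =
      pt (\<Union>(\<sigma> ` X)) ((c * koszul_sign ?par w) \<odot> eval_word A a w)"
      using f[OF add(2)] disj by (subst eval_word_pure_tensors[OF fin a]) (auto simp: eq)
    then show ?case
      by (simp add: G.eval_npoly_add ptc add(1) superization_single_add eval_npoly_add ac cl pt_add pt_smult
          smult_add_right smult_smult mult.assoc mult.commute mult.left_commute)
  qed
  with c show ?thesis by (rule that)
qed

text \<open>
  The bridge between identities and superidentities. The envelope is spanned by pure tensors, on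
  which \<open>f\<close> either vanishes, if supports overlap, or is a nonzero multiple of the superization of
  \<open>f\<close>. Conversely the supports \<open>{}\<close> and \<open>{x}\<close> realize every assignment of parities.
\<close>

theorem envelope_satisfies_iff:
  assumes "multilinear f"
  shows "satisfies G f \<longleftrightarrow> satisfies_super A f"
proof
  obtain X where X: "finite X" "\<And>w. w \<in> Poly_Mapping.keys f \<Longrightarrow> distinct (letters w) \<and> set (letters w) = X"
    using assms unfolding multilinear_def by blast
  assume sat: "satisfies G f"
  show "satisfies_super A f"
    unfolding satisfies_super_def
  proof (intro allI impI)
    fix par :: "nat \<Rightarrow> bit" and v assume v: "\<forall>x. v x \<in> grade A (par x)"
    \<comment> \<open>the smallest disjoint supports with the given parities\<close>
    define \<sigma> where "\<sigma> x = (if par x = 1 then {x} else {})" for x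
    have fin: "finite (\<sigma> x)" for x by (simp add: \<sigma>_def)
    have par: "of_nat (card (\<sigma> x)) = par x" for x by (cases "par x = 1") (simp_all add: \<sigma>_def)
    have disj: "disjoint_supports \<sigma> X" by (auto simp: disjoint_supports_def \<sigma>_def)
    have v': "v x \<in> grade A (of_nat (card (\<sigma> x)))" for x using v by (simp only: par)
    obtain c where c: "c \<noteq> 0" "eval_npoly G (\<lambda>x. pt (\<sigma> x) (v x)) f =
      pt (\<Union>(\<sigma> ` X)) (c \<odot> eval_npoly A v (superization (\<lambda>x. of_nat (card (\<sigma> x))) f))"
      by (rule eval_npoly_pure_tensors[OF fin v' X(2) disj])
    have "range (\<lambda>x. pt (\<sigma> x) (v x)) \<subseteq> carrier G"
      by (intro image_subsetI pt_closed fin v')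
    from sat[unfolded satisfies_def, rule_format, OF this]
    have "eval_npoly G (\<lambda>x. pt (\<sigma> x) (v x)) f = \<zero>\<^bsub>G\<^esub>" .
    then have "pt (\<Union>(\<sigma> ` X)) (c \<odot> eval_npoly A v (superization par f)) = \<zero>\<^bsub>G\<^esub>"
      by (simp only: c(2) par)
    from fun_cong[OF this, of "\<Union>(\<sigma> ` X)"] have "c \<odot> eval_npoly A v (superization par f) = \<zero>"
      by (simp only: pure_tensor_def G_simps(3) if_True simp_thms)
    moreover have "v x \<in> carrier A" for x using v grade_carrier by blast
    ultimately show "eval_npoly A v (superization par f) = \<zero>"
      by (rule smult_eq_zeroD[OF _ c(1) eval_npoly_closed])
  qed
next
  obtain X where X: "finite X" "\<And>w. w \<in> Poly_Mapping.keys f \<Longrightarrow> distinct (letters w) \<and> set (letters w) = X"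
    using assms unfolding multilinear_def by blast
  assume sat: "satisfies_super A f"
  let ?E = "{pt S a | S a. finite S \<and> a \<in> grade A (of_nat (card S))}"
  show "satisfies G f"
    unfolding satisfies_def
  proof (intro allI impI)
    fix v :: "nat \<Rightarrow> nat set \<Rightarrow> 'a" assume "range v \<subseteq> carrier G"
    then have vc: "v x \<in> carrier G" for x by blast
    have "eval_npoly G v f \<in> {\<zero>\<^bsub>G\<^esub>}"
    proof (rule G.eval_npoly_lin_span[OF X, where E = "\<lambda>_. ?E"])
      show "v x \<in> lin_span G ?E" for x by (rule G_lin_span_pure_tensors[OF vc])
      show "?E \<subseteq> carrier G" using pt_closed by blast
      fix u assume u: "\<And>x. u x \<in> carrier G" "\<And>x. x \<in> X \<Longrightarrow> u x \<in> ?E"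
      then have "\<exists>S a. u x = pt S a \<and> finite S \<and> a \<in> grade A (of_nat (card S))" if "x \<in> X" for x
        using that by blast
      then obtain \<sigma>' a' where sa: "\<And>x. x \<in> X \<Longrightarrow> u x = pt (\<sigma>' x) (a' x) \<and> finite (\<sigma>' x) \<and> a' x \<in> grade A (of_nat (card (\<sigma>' x)))"
        by metis
      define \<sigma> where "\<sigma> x = (if x \<in> X then \<sigma>' x else {})" for x
      define a where "a x = (if x \<in> X then a' x else \<zero>)" for x
      have fin: "finite (\<sigma> x)" and a: "a x \<in> grade A (of_nat (card (\<sigma> x)))" for x
        using sa[of x] by (auto simp: \<sigma>_def a_def)
      have "eval_npoly G u f = eval_npoly G (\<lambda>x. pt (\<sigma> x) (a x)) f"
      proof (rule G.eval_npoly_cong)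
        fix w x assume "w \<in> Poly_Mapping.keys f" "x \<in> set (letters w)"
        then have "x \<in> X" using X(2)[of w] by blast
        then show "u x = pt (\<sigma> x) (a x)" using sa[of x] by (simp only: \<sigma>_def a_def if_True simp_thms)
      qed (intro pt_closed fin a)
      also have "\<dots> = \<zero>\<^bsub>G\<^esub>"
      proof (cases "disjoint_supports \<sigma> X")
        case True
        obtain c where c: "c \<noteq> 0" "eval_npoly G (\<lambda>x. pt (\<sigma> x) (a x)) f =
          pt (\<Union>(\<sigma> ` X)) (c \<odot> eval_npoly A a (superization (\<lambda>x. of_nat (card (\<sigma> x))) f))"
          by (rule eval_npoly_pure_tensors[OF fin a X(2) True])
        then show ?thesis
          by (simp only: satisfies_super_grade[OF sat a] pt_zero smult_0_right)
      next
        case False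
        then have "eval_word G (\<lambda>x. pt (\<sigma> x) (a x)) w = \<zero>\<^bsub>G\<^esub>" if "w \<in> Poly_Mapping.keys f" for w
          using X(2)[OF that] by (subst eval_word_pure_tensors[OF fin a]) simp_all
        then show ?thesis
          unfolding eval_npoly_def by (intro G.add.finprod_one_eqI) simp
      qed
      finally show "eval_npoly G u f \<in> {\<zero>\<^bsub>G\<^esub>}" by simp
    qed (simp_all add: vc)
    then show "eval_npoly G v f = \<zero>\<^bsub>G\<^esub>" by simp
  qed
qed

end

lemma alg_hom_envelope:
  assumes A: "superalgebra A" and B: "superalgebra B" and h: "alg_hom h A B"
    and gr: "\<And>i x. x \<in> grade A i \<Longrightarrow> h x \<in> grade B i"
  shows "alg_hom (\<lambda>g S. h (g S)) (grassmann_envelope A) (grassmann_envelope B)"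
proof -
  interpret A: plain_superalgebra A using A by (rule plain_superalgebra.intro)
  interpret B: plain_superalgebra B using B by (rule plain_superalgebra.intro)
  have h0: "h \<zero>\<^bsub>A\<^esub> = \<zero>\<^bsub>B\<^esub>"
    by (rule alg_hom_zero[OF h A.nonassoc_algebra_axioms B.nonassoc_algebra_axioms])
  have hD: "x \<in> carrier A \<Longrightarrow> h x \<in> carrier B" "x \<in> carrier A \<Longrightarrow> y \<in> carrier A \<Longrightarrow> h (x \<oplus>\<^bsub>A\<^esub> y) = h x \<oplus>\<^bsub>B\<^esub> h y"
    "x \<in> carrier A \<Longrightarrow> y \<in> carrier A \<Longrightarrow> h (x \<otimes>\<^bsub>A\<^esub> y) = h x \<otimes>\<^bsub>B\<^esub> h y"
    "x \<in> carrier A \<Longrightarrow> h (c \<odot>\<^bsub>A\<^esub> x) = c \<odot>\<^bsub>B\<^esub> h x" for x y c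
    using h unfolding alg_hom_def by simp_all
  show ?thesis
    unfolding alg_hom_def
  proof (intro conjI ballI allI)
    fix x assume x: "x \<in> carrier A.G"
    show "(\<lambda>S. h (x S)) \<in> carrier B.G"
    proof (rule B.G_carrierI)
      show "finite {S. h (x S) \<noteq> \<zero>\<^bsub>B\<^esub>}"
        by (rule finite_subset[OF _ A.G_finite_support[OF x]]) (auto simp: h0)
    qed (auto simp: A.G_infinite[OF x] h0 intro: gr A.G_component_grade[OF x])
    show "(\<lambda>S. h ((c \<odot>\<^bsub>A.G\<^esub> x) S)) = c \<odot>\<^bsub>B.G\<^esub> (\<lambda>S. h (x S))" for c
      by (simp add: A.G_simps(5) B.G_simps(5) hD A.G_component[OF x])
    fix y assume y: "y \<in> carrier A.G"
    show "(\<lambda>S. h ((x \<oplus>\<^bsub>A.G\<^esub> y) S)) = (\<lambda>S. h (x S)) \<oplus>\<^bsub>B.G\<^esub> (\<lambda>S. h (y S))"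
      by (simp add: A.G_simps(4) B.G_simps(4) hD A.G_component[OF x] A.G_component[OF y])
    show "(\<lambda>S. h ((x \<otimes>\<^bsub>A.G\<^esub> y) S)) = (\<lambda>S. h (x S)) \<otimes>\<^bsub>B.G\<^esub> (\<lambda>S. h (y S))"
    proof
      fix S
      have "h (\<Oplus>\<^bsub>A\<^esub>P\<in>Pow S. grassmann_sign P (S - P) \<odot>\<^bsub>A\<^esub> (x P \<otimes>\<^bsub>A\<^esub> y (S - P))) =
        (\<Oplus>\<^bsub>B\<^esub>P\<in>Pow S. h (grassmann_sign P (S - P) \<odot>\<^bsub>A\<^esub> (x P \<otimes>\<^bsub>A\<^esub> y (S - P))))"
        by (rule additive_finsum[OF A.abelian_monoid_axioms B.abelian_monoid_axioms])
          (simp_all add: hD h0 A.mult_closed A.G_component[OF x] A.G_component[OF y])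
      then show "h ((x \<otimes>\<^bsub>A.G\<^esub> y) S) = ((\<lambda>S. h (x S)) \<otimes>\<^bsub>B.G\<^esub> (\<lambda>S. h (y S))) S"
        by (simp add: A.G_simps(2) B.G_simps(2) h0 hD A.mult_closed A.G_component[OF x] A.G_component[OF y])
    qed
  qed
qed

section \<open>Relatively free superalgebras\<close>

definition relative_ideal :: "('f::field, ('x, 'f) npoly set) superalg set \<Rightarrow> 'x set \<Rightarrow> ('x \<Rightarrow> bit) \<Rightarrow> ('x, 'f) npoly set"
  where "relative_ideal \<C> X par = \<Inter>{J. graded_ideal J (free_superalg X par) \<and> quotient_superalg (free_superalg X par) J \<in> \<C>}"

lemma relatively_free_eq:
  "relatively_free \<C> X par = quotient_superalg (free_superalg X par) (relative_ideal \<C> X par)"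
  by (simp add: relatively_free_def relative_ideal_def)

lemma relative_ideal_subset:
  "graded_ideal J (free_superalg X par) \<Longrightarrow> quotient_superalg (free_superalg X par) J \<in> \<C> \<Longrightarrow> relative_ideal \<C> X par \<subseteq> J"
  unfolding relative_ideal_def by (rule Inter_lower) simp

lemma graded_ideal_relative_ideal:
  assumes "graded_ideal J (free_superalg X par)" "quotient_superalg (free_superalg X par) J \<in> \<C>"
  shows "graded_ideal (relative_ideal \<C> X par) (free_superalg X par)"
  unfolding relative_ideal_def using assms by (intro graded_ideal_Inter) auto

lemma relatively_free_satisfies_super:
  assumes ne: "graded_ideal J0 (free_superalg X par)" "quotient_superalg (free_superalg X par) J0 \<in> \<C>"
    and sat: "\<And>B. B \<in> \<C> \<Longrightarrow> satisfies_super B f"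
  shows "satisfies_super (relatively_free \<C> X par) f"
proof -
  interpret R: free_ideal X par "relative_ideal \<C> X par"
    by unfold_locales (rule graded_ideal_relative_ideal[OF ne])
  show ?thesis
    unfolding relatively_free_eq R.Q_satisfies_super_iff
  proof (intro allI impI)
    fix p :: "nat \<Rightarrow> bit" and u assume u: "\<forall>x. u x \<in> grade R.F (p x)"
    have "eval_npoly R.F u (superization p f) \<in> J"
      if J: "graded_ideal J R.F" "quotient_superalg R.F J \<in> \<C>" for J
    proof -
      interpret J: free_ideal X par J by unfold_locales (rule J(1))
      from sat[OF J(2)] have "\<forall>p u. (\<forall>x. u x \<in> grade J.F (p x)) \<longrightarrow> eval_npoly J.F u (superization p f) \<in> J"
        by (simp only: J.Q_satisfies_super_iff)
      then show ?thesis using u by blast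
    qed
    then show "eval_npoly R.F u (superization p f) \<in> relative_ideal \<C> X par"
      unfolding relative_ideal_def by blast
  qed
qed

text \<open>
  Evaluation kernels in a superalgebra of the supervariety of \<open>B\<close> belong to the family of ideals
  whose intersection defines its relatively free superalgebras. In particular that family is not
  empty, and the relations of the relatively free superalgebra hold in every member of the supervariety.
\<close>

lemma supervariety_ideal:
  fixes A :: "('f::field, 'a) superalg" and v :: "'x \<Rightarrow> 'a"
  assumes A: "superalgebra A" "\<And>f. multilinear f \<Longrightarrow> satisfies_super B f \<Longrightarrow> satisfies_super A f"
    and v: "\<And>x. v x \<in> grade A (par x)"
  shows "graded_ideal (eval_kernel A v X) (free_superalg X par)"
    and "quotient_superalg (free_superalg X par) (eval_kernel A v X) \<in> supervariety_generated_by B"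
proof -
  show gi: "graded_ideal (eval_kernel A v X) (free_superalg X par)"
    by (rule graded_ideal_eval_kernel[OF A(1) v])
  interpret free_ideal X par "eval_kernel A v X" by unfold_locales (rule gi)
  show "Q \<in> supervariety_generated_by B"
    unfolding supervariety_generated_by_def
  proof (intro CollectI conjI allI impI superalgebra_Q)
    fix f assume "multilinear f \<and> satisfies_super B f"
    then have "satisfies_super A f" using A(2) by blast
    then show "satisfies_super Q f"
      by (rule quotient_eval_kernel_satisfies_super[OF A(1) v])
  qed
qed

definition envelope_identities :: "('f::field, 'a) superalg \<Rightarrow> (nat, 'f) npoly set"
  where "envelope_identities B =
    variety_generated_by (grassmann_envelope (countable_free_superalg (supervariety_generated_by B)))"

text \<open>
  Superizing is meaningful for multilinear polynomials only, so generic elements take its place. An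
  element of the envelope of \<open>A\<close> is a finite sum of terms \<open>e\<^sub>S \<otimes> a\<close>; replacing the coefficients \<open>a\<close>, for all variables and all \<open>S\<close>, by distinct free
  generators of the same parity gives generic elements of the envelope of a free superalgebra, on
  which \<open>g\<close> vanishes modulo the relations of the supervariety. The homomorphism that sends each
  generator back to its coefficient respects these relations and carries this to \<open>A\<close>.
\<close>

lemma envelope_identities_complete:
  fixes A :: "('f::field, 'u) superalg" and B :: "('f, 'b) superalg"
  assumes A: "superalgebra A" and sat: "\<And>f. multilinear f \<Longrightarrow> satisfies_super B f \<Longrightarrow> satisfies_super A f"
    and g: "g \<in> envelope_identities B"
  shows "satisfies (grassmann_envelope A) g"
  unfolding satisfies_def
proof (intro allI impI)
  let ?C = "supervariety_generated_by B :: ('f, 'f gpoly set) superalg set"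
  let ?I = "relative_ideal ?C UNIV gen_parity"
  let ?F = "free_superalg UNIV gen_parity :: ('f, 'f gpoly) superalg"
  fix v :: "nat \<Rightarrow> nat set \<Rightarrow> 'u" assume "range v \<subseteq> carrier (grassmann_envelope A)"
  then have v: "v x \<in> carrier (grassmann_envelope A)" for x by blast
  interpret A: plain_superalgebra A using A by (rule plain_superalgebra.intro)
  interpret F: plain_superalgebra ?F by (rule plain_superalgebra.intro) (rule superalgebra_free)
  \<comment> \<open>one generator for each variable and each finite support, of the parity of the support\<close>
  define gen :: "nat \<Rightarrow> nat set \<Rightarrow> nat + nat"
    where "gen x S = (if even (card S) then Inl else Inr) (prod_encode (x, set_encode S))" for x S
  have gen_inj: "x = y \<and> S = T" if "gen x S = gen y T" "finite S" "finite T" for x y S T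
  proof -
    have "prod_encode (x, set_encode S) = prod_encode (y, set_encode T)"
      using that(1) unfolding gen_def by (auto split: if_splits simp del: prod_encode_eq)
    then show ?thesis using that(2,3) by (simp add: set_encode_eq)
  qed
  have gen_par: "gen_parity (gen x S) = of_nat (card S)" for x S
    by (simp add: gen_parity_def gen_def of_nat_bit)
  \<comment> \<open>the values of the generators: coefficients of \<open>v\<close>, and zero for unused generators\<close>
  define a where "a z = (if \<exists>x S. finite S \<and> z = gen x S
      then (let (x, S) = SOME (x, S). finite S \<and> z = gen x S in v x S) else \<zero>\<^bsub>A\<^esub>)" for z
  have a_gen: "a (gen x S) = v x S" if "finite S" for x S
  proof -
    have "(SOME (y, T). finite T \<and> gen x S = gen y T) = (x, S)"
      by (rule some_equality) (use that gen_inj in auto)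
    then show ?thesis using that unfolding a_def by auto
  qed
  have a: "a z \<in> grade A (gen_parity z)" for z
  proof (cases "\<exists>x S. finite S \<and> z = gen x S")
    case True
    then obtain x S where "finite S" "z = gen x S" by blast
    then show ?thesis using A.G_component_grade[OF v] by (simp only: a_gen gen_par)
  next
    case False
    then have "a z = \<zero>\<^bsub>A\<^esub>" unfolding a_def by (rule if_not_P)
    then show ?thesis by (simp only: A.grade_zero)
  qed
  have ac: "a z \<in> carrier A" for z using a A.grade_carrier by blast
  let ?J = "eval_kernel A a UNIV"
  have gi: "graded_ideal ?J ?F" by (rule graded_ideal_eval_kernel) (rule A, rule a)
  have Qi: "quotient_superalg ?F ?J \<in> ?C" by (rule supervariety_ideal(2)) (rule A, erule (1) sat, rule a)
  have gi0: "graded_ideal ?I ?F" by (rule graded_ideal_relative_ideal) (rule gi, rule Qi)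
  interpret R: free_ideal UNIV gen_parity ?I by (rule free_ideal.intro) (rule gi0)
  have sub: "?I \<subseteq> ?J" by (rule relative_ideal_subset[OF gi Qi])
  interpret Q: plain_superalgebra R.Q by (rule plain_superalgebra.intro) (rule R.superalgebra_Q)
  define d where "d x S = (if finite S \<and> v x S \<noteq> \<zero>\<^bsub>A\<^esub> then Poly_Mapping.single (Var (gen x S)) (1::'f) else 0)" for x S
  have d: "d x \<in> carrier F.G" for x
  proof (rule F.G_carrierI)
    show "finite {S. d x S \<noteq> \<zero>\<^bsub>?F\<^esub>}"
      by (rule finite_subset[OF _ A.G_finite_support[OF v[of x]]]) (auto simp: d_def)
    show "d x S \<in> grade ?F (of_nat (card S))" for S
      by (auto simp: d_def word_parity_def gen_par)
  qed (simp add: d_def)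
  have homQ: "alg_hom (\<lambda>g S. R.proj (g S)) F.G Q.G"
    by (rule alg_hom_envelope[OF superalgebra_free R.superalgebra_Q R.alg_hom_proj]) (simp only: R.Q_simps imageI)
  have homA: "alg_hom (\<lambda>g S. eval_npoly A a (g S)) F.G A.G"
  proof (rule alg_hom_envelope[OF superalgebra_free A alg_hom_eval])
    show "eval_npoly A a p \<in> grade A i" if "p \<in> grade ?F i" for i p
      by (rule A.eval_npoly_grade[OF a]) (use that in auto)
  qed (auto intro: A.nonassoc_algebra_axioms ac)
  let ?e = "eval_npoly F.G d g"
  have e: "?e \<in> carrier F.G" by (rule F.G.eval_npoly_closed[OF d])
  have "(\<lambda>S. R.proj (d x S)) \<in> carrier Q.G" for x
    using homQ d unfolding alg_hom_def by blast
  then have "range (\<lambda>x S. R.proj (d x S)) \<subseteq> carrier Q.G" by blast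
  then have "eval_npoly Q.G (\<lambda>x S. R.proj (d x S)) g = \<zero>\<^bsub>Q.G\<^esub>"
    using g unfolding envelope_identities_def variety_generated_by_def satisfies_def
      countable_free_superalg_def relatively_free_eq by blast
  then have "(\<lambda>S. R.proj (?e S)) = \<zero>\<^bsub>Q.G\<^esub>"
    by (simp only: eval_npoly_hom[OF homQ F.nonassoc_algebra_G Q.nonassoc_algebra_G d])
  then have "R.proj (?e S) = R.proj 0" for S
    unfolding Q.G_simps(3) R.Q_simps(2) by (rule fun_cong)
  then have "?e S \<in> ?J" for S
    using sub by (auto simp only: R.proj_eq_iff diff_zero)
  then have "eval_npoly A a (?e S) = \<zero>\<^bsub>A\<^esub>" for S
    by (simp add: eval_kernel_def)
  moreover have "eval_npoly A.G (\<lambda>x S. eval_npoly A a (d x S)) g = (\<lambda>S. eval_npoly A a (?e S))"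
    by (rule eval_npoly_hom[OF homA F.nonassoc_algebra_G A.nonassoc_algebra_G d])
  moreover have "eval_npoly A a (d x S) = v x S" for x S
    using A.G_infinite[OF v[of x]] A.G_component[OF v[of x]] by (auto simp: d_def ac a_gen)
  ultimately show "eval_npoly A.G v g = \<zero>\<^bsub>A.G\<^esub>"
    by (simp add: A.G_simps(3))
qed

text \<open>
  A supervariety is recovered from the variety generated by the envelope of its free superalgebra.
  One inclusion is the preceding lemma. For the other, a superidentity of \<open>B\<close> is an identity of that
  envelope, hence of the envelope of \<open>A\<close>, hence a superidentity of \<open>A\<close>.
\<close>

theorem superalgs_of_envelope_identities:
  fixes B :: "('f::field, 'b) superalg"
  assumes "superalgebra B"
  shows "superalgs_of (envelope_identities B) = (supervariety_generated_by B :: ('f, 'u) superalg set)"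
proof (intro equalityI subsetI)
  fix A :: "('f, 'u) superalg" assume "A \<in> supervariety_generated_by B"
  then have A: "superalgebra A" "\<And>f. multilinear f \<Longrightarrow> satisfies_super B f \<Longrightarrow> satisfies_super A f"
    unfolding supervariety_generated_by_def by auto
  interpret A: plain_superalgebra A using A(1) by (rule plain_superalgebra.intro)
  show "A \<in> superalgs_of (envelope_identities B)"
    unfolding superalgs_of_def in_variety_def
    using A.nonassoc_algebra_G A(1) envelope_identities_complete[OF A] by auto
next
  fix A :: "('f, 'u) superalg" assume "A \<in> superalgs_of (envelope_identities B)"
  then have A: "superalgebra A" "\<And>f. f \<in> envelope_identities B \<Longrightarrow> satisfies (grassmann_envelope A) f"
    unfolding superalgs_of_def in_variety_def by auto
  interpret A: plain_superalgebra A using A(1) by (rule plain_superalgebra.intro)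
  let ?C = "supervariety_generated_by B :: ('f, 'f gpoly set) superalg set"
  interpret B: plain_superalgebra B using assms by (rule plain_superalgebra.intro)
  have gi: "graded_ideal (eval_kernel B (\<lambda>_. \<zero>\<^bsub>B\<^esub>) UNIV) (free_superalg UNIV gen_parity)"
    by (rule graded_ideal_eval_kernel) (rule assms, rule B.grade_zero)
  have Qi: "quotient_superalg (free_superalg UNIV gen_parity) (eval_kernel B (\<lambda>_. \<zero>\<^bsub>B\<^esub>) UNIV) \<in> ?C"
    by (rule supervariety_ideal(2)) (rule assms, assumption, rule B.grade_zero)
  have gi0: "graded_ideal (relative_ideal ?C UNIV gen_parity) (free_superalg UNIV gen_parity)"
    by (rule graded_ideal_relative_ideal) (rule gi, rule Qi)
  interpret R: free_ideal UNIV gen_parity "relative_ideal ?C UNIV gen_parity"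
    by (rule free_ideal.intro) (rule gi0)
  interpret D: plain_superalgebra R.Q by (rule plain_superalgebra.intro) (rule R.superalgebra_Q)
  have "satisfies_super A f" if f: "multilinear f" "satisfies_super B f" for f
  proof -
    have "satisfies_super R.Q f"
      using relatively_free_satisfies_super[OF gi Qi, of f] f
      unfolding relatively_free_eq supervariety_generated_by_def by blast
    then have "satisfies D.G f" by (simp only: D.envelope_satisfies_iff[OF f(1)])
    then have "f \<in> envelope_identities B"
      unfolding envelope_identities_def variety_generated_by_def countable_free_superalg_def relatively_free_eq by simp
    then show ?thesis
      using A(2) by (simp only: A.envelope_satisfies_iff[OF f(1), symmetric])
  qed
  then show "A \<in> supervariety_generated_by B"
    unfolding supervariety_generated_by_def using A(1) by blast
qed

section \<open>Words that vanish in metabelian algebras\<close>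

primrec is_product :: "'x word \<Rightarrow> bool" where
  "is_product (Var x) = False"
| "is_product (Times u v) = True"

text \<open>
  The words with a factor \<open>(u\<^sub>1 u\<^sub>2) (u\<^sub>3 u\<^sub>4)\<close>. They span the ideal of relations of the free metabelian
  superalgebra, and the remaining words are a basis of it.
\<close>

primrec metabelian_null :: "'x word \<Rightarrow> bool" where
  "metabelian_null (Var x) = False"
| "metabelian_null (Times u v) = (metabelian_null u \<or> metabelian_null v \<or> is_product u \<and> is_product v)"

definition null_span :: "('x, 'f::field) npoly set"
  where "null_span = {p. \<forall>w\<in>Poly_Mapping.keys p. metabelian_null w}"

lemma null_span_closed:
  "0 \<in> null_span" "p \<in> null_span \<Longrightarrow> q \<in> null_span \<Longrightarrow> p + q \<in> null_span"
  "p \<in> null_span \<Longrightarrow> Poly_Mapping.map ((*) c) p \<in> null_span"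
  using keys_add_in[of _ p q] keys_smult[of c p] by (auto simp: null_span_def)

fun left_normed :: "'x word list \<Rightarrow> 'x word" where
  "left_normed (w # ws) = foldl Times w ws"
| "left_normed [] = undefined"

lemma left_normed_snoc: "ws \<noteq> [] \<Longrightarrow> left_normed (ws @ [w]) = Times (left_normed ws) w"
  by (cases ws) auto

lemma letters_left_normed: "ws \<noteq> [] \<Longrightarrow> letters (left_normed ws) = concat (map letters ws)"
proof (induction ws rule: rev_induct)
  case (snoc w ws)
  then show ?case by (cases "ws = []") (simp_all add: left_normed_snoc)
qed simp

lemma is_product_left_normed:
  "\<exists>w\<in>set ws. is_product w \<Longrightarrow> is_product (left_normed ws)"
proof (induction ws rule: rev_induct)
  case (snoc w ws)
  then show ?case by (cases "ws = []") (auto simp: left_normed_snoc)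
qed simp

text \<open>
  From the second position on, a factor is multiplied by everything to its left. That is a product
  if it has at least two factors or if its only factor is a product.
\<close>

lemma metabelian_null_left_normed:
  assumes "i < j" "j < length ws" "is_product (ws ! i)" "is_product (ws ! j)"
  shows "metabelian_null (left_normed ws)"
  using assms
proof (induction ws rule: rev_induct)
  case (snoc w ws)
  then have ne: "ws \<noteq> []" by auto
  show ?case
  proof (cases "j < length ws")
    case True
    then show ?thesis using snoc ne by (simp add: left_normed_snoc nth_append)
  next
    case False
    then have "i < length ws" "j = length ws" using snoc.prems by auto
    then have "is_product w" "\<exists>w\<in>set ws. is_product w"
      using snoc.prems by (auto simp: nth_append)
    then show ?thesis using ne is_product_left_normed[of ws] by (simp add: left_normed_snoc)
  qed
qed simp

lemma not_metabelian_null_left_normed_Var: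
  "xs \<noteq> [] \<Longrightarrow> \<not> metabelian_null (left_normed (map Var xs))"
proof (induction xs rule: rev_induct)
  case (snoc x xs)
  then show ?case by (cases "xs = []") (simp_all add: left_normed_snoc)
qed simp

primrec word_subst :: "('x \<Rightarrow> 'y word) \<Rightarrow> 'x word \<Rightarrow> 'y word" where
  "word_subst s (Var x) = s x"
| "word_subst s (Times u v) = Times (word_subst s u) (word_subst s v)"

lemma word_subst_left_normed:
  "xs \<noteq> [] \<Longrightarrow> word_subst s (left_normed (map Var xs)) = left_normed (map s xs)"
proof (induction xs rule: rev_induct)
  case (snoc x xs)
  then show ?case by (cases "xs = []") (simp_all add: left_normed_snoc)
qed simp

lemma left_normed_Var_inj:
  "length xs = length ys \<Longrightarrow> xs \<noteq> [] \<Longrightarrow> left_normed (map Var xs) = left_normed (map Var ys) \<Longrightarrow> xs = ys"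
proof -
  assume "length xs = length ys" "xs \<noteq> []" "left_normed (map Var xs) = left_normed (map Var ys)"
  then have "concat (map letters (map Var xs)) = concat (map letters (map Var ys))"
    by (metis length_0_conv letters_left_normed map_is_Nil_conv)
  moreover have "concat (map letters (map Var zs)) = zs" for zs :: "'a list" by (induction zs) auto
  ultimately show "xs = ys" by simp
qed

section \<open>Signs of transpositions\<close>

definition parity_sign :: "bit \<Rightarrow> 'f::field"
  where "parity_sign p = (if p = 1 then - 1 else 1)"

text \<open>
  The two pairs that a letter between \<open>x\<close> and \<open>y\<close> forms with them contribute the same product before
  and after the exchange, and pairs with letters further out are merely permuted. What remains is
  the pair \<open>x\<close>, \<open>y\<close> itself.
\<close>

lemma koszul_swap:
  assumes "distinct (xs @ x # ys @ y # zs)" and p: "par x = p" "par y = p"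
  shows "pair_prod (koszul_factor par) (xs @ y # ys @ x # zs) =
    (parity_sign p * pair_prod (koszul_factor par) (xs @ x # ys @ y # zs) :: 'f::field)"
proof -
  let ?F = "koszul_factor par :: nat \<Rightarrow> nat \<Rightarrow> 'f"
  have "(\<Prod>z\<leftarrow>ys. ?F y z * ?F z x) = (\<Prod>z\<leftarrow>ys. ?F x z * ?F z y)"
  proof (rule arg_cong[of _ _ prod_list], rule map_cong[OF refl])
    fix z assume "z \<in> set ys"
    then have "z \<noteq> x" "z \<noteq> y" using assms(1) by auto
    then show "?F y z * ?F z x = ?F x z * ?F z y"
      using p unfolding koszul_factor_def by (cases "par z = 1"; cases "p = 1"; cases "z < x"; cases "z < y") simp_all
  qed
  then have ys: "(\<Prod>z\<leftarrow>ys. ?F y z) * (\<Prod>z\<leftarrow>ys. ?F z x) = (\<Prod>z\<leftarrow>ys. ?F x z) * (\<Prod>z\<leftarrow>ys. ?F z y)"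
    by (simp only: prod_list_map_mult)
  have xy: "?F y x = parity_sign p * ?F x y"
    using assms(1) p unfolding koszul_factor_def parity_sign_def
    by (cases "p = 1"; cases "x < y") simp_all
  define a where "a = (\<Prod>z\<leftarrow>ys. ?F y z)"
  define b where "b = (\<Prod>z\<leftarrow>ys. ?F z x)"
  define a' where "a' = (\<Prod>z\<leftarrow>ys. ?F x z)"
  define b' where "b' = (\<Prod>z\<leftarrow>ys. ?F z y)"
  have L: "pair_prod ?F (xs @ y # ys @ x # zs) = (a * b) * (?F y x) *
      (pair_prod ?F xs * pair_prod ?F ys * pair_prod ?F zs * (\<Prod>z\<leftarrow>zs. ?F x z) * (\<Prod>z\<leftarrow>zs. ?F y z) *
       cross_prod ?F ys zs * (\<Prod>z\<leftarrow>xs. ?F z x) * (\<Prod>z\<leftarrow>xs. ?F z y) * cross_prod ?F xs ys * cross_prod ?F xs zs)"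
    by (simp add: pair_prod_append cross_prod_Cons_right cross_prod_append_right a_def b_def algebra_simps)
  have R: "pair_prod ?F (xs @ x # ys @ y # zs) = (a' * b') * (?F x y) *
      (pair_prod ?F xs * pair_prod ?F ys * pair_prod ?F zs * (\<Prod>z\<leftarrow>zs. ?F x z) * (\<Prod>z\<leftarrow>zs. ?F y z) *
       cross_prod ?F ys zs * (\<Prod>z\<leftarrow>xs. ?F z x) * (\<Prod>z\<leftarrow>xs. ?F z y) * cross_prod ?F xs ys * cross_prod ?F xs zs)"
    by (simp add: pair_prod_append cross_prod_Cons_right cross_prod_append_right a'_def b'_def algebra_simps)
  have "a * b = a' * b'" using ys by (simp only: a_def b_def a'_def b'_def)
  then show ?thesis unfolding L R xy by (simp only: mult.assoc mult.left_commute)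
qed

lemma koszul_transpose:
  assumes "distinct xs" "a \<in> set xs" "b \<in> set xs" "a \<noteq> b" "par a = p" "par b = p"
  shows "pair_prod (koszul_factor par) (map (transpose a b) xs) =
    (parity_sign p * pair_prod (koszul_factor par) xs :: 'f::field)"
proof -
  have main: ?thesis if "xs = us @ a # vs @ b # ws \<or> xs = us @ b # vs @ a # ws" for us vs ws
  proof -
    have notin: "a \<notin> set us \<union> set vs \<union> set ws" "b \<notin> set us \<union> set vs \<union> set ws"
      using that assms(1) by auto
    have "map (transpose a b) zs = zs" if "a \<notin> set zs" "b \<notin> set zs" for zs
    proof (rule map_idI)
      fix z assume "z \<in> set zs"
      then have "z \<noteq> a" "z \<noteq> b" using that by blast+
      then show "transpose a b z = z" by simp
    qed
    then have id: "map (transpose a b) us = us" "map (transpose a b) vs = vs" "map (transpose a b) ws = ws"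
      using notin by simp_all
    show ?thesis
      using that
    proof
      assume xs: "xs = us @ a # vs @ b # ws"
      then have "map (transpose a b) xs = us @ b # vs @ a # ws" by (simp add: id)
      then show ?thesis using koszul_swap[of us a vs b ws par p] assms xs by simp
    next
      assume xs: "xs = us @ b # vs @ a # ws"
      then have "map (transpose a b) xs = us @ a # vs @ b # ws" by (simp add: id)
      then show ?thesis using koszul_swap[of us b vs a ws par p] assms xs by simp
    qed
  qed
  obtain us ts where us: "xs = us @ a # ts" using assms(2) by (meson split_list)
  show ?thesis
  proof (cases "b \<in> set ts")
    case True
    then obtain vs ws where "ts = vs @ b # ws" by (meson split_list)
    then show ?thesis using main us by blast
  next
    case False
    then have "b \<in> set us" using us assms by auto
    then obtain vs ws where "us = vs @ b # ws" by (meson split_list)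
    then show ?thesis using main us by (metis append.assoc append_Cons)
  qed
qed

definition perm_word :: "nat \<Rightarrow> (nat \<Rightarrow> nat) \<Rightarrow> nat word"
  where "perm_word n \<pi> = left_normed (map Var (map \<pi> [0..<n]))"

lemma letters_perm_word: "n > 0 \<Longrightarrow> letters (perm_word n \<pi>) = map \<pi> [0..<n]"
proof -
  have "concat (map letters (map Var zs)) = zs" for zs :: "nat list" by (induction zs) auto
  then show "n > 0 \<Longrightarrow> ?thesis" unfolding perm_word_def by (subst letters_left_normed) (simp_all del: map_map)
qed

lemma word_subst_perm_word: "n > 0 \<Longrightarrow> word_subst s (perm_word n \<pi>) = left_normed (map (s \<circ> \<pi>) [0..<n])"
  unfolding perm_word_def by (subst word_subst_left_normed) auto

lemma distinct_perm_word:
  assumes "\<pi> permutes {..<n}" "n > 0"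
  shows "distinct (letters (perm_word n \<pi>))" "set (letters (perm_word n \<pi>)) = {..<n}"
  using assms permutes_inj_on[OF assms(1), of "{..<n}"] permutes_image[OF assms(1)]
  by (auto simp: letters_perm_word distinct_map atLeast0LessThan)

lemma koszul_sign_transpose:
  assumes \<pi>: "\<pi> permutes {..<n}" and "a < n" "b < n" "a \<noteq> b" "par a = p" "par b = p"
  shows "koszul_sign par (perm_word n (transpose a b \<circ> \<pi>)) =
    (parity_sign p * koszul_sign par (perm_word n \<pi>) :: 'f::field)"
proof -
  have n: "n > 0" using assms by simp
  have "letters (perm_word n (transpose a b \<circ> \<pi>)) = map (transpose a b) (letters (perm_word n \<pi>))"
    using n by (simp add: letters_perm_word)
  then show ?thesis
    unfolding koszul_sign_pair_prod
    using assms distinct_perm_word[OF \<pi> n] by (simp add: koszul_transpose del: transpose_comp_eq)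
qed

lemma koszul_sign_square: "koszul_sign par w * koszul_sign par w = (1 :: 'f::field)"
  by (simp add: koszul_sign_def power_mult_distrib[symmetric])

section \<open>A polynomial for a rectangular Young diagram\<close>

definition row_perms :: "nat \<Rightarrow> nat \<Rightarrow> (nat \<Rightarrow> nat) set"
  where "row_perms N m = {\<rho>. \<rho> permutes {..<N * m} \<and> (\<forall>x<N * m. \<rho> x div m = x div m)}"

definition col_perms :: "nat \<Rightarrow> nat \<Rightarrow> (nat \<Rightarrow> nat) set"
  where "col_perms N m = {\<kappa>. \<kappa> permutes {..<N * m} \<and> (\<forall>x<N * m. \<kappa> x mod m = x mod m)}"

definition perm_sign :: "bit \<Rightarrow> nat \<Rightarrow> (nat \<Rightarrow> nat) \<Rightarrow> 'f::field"
  where "perm_sign p n \<pi> = koszul_sign (\<lambda>_. p) (perm_word n \<pi>)"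

text \<open>
  The variables \<open>0, \<dots>, N m - 1\<close> are the cells of an array of \<open>N\<close> rows and \<open>m\<close> columns, the cell \<open>x\<close>
  lying in row \<open>x div m\<close> and column \<open>x mod m\<close>. The character \<^term>\<open>perm_sign p n\<close> is trivial for \<open>p = 0\<close>
  and the sign of permutations for \<open>p = 1\<close>. Hence this is a Young symmetrizer of rectangular shape
  applied to a left normed word: for \<open>q = 0\<close> rows are symmetrized and columns alternated, for \<open>q = 1\<close>
  the other way round. On variables of parity \<open>q\<close> the superization therefore symmetrizes rows and
  alternates columns in both cases, and on variables of parity \<open>q + 1\<close> it does the opposite.
\<close>

definition rect_poly :: "bit \<Rightarrow> nat \<Rightarrow> nat \<Rightarrow> (nat, 'f::field) npoly"
  where "rect_poly q N m = (\<Sum>\<kappa>\<in>col_perms N m. \<Sum>\<rho>\<in>row_perms N m.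
    Poly_Mapping.single (perm_word (N * m) (\<kappa> \<circ> \<rho>)) (perm_sign (q + 1) (N * m) \<kappa> * perm_sign q (N * m) \<rho>))"

lemma finite_perms [simp]: "finite (row_perms N m)" "finite (col_perms N m)"
  unfolding row_perms_def col_perms_def
  by (rule finite_subset[OF _ finite_permutations[of "{..<N * m}"]]; simp add: subset_iff)+

lemma keys_rect_poly:
  assumes "w \<in> Poly_Mapping.keys (rect_poly q N m)"
  obtains \<pi> where "\<pi> permutes {..<N * m}" "w = perm_word (N * m) \<pi>"
proof -
  obtain \<kappa> where \<kappa>: "\<kappa> \<in> col_perms N m" and w: "w \<in> Poly_Mapping.keys (\<Sum>\<rho>\<in>row_perms N m.
      Poly_Mapping.single (perm_word (N * m) (\<kappa> \<circ> \<rho>)) (perm_sign (q + 1) (N * m) \<kappa> * perm_sign q (N * m) \<rho> :: 'a))"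
    using assms[unfolded rect_poly_def, THEN subsetD[OF keys_sum]] by (rule UN_E)
  obtain \<rho> where \<rho>: "\<rho> \<in> row_perms N m" and w: "w \<in> Poly_Mapping.keys
      (Poly_Mapping.single (perm_word (N * m) (\<kappa> \<circ> \<rho>)) (perm_sign (q + 1) (N * m) \<kappa> * perm_sign q (N * m) \<rho> :: 'a))"
    using w[THEN subsetD[OF keys_sum]] by (rule UN_E)
  have "w = perm_word (N * m) (\<kappa> \<circ> \<rho>)" using w by (simp split: if_splits)
  moreover have "(\<kappa> \<circ> \<rho>) permutes {..<N * m}"
    using \<kappa> \<rho> by (intro permutes_compose) (simp_all add: row_perms_def col_perms_def)
  ultimately show ?thesis by (intro that)
qed

lemma multilinear_rect_poly:
  assumes "N * m > 0" and "w \<in> Poly_Mapping.keys (rect_poly q N m)"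
  shows "distinct (letters w) \<and> set (letters w) = {..<N * m}"
  using assms(2) by (rule keys_rect_poly) (simp only: distinct_perm_word[OF _ assms(1)] simp_thms)

lemma superization_sum: "superization par (\<Sum>i\<in>I. p i) = (\<Sum>i\<in>I. superization par (p i))"
  by (rule poly_mapping_eqI) (simp add: lookup_sum sum_distrib_left)

lemma superization_single: "superization par (Poly_Mapping.single w c) = Poly_Mapping.single w (koszul_sign par w * c)"
  by (rule poly_mapping_eqI) (auto simp: lookup_single when_def)

lemma sum_eq_zero_involution:
  fixes g :: "'i \<Rightarrow> ('w \<Rightarrow>\<^sub>0 'f::field_char_0)"
  assumes t: "\<And>i. i \<in> I \<Longrightarrow> t i \<in> I" "\<And>i. i \<in> I \<Longrightarrow> t (t i) = i" and g: "\<And>i. i \<in> I \<Longrightarrow> g (t i) = - g i"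
  shows "sum g I = 0"
proof -
  have "sum g I = sum (\<lambda>i. g (t i)) I"
    by (rule sum.reindex_bij_witness[of _ t t]) (auto simp: t)
  also have "\<dots> = - sum g I" by (simp add: g sum_negf)
  finally have "sum g I = - sum g I" .
  then have "Poly_Mapping.lookup (sum g I) w = - Poly_Mapping.lookup (sum g I) w" for w
    by (metis lookup_uminus)
  then show ?thesis by (intro poly_mapping_eqI) simp
qed

text \<open>
  The contribution of \<open>\<kappa>\<close> and \<open>\<rho>\<close> to the value of the superization when each variable \<open>x\<close> is replaced
  by the word \<open>s x\<close>.
\<close>

definition rect_term :: "bit \<Rightarrow> nat \<Rightarrow> nat \<Rightarrow> (nat \<Rightarrow> bit) \<Rightarrow> (nat \<Rightarrow> 'x word) \<Rightarrow> (nat \<Rightarrow> nat) \<Rightarrow> (nat \<Rightarrow> nat) \<Rightarrow> ('x, 'f::field) npoly"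
  where "rect_term q N m par s \<kappa> \<rho> = Poly_Mapping.single (word_subst s (perm_word (N * m) (\<kappa> \<circ> \<rho>)))
    (koszul_sign par (perm_word (N * m) (\<kappa> \<circ> \<rho>)) * (perm_sign (q + 1) (N * m) \<kappa> * perm_sign q (N * m) \<rho>))"

lemma eval_npoly_free_sum:
  assumes "\<And>x. u x \<in> carrier (free_superalg X gp)"
  shows "eval_npoly (free_superalg X gp) u (\<Sum>i\<in>I. p i) = (\<Sum>i\<in>I. eval_npoly (free_superalg X gp) u (p i :: (nat, 'f::field) npoly))"
proof -
  interpret F: superalgebra "free_superalg X gp :: ('f, ('a, 'f) npoly) superalg" by (rule superalgebra_free)
  show ?thesis
  proof (induction I rule: infinite_finite_induct)
    case (insert i I)
    then show ?case using F.eval_npoly_add[of u "p i" "\<Sum>i\<in>I. p i"] assms by simp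
  qed (use F.eval_npoly_0[of u] in simp_all)
qed

lemma eval_word_free_words:
  "eval_word (free_superalg X gp) (\<lambda>x. Poly_Mapping.single (s x) 1) w = Poly_Mapping.single (word_subst s w) (1 :: 'f::field)"
  by (induction w) simp_all

lemma eval_rect_poly_words:
  assumes s: "\<And>x. set (letters (s x)) \<subseteq> X"
  shows "eval_npoly (free_superalg X gp) (\<lambda>x. Poly_Mapping.single (s x) 1) (superization par (rect_poly q N m)) =
    (\<Sum>\<kappa>\<in>col_perms N m. \<Sum>\<rho>\<in>row_perms N m. rect_term q N m par s \<kappa> \<rho> :: ('x, 'f::field) npoly)"
proof -
  interpret F: superalgebra "free_superalg X gp :: ('f, ('x, 'f) npoly) superalg" by (rule superalgebra_free)
  have c: "Poly_Mapping.single (s x) 1 \<in> carrier (free_superalg X gp :: ('f, ('x, 'f) npoly) superalg)" for x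
    using s by simp
  show ?thesis
    unfolding rect_poly_def superization_sum superization_single eval_npoly_free_sum[OF c]
    by (intro sum.cong refl) (simp add: F.eval_npoly_single[OF c] eval_word_free_words rect_term_def)
qed

lemma permutes_transpose_compose:
  assumes "\<pi> permutes S" "a \<in> S" "b \<in> S"
  shows "(transpose a b \<circ> \<pi>) permutes S"
  using assms by (intro permutes_compose permutes_swap_id)

lemma rect_term_transpose:
  assumes \<pi>: "(\<kappa> \<circ> \<rho>) permutes {..<N * m}" and ab: "a < N * m" "b < N * m" "a \<noteq> b"
    and p: "par a = p" "par b = p" and s: "s a = s b"
  shows "Poly_Mapping.single (word_subst s (perm_word (N * m) (transpose a b \<circ> (\<kappa> \<circ> \<rho>))))
      (koszul_sign par (perm_word (N * m) (transpose a b \<circ> (\<kappa> \<circ> \<rho>))) * c) =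
    Poly_Mapping.single (word_subst s (perm_word (N * m) (\<kappa> \<circ> \<rho>)))
      (koszul_sign par (perm_word (N * m) (\<kappa> \<circ> \<rho>)) * (parity_sign p * c :: 'f::field))"
proof -
  have n: "N * m > 0" using ab(1) by (rule le_less_trans[OF le0])
  have "s (transpose a b x) = s x" for x
    using s by (cases "x = a"; cases "x = b") simp_all
  then have "s \<circ> (transpose a b \<circ> (\<kappa> \<circ> \<rho>)) = s \<circ> (\<kappa> \<circ> \<rho>)" by (simp add: fun_eq_iff)
  then have "word_subst s (perm_word (N * m) (transpose a b \<circ> (\<kappa> \<circ> \<rho>))) = word_subst s (perm_word (N * m) (\<kappa> \<circ> \<rho>))"
    by (simp only: word_subst_perm_word[OF n])
  then show ?thesis
    by (simp only: koszul_sign_transpose[OF \<pi> ab p] mult.assoc mult.commute mult.left_commute)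
qed

lemma parity_sign_mult: "parity_sign (q + 1) * parity_sign q = (- 1 :: 'f::field)"
  by (cases "q = 1") (simp_all add: parity_sign_def)

text \<open>
  Equal entries of parity \<open>q\<close> in one column: exchanging them reverses the sign of each term.
\<close>

lemma sum_col_perms_zero:
  fixes s :: "nat \<Rightarrow> 'x word"
  assumes \<rho>: "\<rho> \<in> row_perms N m" and ab: "a < N * m" "b < N * m" "a \<noteq> b" "a mod m = b mod m"
    and p: "par a = q" "par b = q" and s: "s a = s b"
  shows "(\<Sum>\<kappa>\<in>col_perms N m. rect_term q N m par s \<kappa> \<rho> :: ('x, 'f::field_char_0) npoly) = 0"
proof (rule sum_eq_zero_involution[where t = "\<lambda>\<kappa>. transpose a b \<circ> \<kappa>"])
  fix \<kappa> assume \<kappa>: "\<kappa> \<in> col_perms N m"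
  then have \<kappa>p: "\<kappa> permutes {..<N * m}" and \<kappa>m: "\<And>x. x < N * m \<Longrightarrow> \<kappa> x mod m = x mod m"
    by (simp_all add: col_perms_def)
  have "transpose a b y mod m = y mod m" for y
    using ab(4) by (cases "y = a"; cases "y = b") simp_all
  then show "transpose a b \<circ> \<kappa> \<in> col_perms N m"
    using permutes_transpose_compose[OF \<kappa>p, of a b] ab \<kappa>m by (simp add: col_perms_def)
  show "transpose a b \<circ> (transpose a b \<circ> \<kappa>) = \<kappa>" by (simp add: fun_eq_iff)
  have \<pi>: "(\<kappa> \<circ> \<rho>) permutes {..<N * m}"
    using \<rho> \<kappa>p by (intro permutes_compose) (simp_all add: row_perms_def)
  have sg: "perm_sign (q + 1) (N * m) (transpose a b \<circ> \<kappa>) = (parity_sign (q + 1) * perm_sign (q + 1) (N * m) \<kappa> :: 'f)"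
    unfolding perm_sign_def by (rule koszul_sign_transpose[OF \<kappa>p ab(1-3)]) simp_all
  have "rect_term q N m par s (transpose a b \<circ> \<kappa>) \<rho> =
    Poly_Mapping.single (word_subst s (perm_word (N * m) (\<kappa> \<circ> \<rho>)))
      (koszul_sign par (perm_word (N * m) (\<kappa> \<circ> \<rho>)) * ((parity_sign (q + 1) * parity_sign q) *
        (perm_sign (q + 1) (N * m) \<kappa> * perm_sign q (N * m) \<rho> :: 'f)))"
    unfolding rect_term_def comp_assoc sg
    by (simp only: rect_term_transpose[OF \<pi> ab(1-3) p s]) (simp only: mult.assoc mult.commute mult.left_commute)
  then show "rect_term q N m par s (transpose a b \<circ> \<kappa>) \<rho> = - (rect_term q N m par s \<kappa> \<rho> :: ('x, 'f) npoly)"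
    by (simp only: parity_sign_mult rect_term_def[of q N m par s \<kappa> \<rho>] mult_minus_left mult_1_left
        mult_minus_right single_uminus)
qed

text \<open>
  Equal entries of parity \<open>q + 1\<close> in one row of the array as rearranged by \<open>\<kappa>\<close>.
\<close>

lemma sum_row_perms_zero:
  fixes s :: "nat \<Rightarrow> 'x word"
  assumes \<kappa>: "\<kappa> \<in> col_perms N m" and xy: "x < N * m" "y < N * m" "x \<noteq> y" "x div m = y div m"
    and p: "par (\<kappa> x) = q + 1" "par (\<kappa> y) = q + 1" and s: "s (\<kappa> x) = s (\<kappa> y)"
  shows "(\<Sum>\<rho>\<in>row_perms N m. rect_term q N m par s \<kappa> \<rho> :: ('x, 'f::field_char_0) npoly) = 0"
proof (rule sum_eq_zero_involution[where t = "\<lambda>\<rho>. transpose x y \<circ> \<rho>"])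
  fix \<rho> assume \<rho>: "\<rho> \<in> row_perms N m"
  then have \<rho>p: "\<rho> permutes {..<N * m}" and \<rho>m: "\<And>x. x < N * m \<Longrightarrow> \<rho> x div m = x div m"
    by (simp_all add: row_perms_def)
  have \<kappa>p: "\<kappa> permutes {..<N * m}" using \<kappa> by (simp add: col_perms_def)
  have "transpose x y z div m = z div m" for z
    using xy(4) by (cases "z = x"; cases "z = y") simp_all
  then show "transpose x y \<circ> \<rho> \<in> row_perms N m"
    using permutes_transpose_compose[OF \<rho>p, of x y] xy \<rho>m by (simp add: row_perms_def)
  show "transpose x y \<circ> (transpose x y \<circ> \<rho>) = \<rho>" by (simp add: fun_eq_iff)
  have \<pi>: "(\<kappa> \<circ> \<rho>) permutes {..<N * m}"
    using \<rho>p \<kappa>p by (intro permutes_compose)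
  have ab: "\<kappa> x < N * m" "\<kappa> y < N * m" "\<kappa> x \<noteq> \<kappa> y"
    using permutes_in_image[OF \<kappa>p] xy permutes_inj[OF \<kappa>p] by (auto dest: injD)
  have \<kappa>t: "\<kappa> \<circ> (transpose x y \<circ> \<rho>) = transpose (\<kappa> x) (\<kappa> y) \<circ> (\<kappa> \<circ> \<rho>)"
  proof
    fix z
    have "\<kappa> (transpose x y w) = transpose (\<kappa> x) (\<kappa> y) (\<kappa> w)" for w
      using permutes_inj[OF \<kappa>p] by (cases "w = x"; cases "w = y") (auto simp: transpose_def dest: injD)
    then show "(\<kappa> \<circ> (transpose x y \<circ> \<rho>)) z = (transpose (\<kappa> x) (\<kappa> y) \<circ> (\<kappa> \<circ> \<rho>)) z" by simp
  qed
  have sg: "perm_sign q (N * m) (transpose x y \<circ> \<rho>) = (parity_sign q * perm_sign q (N * m) \<rho> :: 'f)"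
    unfolding perm_sign_def by (rule koszul_sign_transpose[OF \<rho>p xy(1-3)]) simp_all
  have "rect_term q N m par s \<kappa> (transpose x y \<circ> \<rho>) =
    Poly_Mapping.single (word_subst s (perm_word (N * m) (\<kappa> \<circ> \<rho>)))
      (koszul_sign par (perm_word (N * m) (\<kappa> \<circ> \<rho>)) * ((parity_sign (q + 1) * parity_sign q) *
        (perm_sign (q + 1) (N * m) \<kappa> * perm_sign q (N * m) \<rho> :: 'f)))"
    unfolding rect_term_def \<kappa>t sg
    by (simp only: rect_term_transpose[OF \<pi> ab p s]) (simp only: mult.assoc mult.commute mult.left_commute)
  then show "rect_term q N m par s \<kappa> (transpose x y \<circ> \<rho>) = - (rect_term q N m par s \<kappa> \<rho> :: ('x, 'f) npoly)"
    by (simp only: parity_sign_mult rect_term_def[of q N m par s \<kappa> \<rho>] mult_minus_left mult_1_left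
        mult_minus_right single_uminus)
qed

text \<open>
  A column of \<open>N\<close> cells cannot be filled by distinct generators of parity \<open>q\<close>, so if the sum is not
  zero every column has a generator of the other parity. But column permutations only move these
  around, and a row has at most as many of them as there are generators of that parity. Counting
  them by columns and by rows is contradictory. One cell \<open>x0\<close> may hold any word; it spoils at most one
  column, and \<open>m\<close> is chosen so large that the remaining columns suffice.
\<close>

lemma rect_sum_zero_of_few_generators:
  fixes s :: "nat \<Rightarrow> 'x word"
  assumes X: "finite X" "card {g \<in> X. gp g = q} < N" and m: "m = N * card {g \<in> X. gp g \<noteq> q} + 2"
    and s: "\<And>x. x < N * m \<Longrightarrow> x \<noteq> x0 \<Longrightarrow> \<exists>g\<in>X. s x = Var g \<and> gp g = par x"
  shows "(\<Sum>\<kappa>\<in>col_perms N m. \<Sum>\<rho>\<in>row_perms N m. rect_term q N m par s \<kappa> \<rho> :: ('x, 'f::field_char_0) npoly) = 0"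
proof (rule ccontr)
  assume nz: "(\<Sum>\<kappa>\<in>col_perms N m. \<Sum>\<rho>\<in>row_perms N m. rect_term q N m par s \<kappa> \<rho> :: ('x, 'f) npoly) \<noteq> 0"
  have m0: "m > 0" using m by simp
  have bit: "p = q \<or> p = q + 1" for p :: bit by (cases "p = 1"; cases "q = 1") simp_all
  define H where "H = {x. x < N * m \<and> x \<noteq> x0 \<and> par x = q + 1}"
  let ?V = "{g \<in> X. gp g = q}" and ?W = "{g \<in> X. gp g \<noteq> q}"
  \<comment> \<open>otherwise a column without \<open>x0\<close> would consist of \<open>N\<close> distinct generators of parity \<open>q\<close>\<close>
  have col: "\<exists>x\<in>H. x mod m = j" if j: "j < m" "j \<noteq> x0 mod m" for j
  proof (rule ccontr)
    assume no: "\<not> (\<exists>x\<in>H. x mod m = j)"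
    let ?c = "\<lambda>i. i * m + j"
    have c: "?c i < N * m" "?c i \<noteq> x0" "par (?c i) = q" if "i < N" for i
    proof -
      have "(i + 1) * m \<le> N * m" using that by (intro mult_le_mono1) simp
      then show lt: "?c i < N * m" using j(1) by simp
      have md: "?c i mod m = j" using j(1) by simp
      show ne: "?c i \<noteq> x0" by (metis md j(2))
      have "?c i \<notin> H" using no md by blast
      then show "par (?c i) = q" using lt ne bit[of "par (?c i)"] by (auto simp: H_def)
    qed
    have "s (?c i) \<in> Var ` ?V" if "i < N" for i
      using s[of "?c i"] c[OF that] by auto
    then have "(\<lambda>i. s (?c i)) ` {..<N} \<subseteq> Var ` ?V" by blast
    then have "card ((\<lambda>i. s (?c i)) ` {..<N}) \<le> card (Var ` ?V)"
      using X(1) by (intro card_mono) auto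
    also have "\<dots> \<le> card ?V" using X(1) by (intro card_image_le) auto
    finally have "\<not> inj_on (\<lambda>i. s (?c i)) {..<N}"
      using X(2) card_image[of "\<lambda>i. s (?c i)" "{..<N}"] by auto
    then obtain i k where ik: "i < N" "k < N" "i \<noteq> k" "s (?c i) = s (?c k)"
      by (auto simp: inj_on_def)
    have "(\<Sum>\<kappa>\<in>col_perms N m. rect_term q N m par s \<kappa> \<rho> :: ('x, 'f) npoly) = 0" if "\<rho> \<in> row_perms N m" for \<rho>
      using c ik m0 by (intro sum_col_perms_zero[OF that, of "?c i" "?c k"]) auto
    then have "(\<Sum>\<rho>\<in>row_perms N m. \<Sum>\<kappa>\<in>col_perms N m. rect_term q N m par s \<kappa> \<rho> :: ('x, 'f) npoly) = 0"
      by simp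
    then show False using nz by (subst (asm) sum.swap) simp
  qed
  then have "{..<m} - {x0 mod m} \<subseteq> (\<lambda>x. x mod m) ` H" by auto
  moreover have finH: "finite H" by (simp add: H_def)
  ultimately have "card ({..<m} - {x0 mod m}) \<le> card H"
    by (meson card_image_le card_mono finite_imageI order_trans)
  moreover have "m \<le> card ({..<m} - {x0 mod m}) + 1"
    using m0 by (subst card_Diff_singleton) auto
  ultimately have big: "m \<le> card H + 1" by simp
  obtain \<kappa> where \<kappa>: "\<kappa> \<in> col_perms N m"
      and nz': "(\<Sum>\<rho>\<in>row_perms N m. rect_term q N m par s \<kappa> \<rho> :: ('x, 'f) npoly) \<noteq> 0"
    using nz by (meson sum.neutral)
  have \<kappa>p: "\<kappa> permutes {..<N * m}" using \<kappa> by (simp add: col_perms_def)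
  \<comment> \<open>in every row the cells that \<open>\<kappa>\<close> maps into \<open>H\<close> receive distinct generators\<close>
  define H' where "H' = {x. x < N * m \<and> \<kappa> x \<in> H}"
  have "H \<subseteq> \<kappa> ` H'"
  proof
    fix x assume x: "x \<in> H"
    then have "x \<in> \<kappa> ` {..<N * m}" using permutes_image[OF \<kappa>p] by (simp add: H_def)
    then show "x \<in> \<kappa> ` H'" using x by (auto simp: H'_def)
  qed
  moreover have finH': "finite H'" by (simp add: H'_def)
  ultimately have "card H \<le> card H'"
    by (meson card_image_le card_mono finite_imageI order_trans)
  also have "\<dots> \<le> card ({..<N} \<times> (Var ` ?W :: 'x word set))"
  proof (rule card_inj_on_le)
    show "inj_on (\<lambda>x. (x div m, s (\<kappa> x))) H'"
    proof (rule inj_onI, rule ccontr)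
      fix x y assume xy: "x \<in> H'" "y \<in> H'" "(x div m, s (\<kappa> x)) = (y div m, s (\<kappa> y))" "x \<noteq> y"
      then have "(\<Sum>\<rho>\<in>row_perms N m. rect_term q N m par s \<kappa> \<rho> :: ('x, 'f) npoly) = 0"
        by (intro sum_row_perms_zero[OF \<kappa>, of x y]) (auto simp: H'_def H_def)
      with nz' show False by simp
    qed
    show "(\<lambda>x. (x div m, s (\<kappa> x))) ` H' \<subseteq> {..<N} \<times> Var ` ?W"
    proof (rule image_subsetI)
      fix x assume x: "x \<in> H'"
      then have H: "\<kappa> x < N * m" "\<kappa> x \<noteq> x0" "par (\<kappa> x) = q + 1" by (auto simp: H'_def H_def)
      obtain g where g: "g \<in> X" "s (\<kappa> x) = Var g" "gp g = q + 1" using s[OF H(1,2)] H(3) by auto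
      have "x div m < N" using x m0 by (simp add: H'_def less_mult_imp_div_less)
      moreover have "gp g \<noteq> q" using g(3) by (cases "q = 1") simp_all
      ultimately show "(x div m, s (\<kappa> x)) \<in> {..<N} \<times> Var ` ?W" using g by simp
    qed
    show "finite ({..<N} \<times> (Var ` ?W :: 'x word set))" using X(1) by simp
  qed
  also have "\<dots> \<le> N * card ?W"
    using X(1) card_image_le[of ?W Var] by (simp add: card_cartesian_product)
  finally show False using big m by simp
qed

lemma word_parity_Var: "word_parity par (Var x) = par x"
  by (cases "par x = 1") (simp_all add: word_parity_def)

lemma single_words_lin_span:
  fixes p :: "('x, 'f::field) npoly"
  assumes "p \<in> grade (free_superalg X gp) i"
  shows "p \<in> lin_span (free_superalg X gp) {Poly_Mapping.single w 1 | w. set (letters w) \<subseteq> X \<and> word_parity gp w = i}"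
    (is "_ \<in> lin_span ?F ?E")
proof (induction p rule: npoly_induct)
  case zero
  show ?case using lin_span.zero[of ?F ?E] by simp
next
  case (add r w c)
  have "Poly_Mapping.single w 1 \<in> ?E" using assms add(2) by auto
  from lin_span.add[OF this add(1), of c] show ?case by (simp add: Poly_Mapping.map_single)
qed

lemma null_of_two_products:
  assumes \<pi>: "\<pi> permutes {..<n}" and xy: "x < n" "y < n" "x \<noteq> y" "is_product (s x)" "is_product (s y)"
  shows "metabelian_null (word_subst s (perm_word n \<pi>))"
proof -
  have "x \<in> \<pi> ` {..<n}" "y \<in> \<pi> ` {..<n}" using permutes_image[OF \<pi>] xy by simp_all
  then obtain i j where ij: "i < n" "j < n" "\<pi> i = x" "\<pi> j = y" by auto
  then have "i < j \<or> j < i" using xy(3) by (metis nat_neq_iff)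
  then show ?thesis
    using ij xy metabelian_null_left_normed[of i j "map (s \<circ> \<pi>) [0..<n]"]
      metabelian_null_left_normed[of j i "map (s \<circ> \<pi>) [0..<n]"]
    by (auto simp: word_subst_perm_word)
qed

lemma null_span_sum: "(\<And>i. i \<in> I \<Longrightarrow> p i \<in> null_span) \<Longrightarrow> sum p I \<in> null_span"
  by (induction I rule: infinite_finite_induct) (simp_all add: null_span_closed)

text \<open>
  By multilinearity the variables may be replaced by words. If two of these are products, every term
  is a null word; otherwise at most one cell holds something else than a generator.
\<close>

theorem rect_poly_few_generators:
  fixes u :: "nat \<Rightarrow> ('x, 'f::field_char_0) npoly"
  assumes X: "finite X" "card {g \<in> X. gp g = q} < N" and m: "m = N * card {g \<in> X. gp g \<noteq> q} + 2"
    and u: "\<And>x. u x \<in> grade (free_superalg X gp) (par x)"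
  shows "eval_npoly (free_superalg X gp) u (superization par (rect_poly q N m)) \<in> null_span"
proof -
  let ?F = "free_superalg X gp :: ('f, ('x, 'f) npoly) superalg" and ?n = "N * m"
  interpret F: superalgebra ?F by (rule superalgebra_free)
  have n: "?n > 0" using X m by simp
  let ?E = "\<lambda>x. {Poly_Mapping.single w (1 :: 'f) | w. set (letters w) \<subseteq> X \<and> word_parity gp w = par x}"
  show ?thesis
  proof (rule F.eval_npoly_lin_span[where X = "{..<?n}" and E = ?E])
    show "distinct (letters w) \<and> set (letters w) = {..<?n}"
      if "w \<in> Poly_Mapping.keys (superization par (rect_poly q N m :: (nat, 'f) npoly))" for w
      using that by (intro multilinear_rect_poly[OF n]) simp
    show "u x \<in> carrier ?F" for x by (rule F.grade_carrier[OF u])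
    show "u x \<in> lin_span ?F (?E x)" for x by (rule single_words_lin_span[OF u])
    show "?E x \<subseteq> carrier ?F" for x by auto
    fix v :: "nat \<Rightarrow> ('x, 'f) npoly"
    assume v: "\<And>x. v x \<in> carrier ?F" "\<And>x. x \<in> {..<?n} \<Longrightarrow> v x \<in> ?E x"
    have "\<exists>w. v x = Poly_Mapping.single w 1 \<and> set (letters w) \<subseteq> X \<and> word_parity gp w = par x" if "x < ?n" for x
      using v(2)[of x] that by simp
    then obtain t where t: "\<And>x. x < ?n \<Longrightarrow> v x = Poly_Mapping.single (t x) 1 \<and> set (letters (t x)) \<subseteq> X \<and> word_parity gp (t x) = par x"
      by metis
    define s where "s x = t (if x < ?n then x else 0)" for x
    have s: "set (letters (s x)) \<subseteq> X" for x using t n by (simp add: s_def)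
    have sc: "Poly_Mapping.single (s x) (1 :: 'f) \<in> carrier ?F" for x using s by simp
    have "eval_npoly ?F v (superization par (rect_poly q N m)) =
        eval_npoly ?F (\<lambda>x. Poly_Mapping.single (s x) 1) (superization par (rect_poly q N m))"
    proof (rule F.eval_npoly_cong[OF _ sc])
      fix w x assume w: "w \<in> Poly_Mapping.keys (superization par (rect_poly q N m :: (nat, 'f) npoly))" and x: "x \<in> set (letters w)"
      have "set (letters w) = {..<?n}"
        using w[unfolded keys_superization] by (intro conjunct2[OF multilinear_rect_poly[OF n]])
      then have "x < ?n" using x by blast
      then show "v x = Poly_Mapping.single (s x) 1" using t[of x] by (simp add: s_def)
    qed
    also have "\<dots> = (\<Sum>\<kappa>\<in>col_perms N m. \<Sum>\<rho>\<in>row_perms N m. rect_term q N m par s \<kappa> \<rho>)"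
      by (rule eval_rect_poly_words[OF s])
    also have "\<dots> \<in> null_span"
    proof (cases "\<exists>x y. x < ?n \<and> y < ?n \<and> x \<noteq> y \<and> is_product (s x) \<and> is_product (s y)")
      case True
      then obtain x y where xy: "x < ?n" "y < ?n" "x \<noteq> y" "is_product (s x)" "is_product (s y)" by blast
      show ?thesis
      proof (intro null_span_sum)
        fix \<kappa> \<rho> assume "\<kappa> \<in> col_perms N m" "\<rho> \<in> row_perms N m"
        then have "(\<kappa> \<circ> \<rho>) permutes {..<?n}"
          by (intro permutes_compose) (simp_all add: row_perms_def col_perms_def)
        from null_of_two_products[OF this xy]
        show "(rect_term q N m par s \<kappa> \<rho> :: ('x, 'f) npoly) \<in> null_span"
          by (simp add: rect_term_def null_span_def)
      qed
    next
      case False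
      then obtain x0 where x0: "\<And>x. x < ?n \<Longrightarrow> x \<noteq> x0 \<Longrightarrow> \<not> is_product (s x)" by metis
      have "(\<Sum>\<kappa>\<in>col_perms N m. \<Sum>\<rho>\<in>row_perms N m. rect_term q N m par s \<kappa> \<rho> :: ('x, 'f) npoly) = 0"
      proof (rule rect_sum_zero_of_few_generators[OF X m])
        fix x assume x: "x < ?n" "x \<noteq> x0"
        then obtain g where g: "s x = Var g" using x0[of x] by (cases "s x") simp_all
        have "word_parity gp (s x) = par x" using t[of x] x by (simp add: s_def)
        then show "\<exists>g\<in>X. s x = Var g \<and> gp g = par x" using s[of x] g by (simp add: word_parity_Var)
      qed
      then show ?thesis by (simp only: null_span_closed)
    qed
    finally show "eval_npoly ?F v (superization par (rect_poly q N m)) \<in> null_span" .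
  qed (simp_all add: null_span_closed)
qed

text \<open>
  Fill row \<open>i\<close> with the generator \<open>g i\<close>. A term gives back the original array only if \<open>\<kappa>\<close> is the
  identity, and then its sign does not depend on \<open>\<rho>\<close>. So this word has the order of the row group as
  coefficient, up to sign, and in characteristic zero it survives.
\<close>

theorem rect_poly_enough_generators:
  fixes g :: "nat \<Rightarrow> 'x" and X gp
  assumes g: "inj_on g {..<N}" "\<And>i. i < N \<Longrightarrow> g i \<in> X \<and> gp (g i) = q" and Nm: "N > 0" "m > 0"
  obtains u :: "nat \<Rightarrow> ('x, 'f::field_char_0) npoly"
  where "\<And>x. u x \<in> grade (free_superalg X gp) q"
    and "eval_npoly (free_superalg X gp) u (superization (\<lambda>_. q) (rect_poly q N m)) \<notin> null_span"
proof -
  let ?n = "N * m"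
  have n: "?n > 0" using Nm by simp
  define h where "h x = g (if x < ?n then x div m else 0)" for x
  define s where "s x = Var (h x)" for x
  have row: "x div m < N" if "x < ?n" for x using that by (simp add: less_mult_imp_div_less)
  have h: "h x \<in> X \<and> gp (h x) = q" for x using g(2) row Nm by (simp add: h_def)
  have subst: "word_subst s (perm_word ?n \<pi>) = left_normed (map Var (map (h \<circ> \<pi>) [0..<?n]))" for \<pi>
    by (simp add: word_subst_perm_word[OF n] s_def comp_def)
  let ?w = "word_subst s (perm_word ?n id)"
  have id: "id \<in> col_perms N m" "id \<in> row_perms N m"
    by (simp_all add: col_perms_def row_perms_def permutes_id)
  have eq_iff: "word_subst s (perm_word ?n (\<kappa> \<circ> \<rho>)) = ?w \<longleftrightarrow> \<kappa> = id" if \<kappa>: "\<kappa> \<in> col_perms N m" and \<rho>: "\<rho> \<in> row_perms N m" for \<kappa> \<rho>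
  proof
    have \<kappa>p: "\<kappa> permutes {..<?n}" and \<kappa>m: "\<And>x. x < ?n \<Longrightarrow> \<kappa> x mod m = x mod m"
      using \<kappa> by (simp_all add: col_perms_def)
    have \<rho>p: "\<rho> permutes {..<?n}" and \<rho>m: "\<And>x. x < ?n \<Longrightarrow> \<rho> x div m = x div m"
      using \<rho> by (simp_all add: row_perms_def)
    have h_iff: "h x = h y \<longleftrightarrow> x div m = y div m" if "x < ?n" "y < ?n" for x y
      using that inj_onD[OF g(1), of "x div m" "y div m"] row by (auto simp: h_def)
    have lt: "\<kappa> x < ?n" "\<rho> x < ?n" if "x < ?n" for x
      using that permutes_in_image[OF \<kappa>p, of x] permutes_in_image[OF \<rho>p, of x] by simp_all
    { assume "word_subst s (perm_word ?n (\<kappa> \<circ> \<rho>)) = ?w"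
      then have "map (h \<circ> (\<kappa> \<circ> \<rho>)) [0..<?n] = map (h \<circ> id) [0..<?n]"
        unfolding subst by (rule left_normed_Var_inj[rotated 2]) (use n in simp_all)
      then have "h (\<kappa> (\<rho> x)) = h x" if "x < ?n" for x
        using that by (simp add: map_eq_conv)
      then have *: "\<kappa> (\<rho> x) div m = \<rho> x div m" if "x < ?n" for x
        using h_iff that lt \<rho>m by simp
      have "\<kappa> y = y" for y
      proof (cases "y < ?n")
        case True
        then have "y \<in> \<rho> ` {..<?n}" using permutes_image[OF \<rho>p] by simp
        then have "\<kappa> y div m = y div m" using * by auto
        then show ?thesis using \<kappa>m[OF True] by (metis div_mult_mod_eq)
      next
        case False
        then show ?thesis using \<kappa>p by (simp add: permutes_def)
      qed
      then show "\<kappa> = id" by (simp add: fun_eq_iff) }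
    { assume "\<kappa> = id"
      then have "map (h \<circ> (\<kappa> \<circ> \<rho>)) [0..<?n] = map (h \<circ> id) [0..<?n]"
        using h_iff lt \<rho>m by simp
      then show "word_subst s (perm_word ?n (\<kappa> \<circ> \<rho>)) = ?w" unfolding subst by (simp only:) }
  qed
  let ?u = "\<lambda>x. Poly_Mapping.single (s x) (1 :: 'f)" and ?c = "perm_sign (q + 1) ?n id :: 'f"
  have coeff: "Poly_Mapping.lookup (rect_term q N m (\<lambda>_. q) s \<kappa> \<rho>) ?w = (if \<kappa> = id then ?c else 0)"
    if "\<kappa> \<in> col_perms N m" "\<rho> \<in> row_perms N m" for \<kappa> \<rho>
  proof -
    have "Poly_Mapping.lookup (rect_term q N m (\<lambda>_. q) s \<kappa> \<rho>) ?w =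
      (if \<kappa> = id then koszul_sign (\<lambda>_. q) (perm_word ?n \<rho>) * (?c * perm_sign q ?n \<rho>) else 0)"
      using eq_iff[OF that] by (simp add: rect_term_def lookup_single when_def)
    moreover have "koszul_sign (\<lambda>_. q) (perm_word ?n \<rho>) * (?c * perm_sign q ?n \<rho>) = ?c"
      using koszul_sign_square[of "\<lambda>_. q" "perm_word ?n \<rho>", where ?'f = 'f]
      unfolding perm_sign_def by (metis mult.commute mult.left_commute mult_1_right)
    ultimately show ?thesis by simp
  qed
  have s: "set (letters (s x)) \<subseteq> X" for x using h by (simp add: s_def)
  have "Poly_Mapping.lookup (eval_npoly (free_superalg X gp) ?u (superization (\<lambda>_. q) (rect_poly q N m))) ?w =
    (\<Sum>\<kappa>\<in>col_perms N m. \<Sum>\<rho>\<in>row_perms N m. if \<kappa> = id then ?c else 0)"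
    unfolding eval_rect_poly_words[OF s] lookup_sum by (intro sum.cong refl coeff)
  also have "\<dots> = (\<Sum>\<kappa>\<in>col_perms N m. if \<kappa> = id then of_nat (card (row_perms N m)) * ?c else 0)"
    by (intro sum.cong refl) simp
  also have "\<dots> = of_nat (card (row_perms N m)) * ?c"
    using id by simp
  also have "\<dots> \<noteq> 0"
    using id by (auto simp: perm_sign_def card_eq_0_iff)
  finally have "?w \<in> Poly_Mapping.keys (eval_npoly (free_superalg X gp) ?u (superization (\<lambda>_. q) (rect_poly q N m)))"
    by (simp add: in_keys_iff)
  moreover have "\<not> metabelian_null ?w"
    unfolding subst using n by (intro not_metabelian_null_left_normed_Var) simp
  ultimately have not_null: "eval_npoly (free_superalg X gp) ?u (superization (\<lambda>_. q) (rect_poly q N m)) \<notin> null_span"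
    by (auto simp: null_span_def)
  have "?u x \<in> grade (free_superalg X gp) q" for x
    using h by (simp add: s_def word_parity_def)
  then show ?thesis using not_null by (rule that[of ?u])
qed

section \<open>Free metabelian superalgebras\<close>

abbreviation metabelian_poly :: "(nat, 'f::field) npoly"
  where "metabelian_poly \<equiv> Poly_Mapping.single (Times (Times (Var 0) (Var 1)) (Times (Var 2) (Var 3))) 1"

lemma multilinear_metabelian_poly: "multilinear metabelian_poly"
  unfolding multilinear_def by (intro exI[of _ "{0, 1, 2, 3}"]) auto

lemma superalgs_of_metabelian_iff:
  "A \<in> superalgs_of metabelian \<longleftrightarrow> superalgebra A \<and> satisfies_super A metabelian_poly"
proof (cases "superalgebra A")
  case True
  interpret plain_superalgebra A using True by (rule plain_superalgebra.intro)
  show ?thesis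
    unfolding superalgs_of_def in_variety_def metabelian_def
    using True nonassoc_algebra_G envelope_satisfies_iff[OF multilinear_metabelian_poly] by simp
qed (simp add: superalgs_of_def)

lemma eval_metabelian_poly:
  assumes "\<And>x. u x \<in> carrier (free_superalg X gp)"
  shows "eval_npoly (free_superalg X gp) u (superization par metabelian_poly) =
    Poly_Mapping.map ((*) (koszul_sign par (Times (Times (Var 0) (Var 1)) (Times (Var 2) (Var 3)))))
      (npoly_mult (npoly_mult (u 0) (u 1)) (npoly_mult (u 2) (u 3)) :: ('x, 'f::field) npoly)"
proof -
  interpret F: superalgebra "free_superalg X gp :: ('f, ('x, 'f) npoly) superalg" by (rule superalgebra_free)
  show ?thesis unfolding superization_single F.eval_npoly_single[OF assms] by simp
qed

text \<open>
  Substituting words for the variables of \<open>(x y) (z t)\<close> yields all words with two products as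
  factors at the top; the other null words are in the ideal generated by these.
\<close>

lemma null_words_in_metabelian_ideal:
  fixes J :: "('x, 'f::field) npoly set"
  assumes J: "graded_ideal J (free_superalg X gp)"
    and sat: "satisfies_super (quotient_superalg (free_superalg X gp) J) metabelian_poly"
    and "metabelian_null w" "set (letters w) \<subseteq> X"
  shows "Poly_Mapping.single w 1 \<in> J"
  using assms(3,4)
proof (induction w)
  case (Times u v)
  interpret free_ideal X gp J by (rule free_ideal.intro) (rule J)
  have c: "Poly_Mapping.single w (1 :: 'f) \<in> carrier F" if "set (letters w) \<subseteq> X" for w using that by simp
  have t: "Poly_Mapping.single (Times u v) (1 :: 'f) = npoly_mult (Poly_Mapping.single u 1) (Poly_Mapping.single v 1)"
    by simp
  from Times.prems consider "metabelian_null u" | "metabelian_null v" | "is_product u" "is_product v" by auto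
  then show ?case
  proof cases
    case 1
    then show ?thesis unfolding t using Times by (intro J_mult c) auto
  next
    case 2
    then show ?thesis unfolding t using Times by (intro J_mult c) auto
  next
    case 3
    then obtain w0 w1 w2 w3 where uv: "u = Times w0 w1" "v = Times w2 w3"
      by (cases u; cases v) auto
    let ?w = "\<lambda>x::nat. if x = 0 then w0 else if x = 1 then w1 else if x = 2 then w2 else w3"
    let ?par = "\<lambda>x. word_parity gp (?w x)"
    let ?m = "Times (Times (Var 0) (Var 1)) (Times (Var 2) (Var 3)) :: nat word"
    have w: "set (letters (?w x)) \<subseteq> X" for x using Times.prems(2) uv by simp
    have "\<forall>p u. (\<forall>x. u x \<in> grade F (p x)) \<longrightarrow> eval_npoly F u (superization p metabelian_poly) \<in> J"
      using sat by (simp only: Q_satisfies_super_iff)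
    then have "(\<forall>x. Poly_Mapping.single (?w x) 1 \<in> grade F (?par x)) \<longrightarrow>
        eval_npoly F (\<lambda>x. Poly_Mapping.single (?w x) 1) (superization ?par metabelian_poly) \<in> J"
      by (rule spec[where x = "\<lambda>x. Poly_Mapping.single (?w x) 1", OF spec[where x = ?par]])
    moreover have "\<forall>x. Poly_Mapping.single (?w x) 1 \<in> grade F (?par x)" using w by simp
    ultimately have "eval_npoly F (\<lambda>x. Poly_Mapping.single (?w x) 1) (superization ?par metabelian_poly) \<in> J"
      by (rule mp)
    then have "Poly_Mapping.map ((*) (koszul_sign ?par ?m)) (Poly_Mapping.single (Times u v) 1) \<in> J"
      unfolding eval_metabelian_poly[OF c[OF w]] by (simp add: uv)
    then have "Poly_Mapping.map ((*) (koszul_sign ?par ?m)) (Poly_Mapping.map ((*) (koszul_sign ?par ?m)) (Poly_Mapping.single (Times u v) 1)) \<in> J"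
      by (rule J_sub(4))
    then show ?thesis
      by (simp only: smult_simps(3)[symmetric] koszul_sign_square smult_simps(4))
  qed
qed simp

lemma null_span_subset_metabelian_ideal:
  fixes J :: "('x, 'f::field) npoly set"
  assumes J: "graded_ideal J (free_superalg X gp)"
    and sat: "satisfies_super (quotient_superalg (free_superalg X gp) J) metabelian_poly"
    and p: "p \<in> null_span" "p \<in> carrier (free_superalg X gp)"
  shows "p \<in> J"
proof -
  interpret free_ideal X gp J by (rule free_ideal.intro) (rule J)
  show ?thesis
  proof (induction p rule: npoly_induct)
    case zero
    show ?case by (rule J_sub(2))
  next
    case (add r w c)
    have "Poly_Mapping.single w 1 \<in> J"
      using p add(2) by (intro null_words_in_metabelian_ideal[OF J sat]) (auto simp: null_span_def)
    from J_sub(3)[OF J_sub(4)[OF this, of c] add(1)] show ?case by (simp add: Poly_Mapping.map_single)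
  qed
qed

definition metabelian_ideal :: "'x set \<Rightarrow> ('x, 'f::field) npoly set"
  where "metabelian_ideal X = null_span \<inter> {p. \<forall>w\<in>Poly_Mapping.keys p. set (letters w) \<subseteq> X}"

lemma graded_ideal_metabelian_ideal: "graded_ideal (metabelian_ideal X) (free_superalg X gp :: ('f::field, ('x, 'f) npoly) superalg)"
proof -
  let ?F = "free_superalg X gp :: ('f, ('x, 'f) npoly) superalg" and ?J = "metabelian_ideal X :: ('x, 'f) npoly set"
  interpret F: superalgebra ?F by (rule superalgebra_free)
  have J: "p \<in> ?J \<longleftrightarrow> p \<in> null_span \<and> p \<in> carrier ?F" for p by (simp add: metabelian_ideal_def)
  show ?thesis
    unfolding graded_ideal_def F.submodule_iff
  proof (intro conjI ballI allI)
    show "?J \<subseteq> carrier ?F" using J by blast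
    show "\<zero>\<^bsub>?F\<^esub> \<in> ?J" unfolding J using null_span_closed(1) by simp
    fix x y assume x: "x \<in> ?J" and y: "y \<in> ?J"
    then show "x \<oplus>\<^bsub>?F\<^esub> y \<in> ?J"
      using F.a_closed[of x y] null_span_closed(2)[of x y] unfolding J by simp
  next
    fix c x assume x: "x \<in> ?J"
    then show "c \<odot>\<^bsub>?F\<^esub> x \<in> ?J"
      using F.smult_carrier[of x c] null_span_closed(3)[of x c] unfolding J by simp
  next
    fix x y assume x: "x \<in> ?J" and y: "y \<in> carrier ?F"
    have "npoly_mult x y \<in> null_span" "npoly_mult y x \<in> null_span"
      using x unfolding J null_span_def by (auto elim!: keys_npoly_multE)
    then show "x \<otimes>\<^bsub>?F\<^esub> y \<in> ?J" "y \<otimes>\<^bsub>?F\<^esub> x \<in> ?J"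
      using x y F.mult_closed[of x y] F.mult_closed[of y x] unfolding J by simp_all
  next
    fix x assume x: "x \<in> ?J"
    let ?p = "\<lambda>i. npoly_filter (\<lambda>w. word_parity gp w = i) x"
    have keys: "Poly_Mapping.keys (?p i) = {w \<in> Poly_Mapping.keys x. word_parity gp w = i}" for i
      by (auto simp: in_keys_iff)
    have "?p i \<in> ?J \<inter> grade ?F i" for i
      using x by (simp add: metabelian_ideal_def null_span_def keys)
    moreover have "x = ?p 0 \<oplus>\<^bsub>?F\<^esub> ?p 1"
      by (rule poly_mapping_eqI) (auto simp: lookup_add when_def)
    ultimately show "\<exists>x0\<in>?J \<inter> grade ?F 0. \<exists>x1\<in>?J \<inter> grade ?F 1. x = x0 \<oplus>\<^bsub>?F\<^esub> x1" by blast
  qed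
qed

lemma metabelian_ideal_quotient:
  "quotient_superalg (free_superalg X gp) (metabelian_ideal X) \<in> superalgs_of (metabelian :: (nat, 'f::field) npoly set)"
proof -
  interpret free_ideal X gp "metabelian_ideal X :: ('a, 'f) npoly set"
    by (rule free_ideal.intro) (rule graded_ideal_metabelian_ideal)
  have "satisfies_super Q metabelian_poly"
    unfolding Q_satisfies_super_iff
  proof (intro allI impI)
    fix p :: "nat \<Rightarrow> bit" and u assume "\<forall>x. u x \<in> grade F (p x)"
    then have u: "u x \<in> carrier F" for x using F.grade_carrier by blast
    let ?v = "npoly_mult (npoly_mult (u 0) (u 1)) (npoly_mult (u 2) (u 3))"
    have "?v \<in> carrier F"
      using F.mult_closed[OF F.mult_closed[OF u u] F.mult_closed[OF u u], of 0 1 2 3] by (simp only: free_simps(2))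
    moreover have "?v \<in> null_span"
      by (auto simp: null_span_def elim!: keys_npoly_multE)
    ultimately have "?v \<in> metabelian_ideal X" by (simp add: metabelian_ideal_def)
    then show "eval_npoly F u (superization p metabelian_poly) \<in> metabelian_ideal X"
      unfolding eval_metabelian_poly[OF u] by (rule J_sub(4))
  qed
  then show ?thesis using superalgebra_Q by (simp add: superalgs_of_metabelian_iff)
qed

text \<open>
  Thus the free metabelian superalgebra is explicit: modulo this ideal the words that are not null
  are linearly independent.
\<close>

lemma relative_ideal_metabelian:
  "relative_ideal (superalgs_of (metabelian :: (nat, 'f::field) npoly set)) X gp = (metabelian_ideal X :: ('x, 'f) npoly set)"
proof
  show "relative_ideal (superalgs_of (metabelian :: (nat, 'f) npoly set)) X gp \<subseteq> (metabelian_ideal X :: ('x, 'f) npoly set)"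
    by (rule relative_ideal_subset[OF graded_ideal_metabelian_ideal metabelian_ideal_quotient])
  have "metabelian_ideal X \<subseteq> J"
    if "graded_ideal J (free_superalg X gp)" "quotient_superalg (free_superalg X gp) J \<in> superalgs_of metabelian"
    for J :: "('x, 'f) npoly set"
    using null_span_subset_metabelian_ideal[OF that(1)] that(2)
    unfolding superalgs_of_metabelian_iff metabelian_ideal_def by auto
  then show "(metabelian_ideal X :: ('x, 'f) npoly set) \<subseteq> relative_ideal (superalgs_of (metabelian :: (nat, 'f) npoly set)) X gp"
    unfolding relative_ideal_def by blast
qed

lemma free_metabelian_eq:
  "free_V_superalg (metabelian :: (nat, 'f::field) npoly set) r s =
    quotient_superalg (free_superalg (gens r s) gen_parity) (metabelian_ideal (gens r s))"
  by (simp only: free_V_superalg_def relatively_free_eq relative_ideal_metabelian)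

lemma superalgebra_free_metabelian: "superalgebra (free_V_superalg (metabelian :: (nat, 'f::field) npoly set) r s)"
proof -
  interpret free_ideal "gens r s" gen_parity "metabelian_ideal (gens r s) :: 'f gpoly set"
    by (rule free_ideal.intro) (rule graded_ideal_metabelian_ideal)
  show ?thesis unfolding free_metabelian_eq by (rule superalgebra_Q)
qed

lemma free_metabelian_satisfies: "satisfies_super (free_V_superalg (metabelian :: (nat, 'f::field) npoly set) r s) metabelian_poly"
  using metabelian_ideal_quotient unfolding free_metabelian_eq superalgs_of_metabelian_iff by blast

definition gen_of :: "bit \<Rightarrow> nat \<Rightarrow> nat + nat" where "gen_of q i = (if q = 0 then Inl i else Inr i)"

lemma gen_of: "inj (gen_of q)" "gen_parity (gen_of q i) = q"
  by (auto simp: gen_of_def gen_parity_def inj_on_def)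

lemma gens_of_parity:
  "{g \<in> gens r s. gen_parity g = q} = gen_of q ` {..<(if q = 0 then r else s)}"
  by (auto simp: gens_def gen_of_def gen_parity_def)

lemma card_gens_of_parity: "card {g \<in> gens r s. gen_parity g = q} = (if q = 0 then r else s)"
  unfolding gens_of_parity by (subst card_image) (auto intro: inj_on_subset[OF gen_of(1)])

lemma finite_gens: "finite (gens r s)"
  by (simp add: gens_def)

lemma free_metabelian_not_rect_poly:
  assumes "(if q = 0 then r else s) = N" "N > 0" "m > 0"
  shows "\<not> satisfies_super (free_V_superalg (metabelian :: (nat, 'f::field_char_0) npoly set) r s) (rect_poly q N m)"
proof
  let ?J = "metabelian_ideal (gens r s) :: 'f gpoly set"
  interpret free_ideal "gens r s" gen_parity ?J
    by (rule free_ideal.intro) (rule graded_ideal_metabelian_ideal)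
  assume "satisfies_super (free_V_superalg (metabelian :: (nat, 'f) npoly set) r s) (rect_poly q N m)"
  then have sat: "\<forall>p u. (\<forall>x. u x \<in> grade F (p x)) \<longrightarrow> eval_npoly F u (superization p (rect_poly q N m)) \<in> ?J"
    by (simp only: free_metabelian_eq Q_satisfies_super_iff)
  have gen: "gen_of q i \<in> gens r s \<and> gen_parity (gen_of q i) = q" if "i < N" for i
    using gens_of_parity[of r s q] assms(1) that by auto
  show False
  proof (rule rect_poly_enough_generators[OF inj_on_subset[OF gen_of(1) subset_UNIV] gen assms(2,3)])
    fix u :: "nat \<Rightarrow> 'f gpoly"
    assume u: "\<And>x. u x \<in> grade F q" "eval_npoly F u (superization (\<lambda>_. q) (rect_poly q N m)) \<notin> null_span"
    have "eval_npoly F u (superization (\<lambda>_. q) (rect_poly q N m)) \<in> ?J"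
      using sat[rule_format, of u "\<lambda>_. q"] u(1) by blast
    then show False using u(2) by (simp add: metabelian_ideal_def)
  qed
qed

section \<open>The basic spectrum\<close>

context
  fixes r s :: nat and I :: "(nat, 'f::field_char_0) npoly set" and B :: "('f, 'f gpoly set) superalg"
  defines "B \<equiv> free_V_superalg metabelian r s"
  defines "I \<equiv> envelope_identities B"
begin

lemma superalgs_of_I: "superalgs_of I = (supervariety_generated_by B :: ('f, 'u) superalg set)"
  unfolding I_def by (rule superalgs_of_envelope_identities) (simp only: B_def superalgebra_free_metabelian)

lemma I_metabelian: "A \<in> superalgs_of I \<Longrightarrow> A \<in> superalgs_of metabelian"
  unfolding superalgs_of_I superalgs_of_metabelian_iff supervariety_generated_by_def
  using multilinear_metabelian_poly free_metabelian_satisfies unfolding B_def by blast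

lemma B_in: "B \<in> superalgs_of I"
  unfolding superalgs_of_I supervariety_generated_by_def
  using superalgebra_free_metabelian unfolding B_def by blast

text \<open>
  Since \<open>B\<close> itself belongs to the class defined by \<open>I\<close>, the free superalgebra of that class on the same
  generators satisfies no relations beyond the metabelian ones.
\<close>

lemma free_I_eq: "free_V_superalg I r s = B"
proof -
  have "relative_ideal (superalgs_of I) (gens r s) gen_parity = metabelian_ideal (gens r s)"
  proof
    show "relative_ideal (superalgs_of I) (gens r s) gen_parity \<subseteq> metabelian_ideal (gens r s)"
      by (rule relative_ideal_subset[OF graded_ideal_metabelian_ideal]) (use B_in in \<open>simp only: B_def free_metabelian_eq\<close>)
    have "relative_ideal (superalgs_of metabelian) (gens r s) gen_parity \<subseteq> relative_ideal (superalgs_of I) (gens r s) gen_parity"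
      unfolding relative_ideal_def using I_metabelian by blast
    then show "metabelian_ideal (gens r s) \<subseteq> relative_ideal (superalgs_of I) (gens r s) gen_parity"
      by (simp only: relative_ideal_metabelian)
  qed
  then have "free_V_superalg I r s = quotient_superalg (free_superalg (gens r s) gen_parity) (metabelian_ideal (gens r s))"
    unfolding free_V_superalg_def relatively_free_eq by (simp only:)
  then show ?thesis by (simp only: B_def free_metabelian_eq)
qed

text \<open>
  Every value of the superization is a combination of null words, and these vanish in all
  superalgebras of the class because they are metabelian.
\<close>

lemma free_I_satisfies_rect_poly:
  assumes N: "(if q = 0 then r' else s') < N" and m: "m = N * (if q = 0 then s' else r') + 2"
  shows "satisfies_super (free_V_superalg I r' s') (rect_poly q N m)"
proof -
  let ?X = "gens r' s'" and ?C = "superalgs_of I :: ('f, 'f gpoly set) superalg set"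
  interpret B: superalgebra B using superalgebra_free_metabelian unfolding B_def .
  let ?K = "eval_kernel B (\<lambda>_. \<zero>\<^bsub>B\<^esub>) ?X"
  have K: "graded_ideal ?K (free_superalg ?X gen_parity)"
    by (rule graded_ideal_eval_kernel) (rule B.superalgebra_axioms, rule B.grade_zero)
  have KC: "quotient_superalg (free_superalg ?X gen_parity) ?K \<in> ?C"
    unfolding superalgs_of_I by (rule supervariety_ideal(2)) (rule B.superalgebra_axioms, assumption, rule B.grade_zero)
  have other: "card {g \<in> ?X. gen_parity g \<noteq> q} = (if q = 0 then s' else r')"
    using card_gens_of_parity[of r' s' "q + 1"] by (cases "q = 1") simp_all
  interpret R: free_ideal ?X gen_parity "relative_ideal ?C ?X gen_parity"
    by (rule free_ideal.intro) (rule graded_ideal_relative_ideal[OF K KC])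
  show ?thesis
    unfolding free_V_superalg_def relatively_free_eq R.Q_satisfies_super_iff
  proof (intro allI impI)
    fix p :: "nat \<Rightarrow> bit" and u assume u: "\<forall>x. u x \<in> grade R.F (p x)"
    let ?e = "eval_npoly R.F u (superization p (rect_poly q N m))"
    have "?e \<in> null_span"
      using u N m by (intro rect_poly_few_generators[OF finite_gens]) (simp_all only: card_gens_of_parity other)
    moreover have "?e \<in> carrier R.F"
      using u R.F.grade_carrier by (intro R.F.eval_npoly_closed) blast
    ultimately have "?e \<in> J" if "graded_ideal J R.F" "quotient_superalg R.F J \<in> ?C" for J
      using null_span_subset_metabelian_ideal[OF that(1)] I_metabelian[OF that(2)]
      unfolding superalgs_of_metabelian_iff by blast
    then show "?e \<in> relative_ideal ?C ?X gen_parity"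
      unfolding relative_ideal_def by blast
  qed
qed

end

lemma satisfies_super_hom_image:
  fixes A :: "('f::field, 'a) superalg" and B :: "('f, 'b) superalg"
  assumes h: "alg_hom h A B" and A: "superalgebra A" and B: "superalgebra B"
    and gr: "\<And>i. grade B i = h ` grade A i" and inj: "inj_on h (carrier A)"
  shows "satisfies_super B f \<longleftrightarrow> satisfies_super A f"
proof -
  interpret A: superalgebra A by fact
  interpret B: superalgebra B by fact
  have h0: "h \<zero>\<^bsub>A\<^esub> = \<zero>\<^bsub>B\<^esub>"
    by (rule alg_hom_zero[OF h A.nonassoc_algebra_axioms B.nonassoc_algebra_axioms])
  have eval: "eval_npoly B (\<lambda>x. h (v x)) g = \<zero>\<^bsub>B\<^esub> \<longleftrightarrow> eval_npoly A v g = \<zero>\<^bsub>A\<^esub>"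
    if v: "\<And>x. v x \<in> carrier A" for v :: "nat \<Rightarrow> 'a" and g
  proof -
    have e: "eval_npoly B (\<lambda>x. h (v x)) g = h (eval_npoly A v g)"
      by (rule eval_npoly_hom[OF h A.nonassoc_algebra_axioms B.nonassoc_algebra_axioms]) (rule v)
    have "eval_npoly A v g = \<zero>\<^bsub>A\<^esub>" if "h (eval_npoly A v g) = h \<zero>\<^bsub>A\<^esub>"
      using that by (rule inj_onD[OF inj]) (rule A.eval_npoly_closed, rule v, rule A.zero_closed)
    then show ?thesis unfolding e h0[symmetric] by (metis (no_types))
  qed
  show ?thesis
  proof
    assume sat: "satisfies_super B f"
    show "satisfies_super A f"
      unfolding satisfies_super_def
    proof (intro allI impI)
      fix par :: "nat \<Rightarrow> bit" and v assume v: "\<forall>x. v x \<in> grade A (par x)"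
      then have "eval_npoly B (\<lambda>x. h (v x)) (superization par f) = \<zero>\<^bsub>B\<^esub>"
        by (intro satisfies_super_grade[OF sat]) (simp add: gr)
      moreover have "v x \<in> carrier A" for x using v A.grade_carrier by blast
      ultimately show "eval_npoly A v (superization par f) = \<zero>\<^bsub>A\<^esub>"
        by (simp only: eval)
    qed
  next
    assume sat: "satisfies_super A f"
    show "satisfies_super B f"
      unfolding satisfies_super_def
    proof (intro allI impI)
      fix par :: "nat \<Rightarrow> bit" and v assume "\<forall>x. v x \<in> grade B (par x)"
      then have "\<forall>x. \<exists>a. a \<in> grade A (par x) \<and> v x = h a" unfolding gr by blast
      then obtain u where u: "\<And>x. u x \<in> grade A (par x)" "\<And>x. v x = h (u x)" by metis
      have "eval_npoly B (\<lambda>x. h (u x)) (superization par f) = \<zero>\<^bsub>B\<^esub>"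
        using satisfies_super_grade[OF sat u(1)] eval[of u] A.grade_carrier[OF u(1)] by (simp only: simp_thms)
      moreover have "v = (\<lambda>x. h (u x))" using u(2) by blast
      ultimately show "eval_npoly B v (superization par f) = \<zero>\<^bsub>B\<^esub>" by simp
    qed
  qed
qed

lemma superalgebra_copy:
  fixes A :: "('f::field, 'a) superalg" and h :: "'a \<Rightarrow> 'u"
  assumes A: "superalgebra A" and inj: "inj_on h (carrier A)"
  obtains C :: "('f, 'u) superalg" where "superalgebra C" "\<And>f. satisfies_super C f \<longleftrightarrow> satisfies_super A f"
proof -
  interpret A: superalgebra A by fact
  let ?g = "inv_into (carrier A) h"
  define C :: "('f, 'u) superalg" where "C = \<lparr>carrier = h ` carrier A, monoid.mult = (\<lambda>x y. h (?g x \<otimes>\<^bsub>A\<^esub> ?g y)),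
    monoid.one = h \<zero>\<^bsub>A\<^esub>, ring.zero = h \<zero>\<^bsub>A\<^esub>, ring.add = (\<lambda>x y. h (?g x \<oplus>\<^bsub>A\<^esub> ?g y)),
    smult = (\<lambda>c x. h (c \<odot>\<^bsub>A\<^esub> ?g x)), grade = (\<lambda>i. h ` grade A i)\<rparr>"
  have gh: "?g (h x) = x" if "x \<in> carrier A" for x using that inj by simp
  have hom: "alg_hom h A C" by (simp add: alg_hom_def C_def gh)
  have C: "superalgebra C"
  proof (rule superalgebra_image[OF A hom])
    show "grade C 0 \<inter> grade C 1 \<subseteq> {\<zero>\<^bsub>C\<^esub>}"
    proof
      fix y assume "y \<in> grade C 0 \<inter> grade C 1"
      then obtain x0 x1 where x: "x0 \<in> grade A 0" "x1 \<in> grade A 1" "y = h x0" "y = h x1"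
        by (auto simp: C_def)
      then have "x0 = x1" using inj A.grade_carrier by (metis inj_onD)
      then have "x0 = \<zero>\<^bsub>A\<^esub>" using A.grade_both x by blast
      then show "y \<in> {\<zero>\<^bsub>C\<^esub>}" using x by (simp add: C_def)
    qed
  qed (simp_all add: C_def)
  have "satisfies_super C f \<longleftrightarrow> satisfies_super A f" for f
    by (rule satisfies_super_hom_image[OF hom A C _ inj]) (simp add: C_def)
  with C show ?thesis by (rule that)
qed

context free_ideal
begin

text \<open>
  Choosing coset representatives embeds the quotient into the space of polynomials, hence into every
  large universe.
\<close>

lemma inj_on_representative: "inj_on (\<lambda>K. SOME p. p \<in> K) (carrier Q)"
proof (rule inj_onI)
  fix K L assume "K \<in> carrier Q" "L \<in> carrier Q" and eq: "(SOME p. p \<in> K) = (SOME p. p \<in> L)"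
  then obtain x y where xy: "K = proj x" "L = proj y" unfolding Q_simps by blast
  have "(SOME p. p \<in> K) \<in> K"
    by (rule someI[of "\<lambda>p. p \<in> K" x]) (simp only: xy proj_self)
  moreover have "(SOME p. p \<in> L) \<in> L"
    by (rule someI[of "\<lambda>p. p \<in> L" y]) (simp only: xy proj_self)
  ultimately have "(SOME p. p \<in> K) \<in> proj x" "(SOME p. p \<in> K) \<in> proj y" using eq xy by simp_all
  then have "x - y \<in> J" using J_diff[of "(SOME p. p \<in> K) - y" "(SOME p. p \<in> K) - x"] by (simp add: in_proj)
  then show "K = L" by (simp add: xy proj_eq_iff)
qed

end

theorem corollary5p2:
  fixes r s :: nat
  assumes "large_universe TYPE('f::field_char_0) TYPE('u)"
    and "(r, s) \<noteq> (0, 0)"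
  shows "basic_spectrum TYPE('u)
    (variety_generated_by
      (grassmann_envelope
        (countable_free_superalg (supervariety_rs (metabelian :: (nat, 'f) npoly set) r s))))
    = {(r, s)}"
proof -
  let ?B = "free_V_superalg (metabelian :: (nat, 'f) npoly set) r s"
  define I where "I = envelope_identities ?B"
  have I_eq: "variety_generated_by (grassmann_envelope
      (countable_free_superalg (supervariety_rs (metabelian :: (nat, 'f) npoly set) r s))) = I"
    using assms(2) unfolding I_def envelope_identities_def supervariety_rs_def by (simp only: if_False)
  obtain emb :: "'f gpoly \<Rightarrow> 'u" where emb: "inj emb"
    using assms(1) unfolding large_universe_def by blast
  let ?U = "superalgs_of I :: ('f, 'u) superalg set"
  have gen: "supervariety_rs I r s = ?U"
    using assms(2) unfolding supervariety_rs_def I_def by (simp only: if_False free_I_eq superalgs_of_I)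
  interpret B: free_ideal "gens r s" gen_parity "metabelian_ideal (gens r s) :: 'f gpoly set"
    by (rule free_ideal.intro) (rule graded_ideal_metabelian_ideal)
  have "inj_on (emb \<circ> (\<lambda>K. SOME p. p \<in> K)) (carrier B.Q)"
    by (rule comp_inj_on[OF B.inj_on_representative inj_on_subset[OF emb subset_UNIV]])
  then have "\<exists>C :: ('f, 'u) superalg. superalgebra C \<and> (\<forall>f. satisfies_super C f \<longleftrightarrow> satisfies_super B.Q f)"
    by (rule superalgebra_copy[OF B.superalgebra_Q]) blast
  then obtain C :: "('f, 'u) superalg" where C: "superalgebra C" "\<And>f. satisfies_super C f \<longleftrightarrow> satisfies_super ?B f"
    unfolding free_metabelian_eq by blast
  have CU: "C \<in> ?U"
    unfolding I_def superalgs_of_I supervariety_generated_by_def using C by blast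
  have small: "r \<le> r' \<and> s \<le> s'" if eq: "supervariety_rs I r' s' = ?U" for r' s'
  proof (rule ccontr)
    assume "\<not> (r \<le> r' \<and> s \<le> s')"
    \<comment> \<open>\<open>q\<close> is the parity in which there are too few generators, and \<open>N\<close> the number required\<close>
    then obtain q :: bit where q: "(if q = 0 then r' else s') < (if q = 0 then r else s)"
      by (metis linorder_not_le zero_neq_one)
    define N where "N = (if q = 0 then r else s)"
    define m where "m = N * (if q = 0 then s' else r') + 2"
    have pos: "N > 0" "m > 0" using q by (simp_all add: N_def m_def split: if_splits)
    let ?f = "rect_poly q N m :: (nat, 'f) npoly"
    have lin: "multilinear ?f"
      unfolding multilinear_def using multilinear_rect_poly[of N m _ q] pos by (intro exI[of _ "{..<N * m}"]) auto
    have "C \<in> supervariety_rs I r' s'" using CU eq by simp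
    then have "satisfies_super C ?f"
    proof (cases "(r', s') = (0, 0)")
      case True
      with \<open>C \<in> supervariety_rs I r' s'\<close> have "carrier C = {\<zero>\<^bsub>C\<^esub>}"
        by (simp add: supervariety_rs_def)
      moreover interpret C: superalgebra C by (rule C(1))
      have "eval_npoly C v (superization par ?f) \<in> carrier C" if "\<forall>x. v x \<in> grade C (par x)" for par v
        using that C.grade_carrier by (intro C.eval_npoly_closed) blast
      ultimately show ?thesis unfolding satisfies_super_def by blast
    next
      case False
      with \<open>C \<in> supervariety_rs I r' s'\<close> have "C \<in> supervariety_generated_by (free_V_superalg I r' s')"
        by (simp only: supervariety_rs_def if_False)
      moreover have "satisfies_super (free_V_superalg I r' s') ?f"
        unfolding I_def by (rule free_I_satisfies_rect_poly) (use q in \<open>simp_all only: N_def m_def\<close>)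
      ultimately show ?thesis using lin unfolding supervariety_generated_by_def by blast
    qed
    then show False
      using C(2) free_metabelian_not_rect_poly[OF N_def[symmetric] pos] by blast
  qed
  show ?thesis
    unfolding I_eq basic_spectrum_def is_basic_superrank_def
    using gen small by (auto 0 3 dest: small)
qed

end
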